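(* Let $n\ge 2$. The identity component of the isometry group of the Riemannian manifold $\mathrm{SO}(n)\backslash \mathrm{SO}_0(n,1)$ is $$\mathrm{Isom}_0\big(\mathrm{SO}(n)\backslash \mathrm{SO}_0(n,1)\big)=r(\mathrm{SO}(n)),$$ where $r(\mathrm{SO}(n))$ denotes the group of isometries $Kg\mapsto Kgk$, $k\in K$.
   Context: Let $J=\mathrm{diag}(-1,\dots,-1,1)$ (of size $n+1$, with $n$ entries $-1$) and let $G=\mathrm{SO}_0(n,1)$ be the identity component of $\{A\in \mathrm{GL}(n+1,\mathbb R): AJA^t=J\}$. Let $K=\mathrm{SO}(n)\times\{1\}\subset G$ (block diagonal), identified with $\mathrm{SO}(n)$. With $e_{ij}$ the elementary matrices, set $E_{ij}=\epsilon_{ij}e_{ij}+e_{ji}$ for $1\le i<j\le n+1$, where $\epsilon_{ij}=-1$ if $j<n+1$ and $\epsilon_{ij}=1$ if $j=n+1$; these form a basis of the Lie algebra of $G$. Give $G$ the left-invariant Riemannian metric for which $\{E_{ij}\}$ is orthonormal at the identity. The subgroup $K$ acts on $G$ by left multiplication, freely, properly and isometrically, and $\mathrm{SO}(n)\backslash\mathrm{SO}_0(n,1)=K\backslash G$ carries the unique Riemannian metric making the projection $G\to K\backslash G$ a Riemannian submersion. Right multiplication by $k\in K$ is an isometry of $G$ and induces the isometry $r(k)\cdot(Kg)=Kgk$ of $K\backslash G$. $\mathrm{Isom}_0$ denotes the identity component of the isometry group. *)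

theory Defs
  imports "HOL-Analysis.Analysis"
begin

section \<open>Smooth functions\<close>

text \<open>Only meant for open sets \<open>U\<close> in finite-dimensional spaces.\<close>

primrec C_on :: "nat \<Rightarrow> 'a::real_normed_vector set \<Rightarrow> ('a \<Rightarrow> 'b::real_normed_vector) \<Rightarrow> bool" where
  "C_on 0 = (\<lambda>U f. continuous_on U f)"
| "C_on (Suc k) = (\<lambda>U f. (\<forall>x\<in>U. f differentiable (at x)) \<and>
      (\<forall>v. C_on k U (\<lambda>x. frechet_derivative f (at x) v)))"

definition smooth_on :: "'a::real_normed_vector set \<Rightarrow> ('a \<Rightarrow> 'b::real_normed_vector) \<Rightarrow> bool" where
  "smooth_on U f \<longleftrightarrow> (\<forall>k. C_on k U f)"

text \<open>The smooth real functions on an embedded submanifold \<open>S\<close>. Values off \<open>S\<close> are ignored.\<close>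

definition smooth_functions :: "'a::euclidean_space set \<Rightarrow> ('a \<Rightarrow> real) set" where
  "smooth_functions S = {f. \<forall>x\<in>S. \<exists>U h. open U \<and> x \<in> U \<and> smooth_on U h \<and> (\<forall>y\<in>S \<inter> U. f y = h y)}"

definition smooth_curves :: "'a::euclidean_space set \<Rightarrow> 'a \<Rightarrow> (real \<Rightarrow> 'a) set" where
  "smooth_curves S x = {c. c 0 = x \<and> (\<exists>e>0. smooth_on {-e<..<e} c \<and> c ` {-e<..<e} \<subseteq> S)}"

definition tangent_vectors :: "'a::euclidean_space set \<Rightarrow> 'a \<Rightarrow> 'a set" where
  "tangent_vectors S x = {v. \<exists>c\<in>smooth_curves S x. (c has_vector_derivative v) (at 0)}"


section \<open>The groups\<close>

text \<open>
  The row and column indices \<open>1, \<dots>, n, n+1\<close> are rendered by the type \<open>'n option\<close> with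
  \<open>CARD('n) = n\<close>: the indices \<open>1, \<dots>, n\<close> are \<open>Some i\<close>, in the order of \<open>'n\<close>, and the last index
  \<open>n+1\<close> is \<open>None\<close>.
\<close>

type_synonym 'n mat1 = "real ^ 'n option ^ 'n option"

fun index_less :: "'n::linorder option \<Rightarrow> 'n option \<Rightarrow> bool" where
  "index_less (Some i) (Some j) \<longleftrightarrow> i < j"
| "index_less (Some i) None \<longleftrightarrow> True"
| "index_less None j \<longleftrightarrow> False"

definition J_mat :: "'n::finite mat1" where
  "J_mat = (\<chi> i j. if i = j then (if i = None then 1 else -1) else 0)"

definition G :: "'n::finite mat1 set" where
  "G = connected_component_set {A. invertible A \<and> A ** J_mat ** transpose A = J_mat} (mat 1)"

definition SO :: "(real ^ 'n ^ 'n::finite) set" where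
  "SO = {k. orthogonal_matrix k \<and> det k = 1}"

definition block_diag :: "real ^ 'n ^ 'n::finite \<Rightarrow> 'n mat1" where
  "block_diag k = (\<chi> i j. case (i, j) of (Some a, Some b) \<Rightarrow> k $ a $ b
                                       | (None, None) \<Rightarrow> 1
                                       | _ \<Rightarrow> 0)"

definition K :: "'n::finite mat1 set" where
  "K = block_diag ` SO"


section \<open>The left-invariant metric on the group\<close>

definition e_mat :: "'n option \<Rightarrow> 'n option \<Rightarrow> 'n::finite mat1" where
  "e_mat i j = (\<chi> a b. if a = i \<and> b = j then 1 else 0)"

definition E_mat :: "'n option \<Rightarrow> 'n option \<Rightarrow> 'n::finite mat1" where
  "E_mat i j = (if j = None then 1 else -1) *\<^sub>R e_mat i j + e_mat j i"

definition E_basis :: "'n::{finite,linorder} mat1 set" where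
  "E_basis = {E_mat i j | i j. index_less i j}"

text \<open>The inner product on the Lie algebra, the span of \<open>E_basis\<close>, for which \<open>E_basis\<close> is orthonormal.\<close>

definition lie_inner :: "'n::{finite,linorder} mat1 \<Rightarrow> 'n mat1 \<Rightarrow> real" where
  "lie_inner X Y = (\<Sum>b\<in>E_basis. representation E_basis X b * representation E_basis Y b)"

definition G_metric :: "'n::{finite,linorder} mat1 \<Rightarrow> 'n mat1 \<Rightarrow> 'n mat1 \<Rightarrow> real" where
  "G_metric g v w = lie_inner (matrix_inv g ** v) (matrix_inv g ** w)"


section \<open>The quotient manifold\<close>

definition coset :: "'n::finite mat1 \<Rightarrow> 'n mat1 set" where
  "coset g = (\<lambda>k. k ** g) ` K"

definition Q :: "'n::finite mat1 set set" where
  "Q = coset ` G"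

definition Q_topology :: "'n::finite mat1 set topology" where
  "Q_topology = topology (\<lambda>U. U \<subseteq> Q \<and> openin (top_of_set G) {g \<in> G. coset g \<in> U})"

text \<open>
  The smooth structure is the one for which the projection \<open>coset\<close> is a submersion. It is given
  by its algebra of smooth functions, namely those whose pullback to \<open>G\<close> is smooth; tangent
  vectors are derivations of that algebra, extended by \<open>0\<close> to the other functions.
\<close>

definition Q_functions :: "('n::finite mat1 set \<Rightarrow> real) set" where
  "Q_functions = {\<phi>. (\<lambda>g. \<phi> (coset g)) \<in> smooth_functions G}"

definition Q_tangent :: "'n::finite mat1 set \<Rightarrow> (('n mat1 set \<Rightarrow> real) \<Rightarrow> real) set" where
  "Q_tangent p = {X. (\<forall>\<phi>. \<phi> \<notin> Q_functions \<longrightarrow> X \<phi> = 0) \<and>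
     (\<forall>\<phi>\<in>Q_functions. \<forall>\<psi>\<in>Q_functions. \<forall>a b. X (\<lambda>q. a * \<phi> q + b * \<psi> q) = a * X \<phi> + b * X \<psi>) \<and>
     (\<forall>\<phi>\<in>Q_functions. \<forall>\<psi>\<in>Q_functions. X (\<lambda>q. \<phi> q * \<psi> q) = \<phi> p * X \<psi> + X \<phi> * \<psi> p)}"

definition Q_smooth_map :: "('n::finite mat1 set \<Rightarrow> 'n mat1 set) \<Rightarrow> bool" where
  "Q_smooth_map F \<longleftrightarrow> F ` Q \<subseteq> Q \<and> (\<forall>\<phi>\<in>Q_functions. \<phi> \<circ> F \<in> Q_functions)"

definition Q_differential ::
  "('n::finite mat1 set \<Rightarrow> 'n mat1 set) \<Rightarrow> (('n mat1 set \<Rightarrow> real) \<Rightarrow> real) \<Rightarrow> ('n mat1 set \<Rightarrow> real) \<Rightarrow> real"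
  where "Q_differential F X = (\<lambda>\<phi>. if \<phi> \<in> Q_functions then X (\<phi> \<circ> F) else 0)"

text \<open>The differential at \<open>g\<close> of the projection \<open>coset\<close>, applied to a tangent vector \<open>v\<close> of \<open>G\<close> at \<open>g\<close>.\<close>

definition coset_differential ::
  "'n::finite mat1 \<Rightarrow> 'n mat1 \<Rightarrow> ('n mat1 set \<Rightarrow> real) \<Rightarrow> real" where
  "coset_differential g v = (\<lambda>\<phi>. if \<phi> \<in> Q_functions
     then THE d. \<forall>c\<in>smooth_curves G g. (c has_vector_derivative v) (at 0) \<longrightarrow>
                   ((\<lambda>t. \<phi> (coset (c t))) has_real_derivative d) (at 0)
     else 0)"


section \<open>The quotient metric and its isometries\<close>

definition vertical :: "'n::finite mat1 \<Rightarrow> 'n mat1 set" where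
  "vertical g = {v \<in> tangent_vectors G g. coset_differential g v = (\<lambda>\<phi>. 0)}"

definition horizontal :: "'n::{finite,linorder} mat1 \<Rightarrow> 'n mat1 set" where
  "horizontal g = {v \<in> tangent_vectors G g. \<forall>w\<in>vertical g. G_metric g v w = 0}"

text \<open>
  The metric making \<open>coset\<close> a Riemannian submersion: its differential at every \<open>g\<close> maps the
  horizontal space at \<open>g\<close> isometrically onto the tangent space at \<open>coset g\<close>. The choice of \<open>g\<close> in
  its coset does not matter since \<open>K\<close> acts isometrically from the left.
\<close>

definition Q_metric :: "'n::{finite,linorder} mat1 set \<Rightarrow> (('n mat1 set \<Rightarrow> real) \<Rightarrow> real) \<Rightarrow>
    (('n mat1 set \<Rightarrow> real) \<Rightarrow> real) \<Rightarrow> real" where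
  "Q_metric p X Y = (THE r. \<forall>g\<in>G. \<forall>v\<in>horizontal g. \<forall>w\<in>horizontal g.
     coset g = p \<and> coset_differential g v = X \<and> coset_differential g w = Y \<longrightarrow> r = G_metric g v w)"

text \<open>
  Self-maps of \<open>Q\<close> are taken in \<open>extensional Q\<close> (undefined off \<open>Q\<close>), so that equality of functions
  is equality of maps on \<open>Q\<close>.
\<close>

definition Isom :: "('n::{finite,linorder} mat1 set \<Rightarrow> 'n mat1 set) set" where
  "Isom = {F \<in> extensional Q. bij_betw F Q Q \<and> Q_smooth_map F \<and> Q_smooth_map (inv_into Q F) \<and>
     (\<forall>p\<in>Q. \<forall>X\<in>Q_tangent p. \<forall>Y\<in>Q_tangent p.
        Q_metric (F p) (Q_differential F X) (Q_differential F Y) = Q_metric p X Y)}"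

text \<open>The compact-open topology.\<close>

definition Isom_topology :: "('n::{finite,linorder} mat1 set \<Rightarrow> 'n mat1 set) topology" where
  "Isom_topology = topology_generated_by
     {{F \<in> Isom. F ` C \<subseteq> U} | C U. compactin Q_topology C \<and> openin Q_topology U}"

definition Isom0 :: "('n::{finite,linorder} mat1 set \<Rightarrow> 'n mat1 set) set" where
  "Isom0 = connected_component_of_set Isom_topology (restrict id Q)"

definition right_action :: "real ^ 'n ^ 'n::finite \<Rightarrow> 'n mat1 set \<Rightarrow> 'n mat1 set" where
  "right_action k = (\<lambda>p\<in>Q. (\<lambda>g. g ** block_diag k) ` p)"


section \<open>Sanity checks\<close>

lemma openin_Q_topology:
  fixes U :: "'n::finite mat1 set set"
  shows "openin Q_topology U \<longleftrightarrow> U \<subseteq> Q \<and> openin (top_of_set G) {g \<in> G. coset g \<in> U}"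
proof -
  let ?L = "\<lambda>U :: 'n mat1 set set. U \<subseteq> Q \<and> openin (top_of_set G) {g \<in> G. coset g \<in> U}"
  have "?L (S \<inter> T)" if "?L S" "?L T" for S T
  proof -
    have "{g \<in> G. coset g \<in> S \<inter> T} = {g \<in> G. coset g \<in> S} \<inter> {g \<in> G. coset g \<in> T}"
      by auto
    with that show ?thesis by (auto intro: openin_Int)
  qed
  moreover have "?L (\<Union>\<K>)" if "\<forall>U\<in>\<K>. ?L U" for \<K>
  proof -
    have "{g \<in> G. coset g \<in> \<Union>\<K>} = (\<Union>U\<in>\<K>. {g \<in> G. coset g \<in> U})"
      by auto
    with that show ?thesis by (auto intro: openin_Union)
  qed
  ultimately have "istopology ?L"
    unfolding istopology_def by blast
  then show ?thesis
    unfolding Q_topology_def by (subst topology_inverse') auto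
qed

lemma quotient_map_coset:
  "quotient_map (top_of_set (G :: 'n::finite mat1 set)) Q_topology coset"
proof -
  have "{g \<in> G. coset g \<in> Q} = (G :: 'n mat1 set)"
    by (auto simp: Q_def)
  then have "openin Q_topology (Q :: 'n mat1 set set)"
    unfolding openin_Q_topology by simp
  moreover have "topspace Q_topology \<subseteq> (Q :: 'n mat1 set set)"
    using openin_topspace[of Q_topology] unfolding openin_Q_topology by blast
  ultimately have "topspace Q_topology = (Q :: 'n mat1 set set)"
    using openin_subset by blast
  then show ?thesis
    unfolding quotient_map_def openin_Q_topology by (auto simp: Q_def)
qed

lemma index_less_imp_neq: "index_less i j \<Longrightarrow> i \<noteq> j"
  by (cases i; cases j) auto

lemma index_less_asym: "index_less i j \<Longrightarrow> \<not> index_less j i"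
  by (cases i; cases j) auto

lemma E_mat_lower:
  assumes "index_less i j" "index_less k l"
  shows "E_mat i j $ l $ k = (if i = k \<and> j = l then 1 else 0)"
proof -
  have "i \<noteq> j" "k \<noteq> l" "\<not> (l = i \<and> k = j)"
    using assms index_less_imp_neq index_less_asym by blast+
  then show ?thesis
    unfolding E_mat_def e_mat_def by (cases k) auto
qed

lemma independent_E_basis: "independent (E_basis :: 'n::{finite,linorder} mat1 set)"
proof (rule independent_if_scalars_zero)
  show "finite (E_basis :: 'n mat1 set)"
    by (rule finite_subset[of _ "range (\<lambda>(i, j). E_mat i j)"]) (auto simp: E_basis_def)
next
  fix f :: "'n mat1 \<Rightarrow> real" and b :: "'n mat1"
  assume sum0: "(\<Sum>x\<in>E_basis. f x *\<^sub>R x) = 0" and "b \<in> E_basis"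
  then obtain k l where b: "b = E_mat k l" "index_less k l"
    by (auto simp: E_basis_def)
  have fin: "finite (E_basis :: 'n mat1 set)"
    by (rule finite_subset[of _ "range (\<lambda>(i, j). E_mat i j)"]) (auto simp: E_basis_def)
  have x: "x $ l $ k = (if x = b then 1 else 0)" if "x \<in> E_basis" for x
  proof -
    from that obtain i j where "x = E_mat i j" "index_less i j"
      by (auto simp: E_basis_def)
    then show ?thesis
      using b E_mat_lower[of i j k l] E_mat_lower[of k l k l] by auto
  qed
  have "0 = (\<Sum>x\<in>E_basis. f x *\<^sub>R x) $ l $ k"
    using sum0 by simp
  also have "\<dots> = (\<Sum>x\<in>E_basis. f x * (x $ l $ k))"
    by simp
  also have "\<dots> = (\<Sum>x\<in>E_basis. if x = b then f x else 0)"
    by (rule sum.cong) (auto simp: x)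
  also have "\<dots> = f b"
    using \<open>b \<in> E_basis\<close> fin by simp
  finally show "f b = 0" by simp
qed

lemma lie_inner_orthonormal:
  assumes "X \<in> E_basis" "Y \<in> E_basis"
  shows "lie_inner X Y = (if X = Y then 1 else 0)"
proof -
  have "finite (E_basis :: 'a mat1 set)"
    using independent_E_basis independent_imp_finite by blast
  moreover have "lie_inner X Y = (\<Sum>b\<in>E_basis. if b = X then (if X = Y then 1 else 0) else 0)"
    unfolding lie_inner_def
    by (rule sum.cong)
      (auto simp: representation_basis[OF independent_E_basis assms(1)]
        representation_basis[OF independent_E_basis assms(2)])
  ultimately show ?thesis
    using assms by simp
qed

end

theory Submission
  imports Defs
begin

text \<open>
  The last row of \<open>g\<close> is unchanged when \<open>g\<close> is multiplied from the left by an element of \<open>K\<close>.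
  Its first \<open>n\<close> entries form a vector \<open>y\<close> of \<open>\<real>\<^sup>n\<close> that determines the coset \<open>K g\<close>
  (\<open>coset_eq_iff\<close>), and every \<open>y\<close> occurs, because some boost has it in its last row. So the quotient
  is \<open>\<real>\<^sup>n\<close>, and \<open>r(k)\<close> becomes the rotation \<open>y \<mapsto> y k\<close>.

  The quotient metric measures a velocity \<open>w\<close> at \<open>y\<close> by the shortest element \<open>X\<close> of the Lie algebra
  for which \<open>g X\<close> has \<open>w\<close> in its last row. That is a linear least squares problem, and its solution
  (\<open>horizontal_eq\<close>, \<open>Q_metric_eq\<close>) gives the squared length
  \<open>(w \<bullet> w + (y \<bullet> w)\<^sup>2 / (1 + y \<bullet> y)) / (1 + 2 (y \<bullet> y))\<close>.
  In polar coordinates \<open>y = sinh r \<cdot> u\<close> with \<open>u\<close> a unit vector this is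
  \<open>dr\<^sup>2 + (sinh\<^sup>2 r / (1 + 2 sinh\<^sup>2 r)) du\<^sup>2\<close>: a rotation invariant metric in which \<open>r\<close> is the distance
  from the origin and whose spheres about the origin have radii at most \<open>1 / \<surd>2\<close>, so that the space looks
  like a half-infinite cylinder with a cap.

  An isometry \<open>f\<close> of such a metric must fix the origin (\<open>quot_isometry_fixes_0\<close>). Otherwise let \<open>p\<close> be
  the image of the origin and \<open>\<rho> > 0\<close> its distance from the origin. The preimage of the origin has
  distance \<open>\<rho>\<close> from the origin, too. Follow the ray through that preimage up to distance \<open>R\<close>. The image
  path starts at \<open>p\<close>, passes through the origin, and ends at a point \<open>q\<close> of distance at most \<open>R - \<rho>\<close>
  from the origin. Since turning around by a half circle costs a bounded amount, \<open>p\<close> and \<open>q\<close> can also be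
  joined by a spiral of length at most \<open>sqrt ((R - 2 \<rho>)\<^sup>2 + \<pi>\<^sup>2 / 2)\<close>, which is less than \<open>R\<close> for large
  \<open>R\<close>. But the preimage of the spiral joins the origin to a point of distance \<open>R\<close>.

  An isometry that fixes the origin preserves \<open>r\<close>, and therefore maps rays, along which \<open>r\<close> grows with
  unit speed, to rays. So it agrees with its differential at the origin, and is an orthogonal map
  (\<open>quot_isometry_orthogonal\<close>).

  Hence the isometries of the quotient correspond to certain orthogonal matrices, among them all of
  \<open>SO(n)\<close> (\<open>right_action_Isom\<close>). Evaluation at a point is continuous in the compact-open topology, so the
  determinant of that matrix is a continuous function with values \<open>1\<close> and \<open>-1\<close>, hence \<open>1\<close> on the
  identity component. Conversely, \<open>SO(n)\<close> is connected (\<open>SO_connected\<close>) and acts continuously, so that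
  \<open>r(SO(n))\<close> lies in the identity component.
\<close>

section \<open>Calculus of smooth functions\<close>

text \<open>
  Modifying a function off the open set \<open>U\<close> changes none of its derivatives in \<open>U\<close>. This is what allows
  the derivatives in the recursive definition of \<open>C_on\<close> to be replaced by explicit formulas.
\<close>

lemma C_on_cong:
  assumes "open U" "\<And>x. x \<in> U \<Longrightarrow> f x = g x" "C_on k U f"
  shows "C_on k U g"
  using assms(2,3)
proof (induction k arbitrary: f g)
  case 0
  then show ?case using continuous_on_cong by force
next
  case (Suc k)
  have d: "(g has_derivative frechet_derivative f (at x)) (at x)" if "x \<in> U" for x
    using Suc.prems that frechet_derivative_works[of f "at x"]
    by (auto intro: has_derivative_transform_within_open[OF _ assms(1)])
  have "frechet_derivative f (at x) = frechet_derivative g (at x)" if "x \<in> U" for x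
    using d[OF that] frechet_derivative_at by blast
  then show ?case
    using Suc.IH[of "\<lambda>x. frechet_derivative f (at x) v" "\<lambda>x. frechet_derivative g (at x) v" for v] Suc.prems d
    by (metis C_on.simps(2) differentiable_def)
qed

lemma C_on_subset: "C_on k U f \<Longrightarrow> V \<subseteq> U \<Longrightarrow> C_on k V f"
  by (induction k arbitrary: f) (auto intro: continuous_on_subset)

lemma C_on_Suc_imp_C_on: "C_on (Suc k) U f \<Longrightarrow> C_on k U f"
proof (induction k arbitrary: f)
  case 0
  then show ?case
    by (auto intro!: continuous_at_imp_continuous_on differentiable_imp_continuous_within)
next
  case (Suc k)
  then show ?case by (metis C_on.simps(2))
qed

lemma C_on_const: "C_on k U (\<lambda>x. c)"
  by (induction k arbitrary: c) auto

lemma C_on_add: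
  assumes "open U" "C_on k U f" "C_on k U g"
  shows "C_on k U (\<lambda>x. f x + g x)"
  using assms(2,3)
proof (induction k arbitrary: f g)
  case 0
  then show ?case by (auto intro: continuous_on_add)
next
  case (Suc k)
  have "frechet_derivative (\<lambda>x. f x + g x) (at x)
      = (\<lambda>v. frechet_derivative f (at x) v + frechet_derivative g (at x) v)" if "x \<in> U" for x
    by (rule frechet_derivative_at[symmetric], rule has_derivative_add)
       (use Suc.prems that in \<open>auto intro: frechet_derivative_works[THEN iffD1]\<close>)
  moreover have "C_on k U (\<lambda>x. frechet_derivative f (at x) v + frechet_derivative g (at x) v)" for v
    using Suc by auto
  ultimately have "C_on k U (\<lambda>x. frechet_derivative (\<lambda>x. f x + g x) (at x) v)" for v
    by (subst C_on_cong[OF assms(1), of "\<lambda>x. frechet_derivative f (at x) v + frechet_derivative g (at x) v"]) auto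
  then show ?case using Suc.prems by auto
qed

text \<open>
  The product rule turns a derivative of the product into a sum of two products with one derivative
  less to go. The real product, scaling and the matrix product are all instances.
\<close>

lemma C_on_bilinear:
  assumes "bounded_bilinear p" "open U" "C_on k U f" "C_on k U g"
  shows "C_on k U (\<lambda>x. p (f x) (g x))"
  using assms(3,4)
proof (induction k arbitrary: f g)
  case 0
  then show ?case using bounded_bilinear.continuous_on[OF assms(1)] by auto
next
  case (Suc k)
  let ?D = "\<lambda>x v. p (f x) (frechet_derivative g (at x) v) + p (frechet_derivative f (at x) v) (g x)"
  have d: "((\<lambda>x. p (f x) (g x)) has_derivative ?D x) (at x)" if "x \<in> U" for x
    by (rule bounded_bilinear.FDERIV[OF assms(1)])
       (use Suc.prems that in \<open>auto intro: frechet_derivative_works[THEN iffD1]\<close>)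
  have "C_on k U (\<lambda>x. ?D x v)" for v
    using Suc.prems Suc.prems[THEN C_on_Suc_imp_C_on] by (intro C_on_add[OF assms(2)] Suc.IH) auto
  then have "C_on k U (\<lambda>x. frechet_derivative (\<lambda>x. p (f x) (g x)) (at x) v)" for v
    using fun_cong[OF frechet_derivative_at[OF d], of _ v]
    by (subst C_on_cong[OF assms(2), of "\<lambda>x. ?D x v"]) simp_all
  then show ?case using d by (auto simp: differentiable_def)
qed

lemma C_on_compose_linear:
  assumes "bounded_linear L" "open U" "C_on k U f"
  shows "C_on k (L -` U) (\<lambda>x. f (L x))"
  using assms(3)
proof (induction k arbitrary: f)
  case 0
  then show ?case
    using linear_continuous_on[OF assms(1)] by (auto intro!: continuous_on_compose2[of U f _ L])
next
  case (Suc k)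
  have o: "open (L -` U)"
    using assms by (simp add: continuous_open_vimage linear_continuous_at)
  have d: "((\<lambda>x. f (L x)) has_derivative (\<lambda>v. frechet_derivative f (at (L x)) (L v))) (at x)"
    if "L x \<in> U" for x
    by (rule has_derivative_compose[of L L x UNIV f])
       (use Suc.prems that bounded_linear_imp_has_derivative[OF assms(1)] in
         \<open>auto intro: frechet_derivative_works[THEN iffD1]\<close>)
  have "C_on k (L -` U) (\<lambda>x. frechet_derivative f (at (L x)) (L v))" for v
    using Suc by auto
  then have "C_on k (L -` U) (\<lambda>x. frechet_derivative (\<lambda>x. f (L x)) (at x) v)" for v
    using fun_cong[OF frechet_derivative_at[OF d], of _ v]
    by (subst C_on_cong[OF o, of "\<lambda>x. frechet_derivative f (at (L x)) (L v)"]) simp_all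
  then show ?case using d by (auto simp: differentiable_def)
qed

lemma C_on_Suc_real:
  fixes f :: "real \<Rightarrow> real"
  assumes "\<And>x. (f has_real_derivative f' x) (at x)" "C_on k UNIV f'"
  shows "C_on (Suc k) UNIV f"
proof -
  have "frechet_derivative f (at x) v = f' x * v" for x v
    using assms(1)[of x] frechet_derivative_at
    by (metis has_field_derivative_def)
  moreover have "C_on k UNIV (\<lambda>x. f' x * v)" for v
    by (intro C_on_bilinear[OF bounded_bilinear_mult] assms C_on_const) auto
  moreover have "f differentiable at x" for x
    using assms(1) real_differentiable_def by blast
  ultimately show ?thesis by simp
qed

text \<open>
  The functions of this form are closed under differentiation, which makes the induction work; sine
  alone is not.
\<close>

lemma C_on_sin_cos: "C_on k UNIV (\<lambda>x::real. a * sin x + b * cos x)"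
proof (induction k arbitrary: a b)
  case 0
  then show ?case by (auto intro!: continuous_intros)
next
  case (Suc k)
  have "C_on k UNIV (\<lambda>x. (-b) * sin x + a * cos x)" by (rule Suc)
  then show ?case
    by (rule C_on_Suc_real[rotated]) (auto intro!: derivative_eq_intros)
qed

lemma C_on_sinh_cosh: "C_on k UNIV (\<lambda>x::real. a * sinh x + b * cosh x)"
proof (induction k arbitrary: a b)
  case 0
  then show ?case by (auto intro!: continuous_intros)
next
  case (Suc k)
  have "C_on k UNIV (\<lambda>x. b * sinh x + a * cosh x)" by (rule Suc)
  then show ?case
    by (rule C_on_Suc_real[rotated]) (auto intro!: derivative_eq_intros)
qed

lemma smooth_on_subset: "smooth_on U f \<Longrightarrow> V \<subseteq> U \<Longrightarrow> smooth_on V f"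
  unfolding smooth_on_def by (blast intro: C_on_subset)

lemma smooth_on_const: "smooth_on U (\<lambda>x. c)"
  by (simp add: smooth_on_def C_on_const)

lemma smooth_on_add: "open U \<Longrightarrow> smooth_on U f \<Longrightarrow> smooth_on U g \<Longrightarrow> smooth_on U (\<lambda>x. f x + g x)"
  by (simp add: smooth_on_def C_on_add)

lemma smooth_on_bilinear:
  "bounded_bilinear p \<Longrightarrow> open U \<Longrightarrow> smooth_on U f \<Longrightarrow> smooth_on U g \<Longrightarrow> smooth_on U (\<lambda>x. p (f x) (g x))"
  by (simp add: smooth_on_def C_on_bilinear)

lemma smooth_on_compose_linear:
  "bounded_linear L \<Longrightarrow> open U \<Longrightarrow> smooth_on U f \<Longrightarrow> smooth_on (L -` U) (\<lambda>x. f (L x))"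
  by (simp add: smooth_on_def C_on_compose_linear)

lemma smooth_on_linear:
  assumes "bounded_linear L" shows "smooth_on UNIV L"
proof -
  have "C_on k UNIV L" for k
  proof (cases k)
    case 0
    then show ?thesis using assms by (simp add: linear_continuous_on)
  next
    case (Suc m)
    have d: "(L has_derivative L) (at x)" for x
      using bounded_linear_imp_has_derivative[OF assms] by simp
    have "frechet_derivative L (at x) = L" for x
      by (rule frechet_derivative_at[symmetric, OF d])
    then show ?thesis using Suc d by (auto simp: C_on_const differentiable_def)
  qed
  then show ?thesis by (simp add: smooth_on_def)
qed

lemma smooth_on_differentiable: "smooth_on U f \<Longrightarrow> x \<in> U \<Longrightarrow> f differentiable (at x)"
  unfolding smooth_on_def by (metis C_on.simps(2))

lemma smooth_functions_linear_combination:
  assumes "f \<in> smooth_functions S" "g \<in> smooth_functions S"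
  shows "(\<lambda>x. a * f x + b * g x) \<in> smooth_functions S"
proof -
  have "\<exists>U h. open U \<and> x \<in> U \<and> smooth_on U h \<and> (\<forall>y\<in>S \<inter> U. a * f y + b * g y = h y)"
    if "x \<in> S" for x
  proof -
    obtain U h V k where *: "open U" "x \<in> U" "smooth_on U h" "\<forall>y\<in>S \<inter> U. f y = h y"
      "open V" "x \<in> V" "smooth_on V k" "\<forall>y\<in>S \<inter> V. g y = k y"
      using assms \<open>x \<in> S\<close> unfolding smooth_functions_def by blast
    then have "smooth_on (U \<inter> V) (\<lambda>x. a * h x + b * k x)"
      by (intro smooth_on_add smooth_on_bilinear[OF bounded_bilinear_mult] smooth_on_const)
         (auto intro: smooth_on_subset)
    with * show ?thesis
      by (intro exI[of _ "U \<inter> V"] exI[of _ "\<lambda>x. a * h x + b * k x"]) auto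
  qed
  then show ?thesis by (auto simp: smooth_functions_def)
qed

lemma smooth_functions_mult:
  assumes "f \<in> smooth_functions S" "g \<in> smooth_functions S"
  shows "(\<lambda>x. f x * g x) \<in> smooth_functions S"
proof -
  have "\<exists>U h. open U \<and> x \<in> U \<and> smooth_on U h \<and> (\<forall>y\<in>S \<inter> U. f y * g y = h y)"
    if "x \<in> S" for x
  proof -
    obtain U h V k where *: "open U" "x \<in> U" "smooth_on U h" "\<forall>y\<in>S \<inter> U. f y = h y"
      "open V" "x \<in> V" "smooth_on V k" "\<forall>y\<in>S \<inter> V. g y = k y"
      using assms \<open>x \<in> S\<close> unfolding smooth_functions_def by blast
    then have "smooth_on (U \<inter> V) (\<lambda>x. h x * k x)"
      by (intro smooth_on_bilinear[OF bounded_bilinear_mult])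
         (auto intro: smooth_on_subset)
    with * show ?thesis
      by (intro exI[of _ "U \<inter> V"] exI[of _ "\<lambda>x. h x * k x"]) auto
  qed
  then show ?thesis by (auto simp: smooth_functions_def)
qed

lemma smooth_functions_cong:
  assumes "f \<in> smooth_functions S" "\<And>x. x \<in> S \<Longrightarrow> f x = g x"
  shows "g \<in> smooth_functions S"
  using assms unfolding smooth_functions_def by fastforce

lemma linear_smooth_functions:
  "bounded_linear L \<Longrightarrow> L \<in> smooth_functions S"
  using smooth_on_linear unfolding smooth_functions_def by blast

section \<open>Connectedness of the rotation group\<close>

lemma sum_option_UNIV:
  "(\<Sum>x\<in>(UNIV :: 'n::finite option set). f x) = f None + (\<Sum>i\<in>UNIV. f (Some i))"
  by (simp add: UNIV_option_conv sum.reindex)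

text \<open>
  Writes one unit vector as a rotation of another. The auxiliary \<open>w0\<close> is used as the second axis when
  the two vectors are parallel and span no plane; otherwise the axis is the direction of the component
  of \<open>v\<close> orthogonal to \<open>u\<close>. The last clause keeps track of this choice, so that everything orthogonal to
  \<open>u\<close>, \<open>v\<close> and \<open>w0\<close> is orthogonal to \<open>w\<close>.
\<close>

lemma unit_vector_in_plane:
  fixes u v w0 :: "'a::euclidean_space"
  assumes "norm u = 1" "norm v = 1" "norm w0 = 1" "u \<bullet> w0 = 0"
  obtains \<theta> w where "0 \<le> \<theta>" "\<theta> \<le> pi" "norm w = 1" "u \<bullet> w = 0"
    "v = cos \<theta> *\<^sub>R u + sin \<theta> *\<^sub>R w" "w = w0 \<or> (\<exists>\<alpha>. w = \<alpha> *\<^sub>R (v - (u \<bullet> v) *\<^sub>R u))"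
proof -
  define c where "c = u \<bullet> v"
  define d where "d = v - c *\<^sub>R u"
  have c: "\<bar>c\<bar> \<le> 1"
    using Cauchy_Schwarz_ineq2[of u v] assms by (simp add: c_def)
  have uu: "u \<bullet> u = 1" "v \<bullet> v = 1" using assms by (simp_all add: dot_square_norm)
  have dd: "d \<bullet> d = 1 - c\<^sup>2"
    unfolding d_def by (simp add: inner_diff inner_commute uu c_def[symmetric] power2_eq_square)
  have ud: "u \<bullet> d = 0" unfolding d_def by (simp add: inner_diff uu c_def)
  show thesis
  proof (cases "d = 0")
    case True
    then have "c\<^sup>2 = 1" using dd by simp
    then have "c = 1 \<or> c = -1" by (simp add: power2_eq_1_iff)
    then show thesis
    proof
      assume "c = 1"
      then show thesis using that[of 0 w0] True assms by (simp add: d_def)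
    next
      assume "c = -1"
      then show thesis using that[of pi w0] True assms by (simp add: d_def add_eq_0_iff)
    qed
  next
    case False
    have nd: "norm d = sqrt (1 - c\<^sup>2)" using dd by (simp add: norm_eq_sqrt_inner)
    show thesis
    proof (rule that[of "arccos c" "(1 / norm d) *\<^sub>R d"])
      show "v = cos (arccos c) *\<^sub>R u + sin (arccos c) *\<^sub>R ((1 / norm d) *\<^sub>R d)"
        using False c by (simp add: sin_arccos_abs nd[symmetric]) (simp add: d_def)
    qed (use c False ud in \<open>auto simp: arccos_lbound arccos_ubound d_def c_def\<close>)
  qed
qed

definition outer :: "real^'n \<Rightarrow> real^'n \<Rightarrow> real^'n^'n::finite" where
  "outer x y = (\<chi> i j. x $ i * y $ j)"

lemma outer_mult_vector: "outer x y *v z = (y \<bullet> z) *\<^sub>R x"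
  by (simp add: outer_def matrix_vector_mult_def vec_eq_iff inner_vec_def sum_distrib_left
      sum_distrib_right mult_ac)

text \<open>
  For orthonormal \<open>u\<close>, \<open>w\<close> this rotates \<open>u\<close> towards \<open>w\<close> by the angle \<open>\<theta>\<close> and fixes the orthogonal
  complement of their span.
\<close>

definition plane_rotation :: "real^'n \<Rightarrow> real^'n \<Rightarrow> real \<Rightarrow> real^'n^'n::finite" where
  "plane_rotation u w \<theta> = mat 1 + sin \<theta> *\<^sub>R (outer w u - outer u w) + (cos \<theta> - 1) *\<^sub>R (outer u u + outer w w)"

lemma plane_rotation_mult_vector:
  "plane_rotation u w \<theta> *v x = x + sin \<theta> *\<^sub>R ((u \<bullet> x) *\<^sub>R w - (w \<bullet> x) *\<^sub>R u)
     + (cos \<theta> - 1) *\<^sub>R ((u \<bullet> x) *\<^sub>R u + (w \<bullet> x) *\<^sub>R w)"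
  by (simp add: plane_rotation_def matrix_vector_mult_add_rdistrib matrix_vector_mult_diff_rdistrib
      scaleR_matrix_vector_assoc[symmetric] outer_mult_vector)

lemma orthogonal_plane_rotation:
  assumes "norm u = 1" "norm w = 1" "u \<bullet> w = 0"
  shows "orthogonal_matrix (plane_rotation u w \<theta>)"
proof -
  have uw: "u \<bullet> u = 1" "w \<bullet> w = 1" "w \<bullet> u = 0" "u \<bullet> w = 0"
    using assms by (simp_all add: dot_square_norm inner_commute)
  let ?R = "plane_rotation u w \<theta>"
  have "orthogonal_transformation (\<lambda>x. ?R *v x)"
    unfolding orthogonal_transformation_def
  proof (intro conjI allI)
    fix x y :: "real^'a"
    define a b c d where "a = u \<bullet> x" "b = w \<bullet> x" "c = u \<bullet> y" "d = w \<bullet> y"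
    have *: "x \<bullet> u = a" "x \<bullet> w = b" "u \<bullet> y = c" "w \<bullet> y = d" "u \<bullet> x = a" "w \<bullet> x = b"
      by (simp_all add: a_b_c_d_def inner_commute)
    have sc: "sin \<theta> * sin \<theta> = 1 - cos \<theta> * cos \<theta>"
      using sin_cos_squared_add[of \<theta>] by (simp add: power2_eq_square)
    show "(?R *v x) \<bullet> (?R *v y) = x \<bullet> y"
      unfolding plane_rotation_mult_vector
      by (simp add: inner_add_left inner_add_right inner_diff_left inner_diff_right uw *)
         (simp add: algebra_simps sc)
  qed simp
  then show ?thesis
    by (simp add: orthogonal_transformation_matrix)
qed

lemma bounded_bilinear_matrix_mult:
  "bounded_bilinear ((**) :: real^'n^'m \<Rightarrow> real^'p^'n \<Rightarrow> real^'p^'m::finite)"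
  unfolding bilinear_conv_bounded_bilinear[symmetric] bilinear_def
  by (auto intro!: linearI simp: matrix_matrix_mult_def vec_eq_iff algebra_simps sum.distrib
       sum_distrib_left)

lemmas matrix_mult_bilinear =
  bounded_bilinear.add_left[OF bounded_bilinear_matrix_mult]
  bounded_bilinear.add_right[OF bounded_bilinear_matrix_mult]
  bounded_bilinear.diff_left[OF bounded_bilinear_matrix_mult]
  bounded_bilinear.diff_right[OF bounded_bilinear_matrix_mult]
  bounded_bilinear.minus_left[OF bounded_bilinear_matrix_mult]
  bounded_bilinear.minus_right[OF bounded_bilinear_matrix_mult]
  bounded_bilinear.scaleR_left[OF bounded_bilinear_matrix_mult]
  bounded_bilinear.scaleR_right[OF bounded_bilinear_matrix_mult]
  bounded_bilinear.zero_left[OF bounded_bilinear_matrix_mult]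
  bounded_bilinear.zero_right[OF bounded_bilinear_matrix_mult]

lemma continuous_on_matrix_mult [continuous_intros]:
  fixes f :: "'a::topological_space \<Rightarrow> real^'n^'m::finite" and g :: "'a \<Rightarrow> real^'p^'n::finite"
  assumes "continuous_on S f" "continuous_on S g"
  shows "continuous_on S (\<lambda>x. f x ** g x)"
  using bounded_bilinear.continuous_on[OF bounded_bilinear_matrix_mult assms] .

lemma continuous_on_det [continuous_intros]:
  fixes f :: "'a::topological_space \<Rightarrow> real^'n^'n::finite"
  assumes "continuous_on S f"
  shows "continuous_on S (\<lambda>x. det (f x))"
  unfolding det_def by (intro continuous_intros assms)

lemma det_eq_on_connected:
  fixes S :: "(real^'n^'n::finite) set"
  assumes "connected S" "\<And>A. A \<in> S \<Longrightarrow> (det A)\<^sup>2 = 1" "A \<in> S" "B \<in> S"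
  shows "det A = det B"
proof -
  have "connected (det ` S)"
    using assms(1) by (intro connected_continuous_image continuous_intros)
  moreover have "finite (det ` S)"
    by (rule finite_subset[of _ "{1, -1}"]) (use assms(2) in \<open>auto simp: power2_eq_1_iff\<close>)
  ultimately show ?thesis
    using assms(3,4) connected_finite_iff_sing[of "det ` S"] by (auto) (metis imageI singletonD)+
qed

text \<open>
  A rotation that moves a basis vector is composed with rotations in the plane of that vector and its
  image. This is a path within the orthogonal group that leaves the basis vectors fixed so far alone
  and ends at a rotation that fixes one more. When all basis vectors but one are fixed, the
  determinant forces the last one to be fixed as well.
\<close>

lemma SO_connected: "connected (SO :: (real^'n^'n::finite) set)"
proof -
  define C where "C = connected_component_set {A :: real^'n^'n. orthogonal_matrix A} (mat 1)"
  have C: "connected C" "mat 1 \<in> C" "C \<subseteq> {A. orthogonal_matrix A}"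
    unfolding C_def using connected_component_subset[of "{A :: real^'n^'n. orthogonal_matrix A}" "mat 1"]
    by (auto simp: orthogonal_matrix_id connected_component_refl)
  have "C \<subseteq> SO"
  proof
    fix A assume "A \<in> C"
    then have "det A = det (mat 1 :: real^'n^'n)"
      using C by (intro det_eq_on_connected[of C]) (auto simp: power2_eq_1_iff dest!: det_orthogonal_matrix)
    then show "A \<in> SO" using \<open>A \<in> C\<close> C by (auto simp: SO_def)
  qed
  moreover have "A \<in> C" if "finite S" "orthogonal_matrix A" "det A = 1"
    "\<And>i. i \<notin> S \<Longrightarrow> A *v axis i 1 = axis i 1" for S :: "'n set" and A
    using that
  proof (induction S arbitrary: A)
    case empty
    have "A $ r $ i = mat 1 $ r $ i" for r i
    proof -
      have "(A *v axis i 1) $ r = axis i 1 $ r" using empty.prems(3)[of i] by simp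
      then show ?thesis unfolding matrix_vector_mult_basis by (simp add: column_def axis_def mat_def)
    qed
    then have "A = mat 1" by (simp add: vec_eq_iff)
    then show ?case using C by simp
  next
    case (insert j S)
    let ?e = "\<lambda>i. axis i 1 :: real^'n"
    define v where "v = A *v ?e j"
    have inner: "(A *v x) \<bullet> (A *v y) = x \<bullet> y" for x y
      using insert.prems(1) orthogonal_transformation_matrix[of "(*v) A"]
      by (simp add: orthogonal_transformation_def)
    have e: "?e i \<bullet> ?e k = (if i = k then 1 else 0)" for i k
      by (simp add: inner_axis_axis)
    have ve: "?e i \<bullet> v = 0" if "i \<notin> insert j S" for i
      using inner[of "?e i" "?e j"] insert.prems(3)[OF that] that by (simp add: v_def e)
    have nv: "norm v = 1"
      using inner[of "?e j" "?e j"] by (simp add: v_def e norm_eq_1)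
    show ?case
    proof (cases "S = {}")
      case True
      have diag: "A $ i $ k = 0" if "i \<noteq> k" for i k
      proof (cases "k = j")
        case True
        then show ?thesis using ve[of i] that \<open>S = {}\<close>
          by (simp add: v_def matrix_vector_mult_basis column_def inner_axis')
      next
        case False
        then have "(A *v ?e k) $ i = ?e k $ i" using insert.prems(3)[of k] True by simp
        then show ?thesis using that unfolding matrix_vector_mult_basis by (simp add: column_def axis_def)
      qed
      have one: "A $ i $ i = 1" if "i \<noteq> j" for i
      proof -
        have "(A *v ?e i) $ i = ?e i $ i" using insert.prems(3)[of i] True that by simp
        then show ?thesis unfolding matrix_vector_mult_basis by (simp add: column_def axis_def)
      qed
      have "det A = (\<Prod>i\<in>UNIV. A $ i $ i)" by (rule det_diagonal) (rule diag)
      also have "\<dots> = A $ j $ j"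
        by (subst prod.remove[of _ j]) (auto simp: one)
      finally have "A $ j $ j = 1" using insert.prems by simp
      then have "A $ i $ k = mat 1 $ i $ k" for i k
        using diag one by (cases "i = k"; cases "i = j") (auto simp: mat_def)
      then have "A = mat 1" by (simp add: vec_eq_iff)
      then show ?thesis using C by simp
    next
      case False
      \<comment> \<open>A second basis vector that is not yet fixed completes the plane if the image of the first is its negative.\<close>
      then obtain k where k: "k \<in> S" by auto
      then have kj: "k \<noteq> j" using insert by auto
      obtain \<theta> w where w: "norm w = 1" "?e j \<bullet> w = 0" "v = cos \<theta> *\<^sub>R ?e j + sin \<theta> *\<^sub>R w"
        "w = ?e k \<or> (\<exists>\<alpha>. w = \<alpha> *\<^sub>R (v - (?e j \<bullet> v) *\<^sub>R ?e j))"
      proof -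
        have h: "norm (?e j) = 1" "norm (?e k) = 1" "?e j \<bullet> ?e k = 0" using kj by (auto simp: e)
        show thesis by (rule unit_vector_in_plane[OF h(1) nv h(2,3)]) (rule that; assumption)
      qed
      have we: "?e i \<bullet> w = 0" if "i \<notin> insert j S" for i
        using w(4) ve[OF that] that k by (auto simp: e inner_diff_right)
      have ww: "w \<bullet> w = 1" using w(1) by (simp add: norm_eq_1)
      let ?R = "plane_rotation (?e j) w"
      have R: "orthogonal_matrix (?R t)" for t
        using w by (intro orthogonal_plane_rotation) auto
      have Rinv: "?R t ** ?R (-t) = mat 1" for t
      proof -
        have "?R t *v (?R (-t) *v x) = x" for x
        proof -
          define a b where "a = ?e j \<bullet> x" "b = w \<bullet> x"
          have 1: "?R (-t) *v x = x + (- sin t * a) *\<^sub>R w + (sin t * b) *\<^sub>R ?e j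
              + ((cos t - 1) * a) *\<^sub>R ?e j + ((cos t - 1) * b) *\<^sub>R w"
            unfolding plane_rotation_mult_vector a_b_def by (simp add: algebra_simps)
          have 2: "?e j \<bullet> (?R (-t) *v x) = a + (sin t * b) + (cos t - 1) * a"
            "w \<bullet> (?R (-t) *v x) = b - sin t * a + (cos t - 1) * b"
            unfolding 1 by (simp_all add: inner_add_right inner_diff_right w(2) e ww a_b_def inner_commute[of w "?e j"])
          have sc: "sin t * sin t = 1 - cos t * cos t"
            using sin_cos_squared_add[of t] by (simp add: power2_eq_square)
          show ?thesis
            unfolding plane_rotation_mult_vector[of _ _ t "?R (-t) *v x"] 2 unfolding 1
            by (simp add: algebra_simps sc)
        qed
        then show ?thesis by (simp add: matrix_eq matrix_vector_mul_assoc[symmetric])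
      qed
      have detR: "det (?R t) = 1" for t
      proof -
        have "det (?R t) = det (?R 0)"
        proof (rule det_eq_on_connected)
          show "connected (range ?R)"
            unfolding plane_rotation_def by (intro connected_continuous_image continuous_intros) auto
        qed (use R in \<open>auto simp: power2_eq_1_iff dest!: det_orthogonal_matrix\<close>)
        then show ?thesis by (simp add: plane_rotation_def)
      qed
      define A' where "A' = ?R (-\<theta>) ** A"
      have A: "A = ?R \<theta> ** A'"
        unfolding A'_def by (simp add: matrix_mul_assoc Rinv)
      have "?R (-\<theta>) *v v = ?e j"
      proof -
        have "?R \<theta> *v ?e j = v"
          unfolding plane_rotation_mult_vector w(3)
          by (simp add: e inner_commute[of w "?e j"] w(2) algebra_simps)
        then have "?R (-\<theta>) *v v = (?R (-\<theta>) ** ?R (-(-\<theta>))) *v ?e j"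
          by (simp add: matrix_vector_mul_assoc[symmetric])
        then show ?thesis by (simp only: Rinv matrix_vector_mul_lid)
      qed
      then have "A' *v ?e j = ?e j"
        by (simp add: A'_def matrix_vector_mul_assoc[symmetric] v_def)
      moreover have "A' *v ?e i = ?e i" if "i \<notin> insert j S" for i
        using insert.prems(3)[OF that] we[OF that] that e[of j i]
        by (auto simp add: A'_def matrix_vector_mul_assoc[symmetric] plane_rotation_mult_vector inner_commute[of w "?e i"])
      ultimately have "A' *v ?e i = ?e i" if "i \<notin> S" for i
        using that by (cases "i = j") auto
      then have "A' \<in> C"
        using insert.prems R detR
        by (intro insert.IH) (auto simp: A'_def det_mul orthogonal_matrix_mul)
      have "connected (range (\<lambda>t. ?R t ** A'))"
        unfolding plane_rotation_def by (intro connected_continuous_image continuous_intros) auto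
      moreover have "A' \<in> range (\<lambda>t. ?R t ** A')"
        by (rule range_eqI[of _ _ 0]) (simp add: plane_rotation_def)
      moreover have "range (\<lambda>t. ?R t ** A') \<subseteq> {A. orthogonal_matrix A}"
        using R \<open>A' \<in> C\<close> C by (auto intro: orthogonal_matrix_mul)
      ultimately have "range (\<lambda>t. ?R t ** A') \<subseteq> connected_component_set {A. orthogonal_matrix A} A'"
        by (intro connected_component_maximal)
      also have "\<dots> = C"
        using \<open>A' \<in> C\<close> unfolding C_def by (metis connected_component_eq)
      finally show ?thesis using A by auto
    qed
  qed
  from this[of UNIV] have "SO \<subseteq> C" by (auto simp: SO_def)
  ultimately have "SO = C" by blast
  then show ?thesis using C by simp
qed

section \<open>The group, its boosts, and coordinates on the quotient\<close>

definition Lorentz :: "'n::finite mat1 set" where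
  "Lorentz = {A. invertible A \<and> A ** J_mat ** transpose A = J_mat}"

lemma det_J_mat: "det (J_mat :: 'n::finite mat1) \<noteq> 0"
  by (subst det_diagonal) (auto simp: J_mat_def)

text \<open>
  Since \<open>J\<close> is invertible, so is \<open>A\<close>; and as the determinant takes only two values, it is constant on
  connected sets of such matrices.
\<close>

lemma Lorentz_det:
  fixes A :: "'n::finite mat1"
  assumes "A ** J_mat ** transpose A = J_mat" shows "(det A)\<^sup>2 = 1"
proof -
  have "det A * det (J_mat :: 'n mat1) * det A = det (J_mat :: 'n mat1)"
    using arg_cong[OF assms, of det] by (simp only: det_mul det_transpose)
  then have "(det A)\<^sup>2 * det (J_mat :: 'n mat1) = 1 * det (J_mat :: 'n mat1)"
    by (simp only: power2_eq_square mult_ac mult_1)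
  then show ?thesis using det_J_mat by (simp only: mult_cancel_right) blast
qed

lemma matrix_inv_cancel:
  fixes A :: "real^'n^'n::finite"
  assumes "invertible A"
  shows "A ** matrix_inv A = mat 1" "matrix_inv A ** A = mat 1"
  using someI_ex[OF assms[unfolded invertible_def]] unfolding matrix_inv_def by auto

lemma LorentzI: "A ** J_mat ** transpose A = J_mat \<Longrightarrow> A \<in> Lorentz"
  using Lorentz_det[of A] by (auto simp: Lorentz_def invertible_det_nz)

lemma LorentzD: "A \<in> Lorentz \<Longrightarrow> A ** J_mat ** transpose A = J_mat"
  by (simp add: Lorentz_def)

lemma Lorentz_mult:
  assumes "A \<in> Lorentz" "B \<in> Lorentz" shows "A ** B \<in> Lorentz"
proof (rule LorentzI)
  have "A ** B ** J_mat ** transpose (A ** B) = A ** (B ** J_mat ** transpose B) ** transpose A"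
    by (simp add: matrix_mul_assoc matrix_transpose_mul)
  then show "A ** B ** J_mat ** transpose (A ** B) = J_mat"
    using assms by (simp add: LorentzD)
qed

lemma Lorentz_inverse:
  assumes "A \<in> Lorentz" shows "matrix_inv A \<in> Lorentz"
proof (rule LorentzI)
  have i: "matrix_inv A ** A = mat 1"
    using assms by (simp add: Lorentz_def matrix_inv_cancel)
  have "matrix_inv A ** J_mat ** transpose (matrix_inv A)
      = (matrix_inv A ** A) ** J_mat ** transpose (matrix_inv A ** A)"
    using LorentzD[OF assms] by (simp only: matrix_mul_assoc[symmetric] matrix_transpose_mul)
      (simp add: matrix_mul_assoc)
  then show "matrix_inv A ** J_mat ** transpose (matrix_inv A) = J_mat"
    by (simp add: i)
qed

lemma J_mat_simps [simp]:
  "J_mat $ Some a $ Some b = (if a = b then -1 else 0)" "J_mat $ None $ None = 1"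
  "J_mat $ Some a $ None = 0" "J_mat $ None $ Some a = 0"
  by (auto simp: J_mat_def)

text \<open>
  The entries of \<open>A J A\<^sup>t\<close> are the Lorentz products of the rows of \<open>A\<close>.
\<close>

lemma J_form_entry:
  "(A ** J_mat ** transpose A) $ i $ j
    = A $ i $ None * A $ j $ None - (\<Sum>c\<in>UNIV. A $ i $ Some c * A $ j $ Some c)"
  for A :: "'n::finite mat1"
proof -
  have "(A ** J_mat) $ i $ x = A $ i $ x * (if x = None then 1 else -1)" for x
    by (simp add: matrix_matrix_mult_def J_mat_def if_distrib cong: if_cong)
  then show ?thesis
    unfolding matrix_matrix_mult_def[of "A ** J_mat"]
    by (simp add: transpose_def sum_option_UNIV sum_negf)
qed

lemma Lorentz_entry:
  "A \<in> Lorentz \<Longrightarrow>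
    A $ i $ None * A $ j $ None - (\<Sum>c\<in>UNIV. A $ i $ Some c * A $ j $ Some c) = J_mat $ i $ j"
  using J_form_entry[of A i j] LorentzD[of A] by simp

lemma G_eq: "G = connected_component_set Lorentz (mat 1)"
  by (simp add: G_def Lorentz_def)

lemma mat_1_Lorentz: "mat 1 \<in> Lorentz"
  by (rule LorentzI) simp

lemma mat_1_G: "mat 1 \<in> G"
  by (simp add: G_eq mat_1_Lorentz)

lemma G_Lorentz: "g \<in> G \<Longrightarrow> g \<in> Lorentz"
  unfolding G_eq using connected_component_subset by blast

lemma G_connected: "connected G"
  by (simp add: G_eq)

text \<open>
  Membership in the identity component is always shown by exhibiting a connected set that meets it.
\<close>

lemma connected_subset_G:
  assumes "connected S" "S \<subseteq> Lorentz" "a \<in> S" "a \<in> G"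
  shows "S \<subseteq> G"
  using connected_component_maximal[of a S Lorentz] connected_component_eq[of a Lorentz "mat 1"] assms
  by (simp add: G_eq)

lemma G_mult:
  assumes "a \<in> G" "b \<in> G" shows "a ** b \<in> G"
proof -
  have "(\<lambda>x. a ** x) ` G \<subseteq> G"
    using assms
    by (intro connected_subset_G[where a=a] connected_continuous_image continuous_intros G_connected)
       (auto intro: Lorentz_mult G_Lorentz intro!: image_eqI[of _ _ "mat 1"] mat_1_G)
  then show ?thesis using assms by auto
qed

lemma det_G: "g \<in> G \<Longrightarrow> det g = 1"
  using det_eq_on_connected[OF G_connected, of g "mat 1"] mat_1_G Lorentz_det LorentzD G_Lorentz
  by fastforce

lemma G_invertible: "g \<in> G \<Longrightarrow> invertible g"
  using det_G[of g] by (simp add: invertible_det_nz)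

text \<open>
  The corner entry is left out: on \<open>G\<close> it is determined by the others, see \<open>G_corner\<close>.
\<close>

definition last_row :: "'n::finite mat1 \<Rightarrow> real^'n" where
  "last_row g = (\<chi> i. g $ None $ Some i)"

lemma bounded_linear_last_row: "bounded_linear last_row"
  unfolding linear_conv_bounded_linear[symmetric]
  by (auto intro!: linearI simp: last_row_def vec_eq_iff)

text \<open>
  The last row has Lorentz square \<open>1\<close>, so its corner entry is a square root of \<open>1 + y \<bullet> y\<close>. The entry is
  positive since it is continuous, does not vanish, and equals \<open>1\<close> at the identity of the connected
  group \<open>G\<close>.
\<close>

lemma G_corner:
  assumes "g \<in> G" shows "g $ None $ None = sqrt (1 + last_row g \<bullet> last_row g)"
proof -
  have sq: "(h $ None $ None)\<^sup>2 = 1 + last_row h \<bullet> last_row h" if "h \<in> G" for h :: "'a mat1"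
    using Lorentz_entry[OF G_Lorentz[OF that], of None None]
    by (simp add: J_mat_def last_row_def inner_vec_def power2_eq_square)
  have "g $ None $ None > 0"
  proof (rule ccontr)
    assume "\<not> ?thesis"
    moreover have "connected ((\<lambda>h :: 'a mat1. h $ None $ None) ` G)"
      by (intro connected_continuous_image continuous_intros G_connected)
    moreover have "(mat 1 :: 'a mat1) $ None $ None = 1" by (simp add: mat_def)
    ultimately have "0 \<in> (\<lambda>h :: 'a mat1. h $ None $ None) ` G"
      using connected_contains_Icc[of "(\<lambda>h :: 'a mat1. h $ None $ None) ` G" "g $ None $ None" 1]
        assms mat_1_G by (force simp: subset_iff)
    then obtain h where "h \<in> G" "(h :: 'a mat1) $ None $ None = 0" by auto
    with sq[of h] show False using inner_ge_zero[of "last_row h"] by simp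
  qed
  then show ?thesis using sq[OF assms] by (metis less_imp_le real_sqrt_unique)
qed

lemma G_last_row_eq:
  assumes "g \<in> G" "h \<in> G" "last_row g = last_row h" shows "g $ None = h $ None"
proof -
  have "g $ None $ x = h $ None $ x" for x
    using assms G_corner[of g] G_corner[of h] by (cases x) (auto simp: last_row_def vec_eq_iff)
  then show ?thesis by (simp add: vec_eq_iff)
qed

lemma block_diag_simps [simp]:
  "block_diag k $ Some a $ Some b = k $ a $ b" "block_diag k $ None $ None = 1"
  "block_diag k $ Some a $ None = 0" "block_diag k $ None $ Some a = 0"
  by (auto simp: block_diag_def)

lemma mat1_eqI:
  fixes A B :: "'n::finite mat1"
  assumes "\<And>a b. A $ Some a $ Some b = B $ Some a $ Some b" "\<And>a. A $ Some a $ None = B $ Some a $ None"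
    "\<And>a. A $ None $ Some a = B $ None $ Some a" "A $ None $ None = B $ None $ None"
  shows "A = B"
proof -
  have "A $ x $ y = B $ x $ y" for x y using assms by (cases x; cases y) auto
  then show ?thesis by (simp add: vec_eq_iff)
qed

lemma block_diag_mult: "block_diag (a ** b) = block_diag a ** block_diag b"
  by (rule mat1_eqI) (simp_all add: matrix_matrix_mult_def sum_option_UNIV)

lemma block_diag_mat_1: "block_diag (mat 1) = mat 1"
  by (rule mat1_eqI) (simp_all add: mat_def)

lemma continuous_on_block_diag [continuous_intros]:
  fixes f :: "'a::topological_space \<Rightarrow> real^'n^'n::finite"
  assumes "continuous_on S f" shows "continuous_on S (\<lambda>x. block_diag (f x))"
proof -
  have "continuous_on S (\<lambda>x. block_diag (f x) $ i $ j)" for i j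
    using assms by (cases i; cases j) (auto intro!: continuous_intros)
  then have "continuous_on S (\<lambda>x. \<chi> i j. block_diag (f x) $ i $ j)"
    by (intro continuous_on_vec_lambda)
  then show ?thesis by simp
qed

lemma block_diag_Lorentz:
  assumes "orthogonal_matrix k" shows "block_diag k \<in> Lorentz"
proof (rule LorentzI)
  have "(k ** transpose k) $ a $ b = (\<Sum>c\<in>UNIV. k $ a $ c * k $ b $ c)" for a b
    by (simp add: matrix_matrix_mult_def transpose_def)
  then have k: "(\<Sum>c\<in>UNIV. k $ a $ c * k $ b $ c) = (if a = b then 1 else 0)" for a b
    using assms by (simp add: orthogonal_matrix_def mat_def)
  show "block_diag k ** J_mat ** transpose (block_diag k) = J_mat"
    by (rule mat1_eqI) (auto simp: J_form_entry J_mat_simps k)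
qed

lemma SO_mult: "a \<in> SO \<Longrightarrow> b \<in> SO \<Longrightarrow> a ** b \<in> SO"
  by (simp add: SO_def orthogonal_matrix_mul det_mul)

lemma SO_transpose: "a \<in> SO \<Longrightarrow> transpose a \<in> SO"
  by (simp add: SO_def orthogonal_matrix_transpose det_transpose)

lemma SO_inverse: "a \<in> SO \<Longrightarrow> a ** transpose a = mat 1" "a \<in> SO \<Longrightarrow> transpose a ** a = mat 1"
  by (simp_all add: SO_def orthogonal_matrix_def)

lemma mat_1_SO: "mat 1 \<in> SO"
  by (simp add: SO_def orthogonal_matrix_id)

lemma block_diag_G: "k \<in> SO \<Longrightarrow> block_diag k \<in> G"
proof -
  assume k: "k \<in> SO"
  have "block_diag ` SO \<subseteq> (G :: 'a mat1 set)"
  proof (rule connected_subset_G)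
    show "connected (block_diag ` SO :: 'a mat1 set)"
      by (intro connected_continuous_image continuous_intros SO_connected)
    show "block_diag ` SO \<subseteq> (Lorentz :: 'a mat1 set)"
      by (auto simp: SO_def block_diag_Lorentz)
    show "mat 1 \<in> (block_diag ` SO :: 'a mat1 set)"
      using mat_1_SO block_diag_mat_1 by (metis image_eqI)
  qed (rule mat_1_G)
  with k show ?thesis by auto
qed

text \<open>
  Were the determinant of \<open>k\<close> equal to \<open>-1\<close>, multiplying by a reflection \<open>p\<close> of one coordinate would
  give an element of \<open>SO(n)\<close>. Its block matrix lies in \<open>G\<close> and has determinant \<open>1\<close>, although the block
  matrix of \<open>p\<close> has determinant \<open>-1\<close>.
\<close>

lemma det_block_diag_eq_1:
  assumes "orthogonal_matrix k" "det (block_diag k) = 1" shows "det k = 1"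
proof (rule ccontr)
  assume "det k \<noteq> 1"
  then have k: "det k = -1" using assms det_orthogonal_matrix by blast
  obtain j :: 'a where True by simp
  define e :: "'a \<Rightarrow> real" where "e = (\<lambda>a. if a = j then -1 else 1)"
  have e: "e a * e a = 1" for a by (simp add: e_def)
  define p :: "real^'a^'a" where "p = (\<chi> a b. if a = b then e a else 0)"
  have "transpose p = p" by (auto simp: p_def transpose_def vec_eq_iff)
  moreover have "(p ** p) $ a $ b = mat 1 $ a $ b" for a b
  proof -
    have "(p ** p) $ a $ b = (\<Sum>k\<in>UNIV. if k = a then (if a = b then 1 else 0) else 0)"
      unfolding matrix_matrix_mult_def vec_lambda_beta by (rule sum.cong) (auto simp: p_def e)
    then show ?thesis by (simp add: mat_def)
  qed
  then have "p ** p = mat 1" by (simp add: vec_eq_iff)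
  ultimately have p: "orthogonal_matrix p" by (simp add: orthogonal_matrix_def)
  have dp: "det p = -1"
    by (subst det_diagonal) (auto simp: p_def e_def prod.remove[of _ j])
  have dbp: "det (block_diag p) = -1"
  proof (subst det_diagonal)
    fix x y :: "'a option" assume "x \<noteq> y"
    then show "block_diag p $ x $ y = 0" by (cases x; cases y) (auto simp: p_def)
  next
    have "block_diag p $ x $ x = (if x = Some j then -1 else 1)" for x
      by (cases x) (auto simp: p_def e_def)
    then show "(\<Prod>x\<in>UNIV. block_diag p $ x $ x) = -1"
      by (simp add: prod.remove[of _ "Some j"])
  qed
  have "k ** p \<in> SO" using k p dp assms by (simp add: SO_def orthogonal_matrix_mul det_mul)
  from det_G[OF block_diag_G[OF this]] show False
    using assms dbp by (simp add: block_diag_mult det_mul)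
qed

text \<open>
  If the last row is a unit vector, orthogonality of the rows makes the last column a unit vector too.
\<close>

lemma stabilizer_in_K:
  assumes "m \<in> Lorentz" "det m = 1" "m $ None = axis None 1"
  shows "m \<in> K"
proof -
  have r: "m $ None $ None = 1" "m $ None $ Some a = 0" for a
    using assms(3) by (simp_all add: axis_def)
  have c: "m $ Some a $ None = 0" for a
    using Lorentz_entry[OF assms(1), of "Some a" None] r by (simp add: J_mat_def)
  define k where "k = (\<chi> a b. m $ Some a $ Some b)"
  have m: "m = block_diag k"
    by (rule mat1_eqI) (simp_all add: k_def r c)
  have "(\<Sum>x\<in>UNIV. k $ a $ x * k $ b $ x) = (if a = b then 1 else 0)" for a b
    using Lorentz_entry[OF assms(1), of "Some a" "Some b"] c by (simp add: J_mat_def k_def split: if_splits)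
  then have "k ** transpose k = mat 1"
    by (simp add: matrix_matrix_mult_def transpose_def mat_def vec_eq_iff)
  then have o: "orthogonal_matrix k"
    by (simp add: orthogonal_matrix_def matrix_left_right_inverse)
  then have "det k = 1" using det_block_diag_eq_1 assms(2) m by blast
  with o m show ?thesis by (auto simp: K_def SO_def)
qed

lemma last_row_block_diag_mult: "last_row (block_diag k ** g) = last_row g"
  by (simp add: last_row_def matrix_matrix_mult_def sum_option_UNIV)

lemma last_row_mult_block_diag: "last_row (g ** block_diag k) = last_row g v* k"
  by (simp add: last_row_def matrix_matrix_mult_def sum_option_UNIV vector_matrix_mult_def vec_eq_iff mult.commute)

lemma self_in_coset: "g \<in> coset g"
  unfolding coset_def K_def using mat_1_SO block_diag_mat_1
  by (metis (no_types, lifting) image_eqI matrix_mul_lid)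

lemma last_row_in_coset: "h \<in> coset g \<Longrightarrow> last_row h = last_row g"
  by (auto simp: coset_def K_def last_row_block_diag_mult)

text \<open>
  If \<open>g\<close> and \<open>h\<close> have the same last row, then \<open>h g\<^sup>-\<^sup>1\<close> fixes the last unit row vector.
\<close>

lemma coset_eq_iff:
  assumes "g \<in> G" "h \<in> G"
  shows "coset g = coset h \<longleftrightarrow> last_row g = last_row h"
proof
  assume "coset g = coset h"
  then show "last_row g = last_row h" using self_in_coset last_row_in_coset by blast
next
  assume l: "last_row g = last_row h"
  have sub: "coset h \<subseteq> coset g" if "g \<in> G" "h \<in> G" "last_row g = last_row h" for g h :: "'a mat1"
  proof -
    define m where "m = h ** matrix_inv g"
    have inv: "invertible g" using G_invertible that by blast
    have h: "h = m ** g"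
      using inv by (simp add: m_def matrix_mul_assoc[symmetric] matrix_inv_cancel)
    have "m \<in> Lorentz" unfolding m_def
      using that by (intro Lorentz_mult Lorentz_inverse G_Lorentz)
    moreover have "det m = 1" using h det_G[of g] det_G[of h] that by (simp add: det_mul)
    moreover have "m $ None = (g ** matrix_inv g) $ None"
      using G_last_row_eq[OF that] by (simp add: m_def matrix_matrix_mult_def)
    then have "m $ None = axis None 1"
      using inv by (simp add: matrix_inv_cancel mat_def axis_def vec_eq_iff)
    ultimately have "m \<in> K" by (rule stabilizer_in_K)
    then obtain k where k: "k \<in> SO" "m = block_diag k" by (auto simp: K_def)
    show ?thesis
    proof
      fix x assume "x \<in> coset h"
      then obtain k' where "k' \<in> SO" "x = block_diag k' ** h" by (auto simp: coset_def K_def)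
      then have "x = block_diag (k' ** k) ** g" "k' ** k \<in> SO"
        using h k by (simp_all add: block_diag_mult matrix_mul_assoc SO_mult)
      then show "x \<in> coset g" by (auto simp: coset_def K_def)
    qed
  qed
  show "coset g = coset h" using sub[of g h] sub[of h g] assms l by auto
qed

text \<open>
  The symmetric positive definite element of \<open>G\<close> with last row \<open>(y, sqrt (1 + y \<bullet> y))\<close>. It is a
  section of the projection to the quotient.
\<close>

definition boost :: "real^'n \<Rightarrow> 'n::finite mat1" where
  "boost y = (\<chi> i j. case (i, j) of
      (Some a, Some b) \<Rightarrow> (if a = b then 1 else 0) + y $ a * y $ b / (1 + sqrt (1 + y \<bullet> y))
    | (Some a, None) \<Rightarrow> y $ a | (None, Some b) \<Rightarrow> y $ b | (None, None) \<Rightarrow> sqrt (1 + y \<bullet> y))"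

lemma boost_simps [simp]:
  "boost y $ Some a $ Some b = (if a = b then 1 else 0) + y $ a * y $ b / (1 + sqrt (1 + y \<bullet> y))"
  "boost y $ Some a $ None = y $ a" "boost y $ None $ Some b = y $ b"
  "boost y $ None $ None = sqrt (1 + y \<bullet> y)"
  by (simp_all add: boost_def)

lemma last_row_boost [simp]: "last_row (boost y) = y"
  by (simp add: last_row_def vec_eq_iff)

lemma boost_denominator: "1 + sqrt (1 + y \<bullet> y) \<noteq> 0"
proof -
  have "sqrt (1 + y \<bullet> y) \<ge> 0" by simp
  then show ?thesis by linarith
qed

lemma boost_Lorentz: "boost (y :: real^'n::finite) \<in> Lorentz"
proof (rule LorentzI)
  define q where "q = sqrt (1 + y \<bullet> y)"
  have q: "q \<ge> 0" "q * q = 1 + y \<bullet> y" by (simp_all add: q_def)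
  have q1: "1 + q \<noteq> 0" using q by linarith
  have s: "(\<Sum>c\<in>UNIV. y $ c * y $ c) = q * q - 1" using q by (simp add: inner_vec_def)
  have A: "(\<Sum>c\<in>UNIV. y $ c * ((if b = c then 1 else 0) + y $ b * y $ c / (1 + q))) = y $ b * q" for b
  proof -
    have "(\<Sum>c\<in>UNIV. y $ c * ((if b = c then 1 else 0) + y $ b * y $ c / (1 + q)))
        = (\<Sum>c\<in>UNIV. (if b = c then y $ c else 0) + y $ b / (1 + q) * (y $ c * y $ c))"
      by (intro sum.cong) (auto simp: algebra_simps)
    also have "\<dots> = y $ b + y $ b / (1 + q) * (q * q - 1)"
      by (simp only: sum.distrib sum_distrib_left[symmetric] s) simp
    also have "\<dots> = y $ b * q" using q1 by (simp add: field_simps)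
    finally show ?thesis .
  qed
  have B: "(\<Sum>c\<in>UNIV. ((if a = c then 1 else 0) + y $ a * y $ c / (1 + q)) *
      ((if b = c then 1 else 0) + y $ b * y $ c / (1 + q))) = (if a = b then 1 else 0) + y $ a * y $ b" for a b
  proof -
    have "(\<Sum>c\<in>UNIV. ((if a = c then 1 else 0) + y $ a * y $ c / (1 + q)) *
      ((if b = c then 1 else 0) + y $ b * y $ c / (1 + q)))
      = (\<Sum>c\<in>UNIV. (if a = c then (if b = c then 1 else 0) + y $ b * y $ c / (1 + q) else 0)
         + y $ a / (1 + q) * (y $ c * ((if b = c then 1 else 0) + y $ b * y $ c / (1 + q))))"
      by (intro sum.cong) (auto simp: algebra_simps)
    also have "\<dots> = (if a = b then 1 else 0) + y $ b * y $ a / (1 + q) + y $ a / (1 + q) * (y $ b * q)"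
      by (simp only: sum.distrib sum_distrib_left[symmetric] A) simp
    also have "\<dots> = (if a = b then 1 else 0) + y $ a * y $ b"
    proof -
      have "u / (1 + q) + u / (1 + q) * q = u / (1 + q) * (1 + q)" for u
        by (simp only: distrib_left mult_1_right)
      then have "u / (1 + q) + u / (1 + q) * q = u" for u using q1 by simp
      from this[of "y $ a * y $ b"] show ?thesis by (simp add: mult_ac)
    qed
    finally show ?thesis .
  qed
  have A': "(\<Sum>c\<in>UNIV. ((if b = c then 1 else 0) + y $ b * y $ c / (1 + q)) * y $ c) = y $ b * q" for b
    by (rule trans[OF sum.cong[OF refl mult.commute] A])
  have s': "q * q - (\<Sum>c\<in>UNIV. y $ c * y $ c) = 1" using s by simp
  show "boost y ** J_mat ** transpose (boost y) = J_mat"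
    by (rule mat1_eqI; simp only: J_form_entry boost_simps J_mat_simps q_def[symmetric] A A' B s')
       auto
qed

lemma differentiable_boost: "boost differentiable (at (y :: real^'n::finite))"
proof -
  have n: "((\<lambda>y :: real^'n. y $ a) has_derivative (\<lambda>h. h $ a)) (at y)" for a
    by (rule bounded_linear_imp_has_derivative) (rule bounded_linear_vec_nth)
  have n': "(\<lambda>y :: real^'n. y $ a) differentiable (at y)" for a
    using n by (auto simp: differentiable_def)
  have "(\<lambda>y :: real^'n. 1 + y \<bullet> y) differentiable (at y)"
    by (auto intro!: derivative_intros differentiable_inner)
  moreover have "1 + y \<bullet> y > 0" by (simp add: add_pos_nonneg)
  ultimately have q: "(\<lambda>y :: real^'n. sqrt (1 + y \<bullet> y)) differentiable (at y)"
    unfolding differentiable_def by (auto intro: has_derivative_real_sqrt)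
  have "(\<lambda>y :: real^'n. boost y $ i $ j) differentiable (at y)" for i j
    using n' q boost_denominator[of y]
    by (cases i; cases j) (auto intro!: differentiable_add differentiable_mult differentiable_divide)
  then have "(\<lambda>y. \<Sum>i\<in>UNIV. \<Sum>j\<in>UNIV. (boost y $ i $ j) *\<^sub>R (e_mat i j :: 'n mat1)) differentiable (at y)"
    by (intro differentiable_sum differentiable_scaleR) auto
  moreover have "(\<Sum>i\<in>UNIV. \<Sum>j\<in>UNIV. (A $ i $ j) *\<^sub>R e_mat i j) = A" for A :: "'n mat1"
  proof -
    have "(\<Sum>j\<in>UNIV. A $ i $ j * e_mat i j $ r $ c) = (if i = r then A $ i $ c else 0)" for i r c
      by (auto simp: e_mat_def if_distrib cong: if_cong)
    then show ?thesis by (simp add: vec_eq_iff)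
  qed
  ultimately show ?thesis by simp
qed

lemma continuous_on_boost: "continuous_on S boost"
  by (simp add: continuous_at_imp_continuous_on differentiable_boost differentiable_imp_continuous_within)

lemma boost_G: "boost (y :: real^'n::finite) \<in> G"
proof -
  have "range boost \<subseteq> (G :: 'n mat1 set)"
  proof (rule connected_subset_G)
    show "connected (range (boost :: real^'n \<Rightarrow> _))"
      by (intro connected_continuous_image continuous_on_boost) auto
    have "boost 0 = (mat 1 :: 'n mat1)" by (rule mat1_eqI) (simp_all add: mat_def)
    then show "mat 1 \<in> range (boost :: real^'n \<Rightarrow> _)" by (metis rangeI)
  qed (auto simp: boost_Lorentz mat_1_G)
  then show ?thesis by auto
qed

text \<open>
  \<open>from_coords\<close> and \<open>coords\<close> are the mutually inverse identifications of \<open>\<real>\<^sup>n\<close> with the quotient.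
\<close>

definition from_coords :: "real^'n \<Rightarrow> 'n::finite mat1 set" where
  "from_coords y = coset (boost y)"

definition coords :: "'n::finite mat1 set \<Rightarrow> real^'n" where
  "coords q = last_row (SOME g. g \<in> q)"

lemma coords_coset: "coords (coset g) = last_row g"
  unfolding coords_def by (rule last_row_in_coset) (metis self_in_coset someI)

lemma coset_eq_from_coords: "g \<in> G \<Longrightarrow> coset g = from_coords (last_row g)"
  unfolding from_coords_def by (subst coset_eq_iff) (auto simp: boost_G)

lemma coords_from_coords [simp]: "coords (from_coords y) = y"
  by (simp add: from_coords_def coords_coset)

lemma from_coords_Q [simp]: "from_coords y \<in> Q"
  by (simp add: from_coords_def Q_def boost_G)

lemma from_coords_coords: "q \<in> Q \<Longrightarrow> from_coords (coords q) = q"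
  by (auto simp: Q_def coords_coset coset_eq_from_coords)

lemma Q_eq: "Q = range from_coords"
  using from_coords_coords by (metis from_coords_Q subsetI subset_antisym image_subset_iff rangeI)

lemma right_action_coset:
  assumes "g \<in> G" shows "right_action k (coset g) = coset (g ** block_diag k)"
  using assms by (simp add: right_action_def Q_def coset_def image_image matrix_mul_assoc)

lemma right_action_from_coords: "k \<in> SO \<Longrightarrow> right_action k (from_coords y) = from_coords (y v* k)"
  using coset_eq_from_coords[OF G_mult[OF boost_G block_diag_G], of k y]
  by (simp add: from_coords_def[of y] right_action_coset boost_G last_row_mult_block_diag)

section \<open>The Lie algebra and the tangent spaces of the group\<close>

definition lie_algebra :: "'n::finite mat1 set" where
  "lie_algebra = {X. X ** J_mat + J_mat ** transpose X = 0}"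

lemma mult_J_entry:
  "(X ** J_mat) $ i $ j = X $ i $ j * (if j = None then 1 else -1)"
  "(J_mat ** X) $ i $ j = (if i = None then 1 else -1) * X $ i $ j"
  for X :: "'n::finite mat1"
proof -
  have "(X ** J_mat) $ i $ j = (\<Sum>k\<in>UNIV. if k = j then X $ i $ j * (if j = None then 1 else -1) else 0)"
    unfolding matrix_matrix_mult_def vec_lambda_beta by (rule sum.cong) (auto simp: J_mat_def)
  then show "(X ** J_mat) $ i $ j = X $ i $ j * (if j = None then 1 else -1)" by simp
  have "(J_mat ** X) $ i $ j = (\<Sum>k\<in>UNIV. if k = i then (if i = None then 1 else -1) * X $ i $ j else 0)"
    unfolding matrix_matrix_mult_def vec_lambda_beta by (rule sum.cong) (auto simp: J_mat_def)
  then show "(J_mat ** X) $ i $ j = (if i = None then 1 else -1) * X $ i $ j" by simp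
qed

lemma lie_algebra_entries:
  "X \<in> lie_algebra \<longleftrightarrow> (\<forall>i j. X $ i $ j * (if j = None then 1 else -1) +
      (if i = None then 1 else -1) * X $ j $ i = 0)"
  for X :: "'n::finite mat1"
  by (simp add: lie_algebra_def vec_eq_iff mult_J_entry transpose_def)

lemma lie_algebra_iff:
  "X \<in> lie_algebra \<longleftrightarrow> (\<forall>a b. X $ Some a $ Some b + X $ Some b $ Some a = 0) \<and>
     (\<forall>a. X $ Some a $ None = X $ None $ Some a) \<and> X $ None $ None = 0"
  for X :: "'n::finite mat1"
proof -
  have "X \<in> lie_algebra \<longleftrightarrow> (\<forall>i j. X $ i $ j * (if j = None then 1 else -1) +
      (if i = None then 1 else -1) * X $ j $ i = 0)"
    by (rule lie_algebra_entries)
  also have "\<dots> \<longleftrightarrow> (\<forall>a b. X $ Some a $ Some b + X $ Some b $ Some a = 0) \<and>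
     (\<forall>a. X $ Some a $ None = X $ None $ Some a) \<and> X $ None $ None = 0"
    (is "?l \<longleftrightarrow> ?r")
  proof
    assume l: ?l
    have "X $ Some a $ Some b + X $ Some b $ Some a = 0" "X $ Some a $ None = X $ None $ Some a"
      "X $ None $ None = 0" for a b
      using l[rule_format, of "Some a" "Some b"] l[rule_format, of "Some a" None] l[rule_format, of None None]
      by simp_all
    then show ?r by blast
  next
    assume r: ?r
    show ?l
    proof (intro allI)
      fix i j
      show "X $ i $ j * (if j = None then 1 else -1) + (if i = None then 1 else -1) * X $ j $ i = 0"
      proof (cases i)
        case (Some a)
        have "X $ Some a $ Some b + X $ Some b $ Some a = 0" for b using r by blast
        then have "- X $ Some a $ Some b - X $ Some b $ Some a = 0" for b
          by (metis add.inverse_neutral minus_add_distrib diff_conv_add_uminus)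
        then show ?thesis using r Some by (cases j) simp_all
      qed (use r in \<open>cases j; auto\<close>)
    qed
  qed
  finally show ?thesis .
qed

lemma lie_algebra_subspace: "subspace lie_algebra"
proof (rule subspaceI)
  fix X Y :: "'a mat1" and c :: real
  have *: "a + b + (c + d) = 0" if "a + c = 0" "b + d = 0" for a b c d :: real using that by linarith
  show "X + Y \<in> lie_algebra" if "X \<in> lie_algebra" "Y \<in> lie_algebra"
    using that by (simp add: lie_algebra_iff *)
  show "c *\<^sub>R X \<in> lie_algebra" if "X \<in> lie_algebra"
    using that by (simp add: lie_algebra_iff distrib_left[symmetric])
qed (simp add: lie_algebra_iff)

lemma e_mat_mult: "e_mat i j ** e_mat k l = (if j = k then e_mat i l else 0)"
  for i j k l :: "'n::finite option"
proof -
  have "(e_mat i j ** e_mat k l) $ r $ c = (\<Sum>x\<in>UNIV. if x = j then (if j = k \<and> r = i \<and> c = l then 1 else 0) else 0)" for r c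
    unfolding matrix_matrix_mult_def vec_lambda_beta by (rule sum.cong) (auto simp: e_mat_def)
  then have "(e_mat i j ** e_mat k l) $ r $ c = (if j = k then e_mat i l else 0) $ r $ c" for r c
    by (auto simp: e_mat_def)
  then show ?thesis by (simp only: vec_eq_iff) simp
qed

lemma index_less_trichotomy: "i \<noteq> j \<Longrightarrow> index_less i j \<or> index_less j i"
  by (cases i; cases j) auto

lemma E_mat_entry:
  "E_mat i j $ r $ c = (if r = i \<and> c = j then (if j = None then 1 else -1) else 0)
     + (if r = j \<and> c = i then 1 else 0)"
  by (simp add: E_mat_def e_mat_def)

lemma E_mat_lie_algebra: "index_less i j \<Longrightarrow> E_mat i j \<in> lie_algebra"
  unfolding lie_algebra_entries
proof (intro allI)
  fix r c assume ij: "index_less i j"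
  then have ne: "i \<noteq> j" "i \<noteq> None" using index_less_imp_neq by (blast, cases i) auto
  let ?\<epsilon> = "\<lambda>j :: 'a option. if j = None then 1 else -1 :: real"
  consider "r = i" "c = j" | "r = j" "c = i" | "\<not> (r = i \<and> c = j)" "\<not> (r = j \<and> c = i)" by blast
  then show "E_mat i j $ r $ c * ?\<epsilon> c + ?\<epsilon> r * E_mat i j $ c $ r = 0"
  proof cases
    case 3
    then have 4: "\<not> (c = i \<and> r = j)" "\<not> (c = j \<and> r = i)" by blast+
    have "E_mat i j $ r $ c = 0" "E_mat i j $ c $ r = 0" by (simp_all only: E_mat_entry 3 4 if_False add_0)
    then show ?thesis by simp
  qed (use ne in \<open>simp_all add: E_mat_entry\<close>)
qed

text \<open>
  Because of this relation, the exponential series of \<open>t E\<close> collapses to a combination of \<open>1\<close>, \<open>E\<close> and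
  \<open>E\<^sup>2\<close> whose coefficients are circular or hyperbolic functions of \<open>t\<close>.
\<close>

lemma E_mat_cube:
  fixes i j :: "'n::{finite,linorder} option"
  assumes "index_less i j"
  shows "E_mat i j ** E_mat i j ** E_mat i j = (if j = None then 1 else -1) *\<^sub>R E_mat i j"
proof -
  have "i \<noteq> j" "j \<noteq> i" using index_less_imp_neq[OF assms] by auto
  show ?thesis
    using \<open>i \<noteq> j\<close> \<open>j \<noteq> i\<close> by (auto simp: E_mat_def matrix_mult_bilinear e_mat_mult)
qed

lemma lie_algebra_expansion:
  fixes X :: "'n::{finite,linorder} mat1"
  assumes "X \<in> lie_algebra"
  shows "X = (\<Sum>(i, j)\<in>{(i, j). index_less i j}. X $ j $ i *\<^sub>R E_mat i j)"
proof -
  have "(\<Sum>(i, j)\<in>{(i, j). index_less i j}. X $ j $ i *\<^sub>R E_mat i j) $ r $ c = X $ r $ c" for r c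
  proof -
    let ?P = "{(i, j). index_less i j} :: ('n option \<times> 'n option) set"
    let ?\<epsilon> = "\<lambda>j :: 'n option. if j = None then 1 else -1 :: real"
    have "(\<Sum>(i, j)\<in>?P. X $ j $ i *\<^sub>R E_mat i j) $ r $ c
        = (\<Sum>p\<in>?P. (if p = (r, c) then ?\<epsilon> c * X $ c $ r else 0) + (if p = (c, r) then X $ r $ c else 0))"
      unfolding sum_component
    proof (intro sum.cong refl)
      fix p :: "'n option \<times> 'n option" assume p: "p \<in> ?P"
      obtain a b where ab: "p = (a, b)" "a \<noteq> b" using p index_less_imp_neq by (cases p) blast
      consider "r = a" "c = b" | "r = b" "c = a" | "\<not> (r = a \<and> c = b)" "\<not> (r = b \<and> c = a)" by blast
      then show "(case p of (i, j) \<Rightarrow> X $ j $ i *\<^sub>R E_mat i j) $ r $ c =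
          (if p = (r, c) then ?\<epsilon> c * X $ c $ r else 0) + (if p = (c, r) then X $ r $ c else 0)"
      proof cases
        case 1
        have "E_mat a b $ a $ b = ?\<epsilon> b" using ab(2) by (simp add: E_mat_entry)
        then show ?thesis using ab(2) unfolding ab(1) 1 by simp
      next
        case 2
        have "E_mat a b $ b $ a = 1" using ab(2) by (simp add: E_mat_entry)
        then show ?thesis using ab(2) unfolding ab(1) 2 by simp
      next
        case 3
        have E0: "E_mat a b $ r $ c = 0" by (simp only: E_mat_entry 3 if_False add_0)
        have p: "p \<noteq> (r, c)" "p \<noteq> (c, r)" using 3 ab(1) by blast+
        have "(case p of (i, j) \<Rightarrow> X $ j $ i *\<^sub>R E_mat i j) $ r $ c = 0" by (simp add: ab(1) E0)
        then show ?thesis by (simp only: p if_False add_0)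
      qed
    qed
    also have "\<dots> = (if index_less r c then ?\<epsilon> c * X $ c $ r else 0) + (if index_less c r then X $ r $ c else 0)"
      by (simp add: sum.distrib)
    also have "\<dots> = X $ r $ c"
    proof -
      have X: "X $ r $ c * ?\<epsilon> c + ?\<epsilon> r * X $ c $ r = 0"
        using assms unfolding lie_algebra_entries by blast
      consider "r = c" | "index_less r c" "\<not> index_less c r" | "index_less c r" "\<not> index_less r c"
        using index_less_trichotomy index_less_asym by blast
      then show ?thesis
      proof cases
        case 1
        then have "\<not> index_less r c" using index_less_imp_neq by blast
        then show ?thesis using 1 X by (simp split: if_splits)
      next
        case 2
        then obtain a where "r = Some a" by (cases r) auto
        then show ?thesis using 2 X by (cases c) simp_all
      qed simp
    qed
    finally show ?thesis .
  qed
  then show ?thesis by (simp add: vec_eq_iff)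
qed

lemma lie_algebra_span: "X \<in> lie_algebra \<Longrightarrow> X \<in> span E_basis"
proof -
  assume X: "X \<in> lie_algebra"
  have "(\<Sum>(i, j)\<in>{(i, j). index_less i j}. X $ j $ i *\<^sub>R E_mat i j) \<in> span E_basis"
    by (rule span_sum) (clarsimp, intro span_scale span_base, auto simp: E_basis_def)
  then show ?thesis using lie_algebra_expansion[OF X] by simp
qed

lemma e_mat_inner: "e_mat i j \<bullet> X = X $ i $ j"
proof -
  have "(\<Sum>c\<in>UNIV. e_mat i j $ r $ c * X $ r $ c) = (\<Sum>c\<in>UNIV. if c = j then (if r = i then X $ i $ j else 0) else 0)" for r
    by (rule sum.cong) (auto simp: e_mat_def)
  then show ?thesis by (simp add: inner_vec_def)
qed

lemma E_basis_inner:
  assumes "a \<in> E_basis" "b \<in> E_basis" shows "a \<bullet> b = (if a = b then 2 else 0)"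
proof -
  obtain i j k l where *: "a = E_mat i j" "b = E_mat k l" "index_less i j" "index_less k l"
    using assms by (auto simp: E_basis_def)
  have "a \<bullet> b = (if j = None then 1 else -1) * b $ i $ j + b $ j $ i"
    unfolding * E_mat_def[of i j] by (simp add: inner_add_left e_mat_inner)
  also have "b $ i $ j = (if l = None then 1 else -1) * (if k = i \<and> l = j then 1 else 0)"
  proof -
    have "\<not> (i = l \<and> j = k)" using * index_less_asym by blast
    then have "b $ i $ j = (if i = k \<and> j = l then (if l = None then 1 else -1) else 0)"
      unfolding *(2) E_mat_entry by (simp only: if_False add_0_right)
    also have "\<dots> = (if l = None then 1 else -1) * (if k = i \<and> l = j then 1 else 0)" by (cases "i = k"; cases "j = l") simp_all
    finally show ?thesis .
  qed
  also have "b $ j $ i = (if k = i \<and> l = j then 1 else 0)"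
    using * E_mat_lower by blast
  finally have "a \<bullet> b = (if k = i \<and> l = j then 2 else 0)" by (auto)
  moreover have "a = b \<longleftrightarrow> k = i \<and> l = j"
    using * E_mat_lower[of i j i j] E_mat_lower[of k l i j] by (auto split: if_splits)
  ultimately show ?thesis by simp
qed

text \<open>
  The basis is orthogonal with squared length \<open>2\<close> for the Euclidean inner product of matrices, since
  every basis element has two entries of absolute value \<open>1\<close>.
\<close>

lemma lie_inner_eq:
  assumes "X \<in> lie_algebra" "Y \<in> lie_algebra"
  shows "lie_inner X Y = (X \<bullet> Y) / 2"
proof -
  let ?r = "representation E_basis"
  have fin: "finite (E_basis :: 'a mat1 set)"
    using independent_E_basis independent_imp_finite by blast
  have *: "(\<Sum>b\<in>E_basis. ?r Z b *\<^sub>R b) = Z" if "Z \<in> lie_algebra" for Z :: "'a mat1"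
    by (rule sum_representation_eq[OF independent_E_basis lie_algebra_span[OF that] fin order_refl])
  have "a \<bullet> Y = 2 * ?r Y a" if "a \<in> E_basis" for a
  proof -
    have "a \<bullet> Y = (\<Sum>b\<in>E_basis. ?r Y b * (a \<bullet> b))"
      by (subst *[OF assms(2), symmetric]) (simp add: inner_sum_right)
    also have "\<dots> = (\<Sum>b\<in>E_basis. if b = a then 2 * ?r Y a else 0)"
      by (rule sum.cong) (auto simp: E_basis_inner that)
    finally show ?thesis using fin that by simp
  qed
  then have "(\<Sum>a\<in>E_basis. ?r X a * (a \<bullet> Y)) = 2 * lie_inner X Y"
    by (simp add: lie_inner_def sum_distrib_left mult_ac)
  moreover have "X \<bullet> Y = (\<Sum>a\<in>E_basis. ?r X a * (a \<bullet> Y))"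
    by (subst *[OF assms(1), symmetric]) (simp add: inner_sum_left)
  ultimately show ?thesis by simp
qed

text \<open>
  Elements of the Lie algebra move through \<open>J\<close> with a change of sign, which reduces the claim to
  \<open>(1 + s X + k X\<^sup>2) (1 - s X + k X\<^sup>2) = 1\<close>. By the cubic relation, the left-hand side is
  \<open>1 + (2 k - s\<^sup>2 + \<eta> k\<^sup>2) X\<^sup>2\<close>.
\<close>

lemma one_parameter_Lorentz:
  fixes X :: "'n::finite mat1"
  assumes X: "X \<in> lie_algebra" and cube: "X ** X ** X = \<eta> *\<^sub>R X" and sk: "2 * k - s\<^sup>2 + \<eta> * k\<^sup>2 = 0"
  shows "mat 1 + s *\<^sub>R X + k *\<^sub>R (X ** X) \<in> Lorentz"
proof (rule LorentzI)
  let ?A = "mat 1 + s *\<^sub>R X + k *\<^sub>R (X ** X)"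
  have JX: "J_mat ** transpose X = - (X ** J_mat)"
    using X by (simp add: lie_algebra_def add_eq_0_iff)
  have JXX: "J_mat ** (transpose X ** transpose X) = X ** X ** J_mat"
    unfolding matrix_mul_assoc JX
    by (simp add: matrix_mult_bilinear) (simp add: matrix_mul_assoc[symmetric] JX matrix_mult_bilinear)
  have tr: "transpose ?A = mat 1 + s *\<^sub>R transpose X + k *\<^sub>R (transpose X ** transpose X)"
    by (simp add: transpose_def matrix_matrix_mult_def vec_eq_iff mat_def mult.commute)
  have "J_mat ** transpose ?A = (mat 1 - s *\<^sub>R X + k *\<^sub>R (X ** X)) ** J_mat"
    unfolding tr by (simp add: matrix_mult_bilinear JX JXX)
  then have "?A ** J_mat ** transpose ?A
      = ?A ** (mat 1 - s *\<^sub>R X + k *\<^sub>R (X ** X)) ** J_mat"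
    by (simp only: matrix_mul_assoc[symmetric])
  also have "?A ** (mat 1 - s *\<^sub>R X + k *\<^sub>R (X ** X)) = mat 1"
  proof -
    have c: "X ** (X ** X) = \<eta> *\<^sub>R X" "X ** X ** (X ** X) = \<eta> *\<^sub>R (X ** X)"
      using cube by (simp_all add: matrix_mul_assoc matrix_mult_bilinear)
    have "?A ** (mat 1 - s *\<^sub>R X + k *\<^sub>R (X ** X))
        = mat 1 + (2 * k - s\<^sup>2 + \<eta> * k\<^sup>2) *\<^sub>R (X ** X)"
      by (simp add: matrix_mult_bilinear cube c)
         (simp add: vec_eq_iff algebra_simps power2_eq_square)
    then show ?thesis using sk by simp
  qed
  finally show "?A ** J_mat ** transpose ?A = J_mat" by simp
qed

lemma one_parameter_tangent:
  fixes X :: "'n::finite mat1"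
  assumes X: "X \<in> lie_algebra" and cube: "X ** X ** X = \<eta> *\<^sub>R X"
    and sk: "\<And>t. 2 * k t - (s t)\<^sup>2 + \<eta> * (k t)\<^sup>2 = 0"
    and smooth: "smooth_on UNIV s" "smooth_on UNIV k"
    and "s 0 = 0" "k 0 = 0" "(s has_real_derivative 1) (at 0)" "(k has_real_derivative 0) (at 0)"
  shows "a *\<^sub>R X \<in> tangent_vectors G (mat 1)"
proof -
  define c where "c = (\<lambda>t. mat 1 + s (a * t) *\<^sub>R X + k (a * t) *\<^sub>R (X ** X))"
  have lin: "bounded_linear (\<lambda>t::real. a * t)" by (rule bounded_linear_mult_right)
  have sc: "smooth_on UNIV c"
    unfolding c_def
    using smooth_on_compose_linear[OF lin open_UNIV smooth(1)] smooth_on_compose_linear[OF lin open_UNIV smooth(2)]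
    by (intro smooth_on_add smooth_on_bilinear[OF bounded_bilinear_scaleR] smooth_on_const open_UNIV) auto
  have contc: "continuous_on UNIV c"
    using sc unfolding smooth_on_def by (metis C_on.simps(1))
  have "range c \<subseteq> G"
  proof (rule connected_subset_G)
    show "connected (range c)" using contc by (intro connected_continuous_image) auto
    show "range c \<subseteq> Lorentz" by (auto simp: c_def intro!: one_parameter_Lorentz[OF X cube sk])
    show "mat 1 \<in> range c" by (rule range_eqI[of _ _ 0]) (simp add: c_def assms)
  qed (rule mat_1_G)
  then have "c \<in> smooth_curves G (mat 1)"
    using sc by (auto simp: smooth_curves_def c_def assms intro!: exI[of _ 1] intro: smooth_on_subset)
  moreover have "(c has_vector_derivative a *\<^sub>R X) (at 0)"
  proof -
    have d: "((\<lambda>t. a * t) has_real_derivative a) (at 0)" by (auto intro!: derivative_eq_intros)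
    have "((\<lambda>t. s (a * t)) has_real_derivative 1 * a) (at 0)"
      by (rule DERIV_chain2[of s]) (use assms d in auto)
    moreover have "((\<lambda>t. k (a * t)) has_real_derivative 0 * a) (at 0)"
      by (rule DERIV_chain2[of k]) (use assms d in auto)
    ultimately show ?thesis
      unfolding c_def by (auto intro!: derivative_eq_intros)
  qed
  ultimately show ?thesis unfolding tangent_vectors_def by blast
qed

lemma E_mat_tangent:
  fixes i j :: "'n::{finite,linorder} option"
  assumes "index_less i j" shows "a *\<^sub>R E_mat i j \<in> tangent_vectors G (mat 1)"
proof (cases "j = None")
  case True
  have "C_on k UNIV (\<lambda>t::real. cosh t - 1)" for k
    using C_on_add[OF open_UNIV C_on_sinh_cosh[of k 0 1] C_on_const[of k UNIV "-1"]] by simp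
  moreover have "2 * (cosh t - 1) - (sinh t)\<^sup>2 + 1 * (cosh t - 1)\<^sup>2 = 0" for t :: real
    using hyperbolic_pythagoras[of t] by (simp add: power2_eq_square algebra_simps)
  ultimately show ?thesis
    using E_mat_cube[OF assms] True assms C_on_sinh_cosh[of _ 1 0]
    by (intro one_parameter_tangent[where \<eta>=1 and s=sinh and k="\<lambda>t. cosh t - 1"])
       (auto intro!: E_mat_lie_algebra assms derivative_eq_intros simp: smooth_on_def)
next
  case False
  have "C_on k UNIV (\<lambda>t::real. 1 - cos t)" for k
    using C_on_add[OF open_UNIV C_on_sin_cos[of k 0 "-1"] C_on_const[of k UNIV "1"]] by simp
  moreover have "2 * (1 - cos t) - (sin t)\<^sup>2 + (-1) * (1 - cos t)\<^sup>2 = 0" for t :: real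
    by (simp add: sin_squared_eq power2_eq_square algebra_simps)
  ultimately show ?thesis
    using E_mat_cube[OF assms] False assms C_on_sin_cos[of _ 1 0]
    by (intro one_parameter_tangent[where \<eta>="-1" and s=sin and k="\<lambda>t. 1 - cos t"])
       (auto intro!: E_mat_lie_algebra assms derivative_eq_intros simp: smooth_on_def)
qed

lemma smooth_curves_mult:
  assumes "c \<in> smooth_curves G g" "d \<in> smooth_curves G h"
  shows "(\<lambda>t. c t ** d t) \<in> smooth_curves G (g ** h)"
proof -
  obtain e1 e2 where e: "e1 > 0" "smooth_on {-e1<..<e1} c" "c ` {-e1<..<e1} \<subseteq> G"
    "e2 > 0" "smooth_on {-e2<..<e2} d" "d ` {-e2<..<e2} \<subseteq> G"
    using assms by (auto simp: smooth_curves_def)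
  let ?e = "min e1 e2"
  have sub: "{-?e<..<?e} \<subseteq> {-e1<..<e1}" "{-?e<..<?e} \<subseteq> {-e2<..<e2}" by auto
  have "smooth_on {-?e<..<?e} (\<lambda>t. c t ** d t)"
    using e sub by (intro smooth_on_bilinear[OF bounded_bilinear_matrix_mult]) (auto intro: smooth_on_subset)
  moreover have "(\<lambda>t. c t ** d t) ` {-?e<..<?e} \<subseteq> G"
  proof
    fix x assume "x \<in> (\<lambda>t. c t ** d t) ` {-?e<..<?e}"
    then obtain t where "t \<in> {-?e<..<?e}" "x = c t ** d t" by blast
    moreover from this have "c t \<in> G" "d t \<in> G" using e(3,6) sub by blast+
    ultimately show "x \<in> G" by (simp add: G_mult)
  qed
  moreover have "?e > 0" using e by simp
  moreover have "c 0 = g" "d 0 = h" using assms by (auto simp: smooth_curves_def)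
  ultimately show ?thesis unfolding smooth_curves_def by blast
qed

lemma smooth_curves_const: "g \<in> G \<Longrightarrow> (\<lambda>t. g) \<in> smooth_curves G g"
  by (auto simp: smooth_curves_def smooth_on_const intro: exI[of _ 1])

lemma tangent_mult:
  assumes "g \<in> G" "v \<in> tangent_vectors G h" shows "g ** v \<in> tangent_vectors G (g ** h)"
proof -
  obtain c where c: "c \<in> smooth_curves G h" "(c has_vector_derivative v) (at 0)"
    using assms by (auto simp: tangent_vectors_def)
  have "((\<lambda>t. g ** c t) has_vector_derivative g ** v) (at 0)"
    using bounded_linear.has_vector_derivative[OF bounded_bilinear.bounded_linear_right[OF bounded_bilinear_matrix_mult] c(2)] .
  then show ?thesis
    using smooth_curves_mult[OF smooth_curves_const[OF assms(1)] c(1)] by (auto simp: tangent_vectors_def)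
qed

lemma tangent_add:
  assumes "v \<in> tangent_vectors G (mat 1)" "w \<in> tangent_vectors G (mat 1)"
  shows "v + w \<in> tangent_vectors G (mat 1)"
proof -
  obtain c d where c: "c \<in> smooth_curves G (mat 1)" "(c has_vector_derivative v) (at 0)"
    and d: "d \<in> smooth_curves G (mat 1)" "(d has_vector_derivative w) (at 0)"
    using assms by (auto simp: tangent_vectors_def)
  have 0: "c 0 = mat 1" "d 0 = mat 1" using c d by (auto simp: smooth_curves_def)
  have "((\<lambda>t. c t ** d t) has_vector_derivative c 0 ** w + v ** d 0) (at 0)"
    using bounded_bilinear.has_vector_derivative[OF bounded_bilinear_matrix_mult c(2) d(2)] .
  then have "((\<lambda>t. c t ** d t) has_vector_derivative v + w) (at 0)"
    by (simp add: 0 add.commute)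
  then show ?thesis
    using smooth_curves_mult[OF c(1) d(1)] by (auto simp: tangent_vectors_def)
qed

text \<open>
  Products of curves through the identity add their velocities, so the one-parameter subgroups of the
  basis elements already produce every element of the Lie algebra as a velocity.
\<close>

lemma lie_algebra_tangent:
  fixes X :: "'n::{finite,linorder} mat1"
  assumes "X \<in> lie_algebra" shows "X \<in> tangent_vectors G (mat 1)"
proof -
  have z: "0 \<in> tangent_vectors G (mat 1 :: 'n mat1)"
    using smooth_curves_const[OF mat_1_G] has_vector_derivative_const
    unfolding tangent_vectors_def by blast
  have "(\<Sum>(i, j)\<in>P. X $ j $ i *\<^sub>R E_mat i j) \<in> tangent_vectors G (mat 1)"
    if "finite P" "P \<subseteq> {(i, j). index_less i j}" for P
    using that by (induction P rule: finite_induct) (auto intro!: z tangent_add E_mat_tangent)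
  from this[of "{(i, j). index_less i j}"] show ?thesis
    using lie_algebra_expansion[OF assms] by simp
qed

lemma tangent_vectors_G:
  fixes g :: "'n::{finite,linorder} mat1"
  assumes g: "g \<in> G" shows "tangent_vectors G g = (\<lambda>X. g ** X) ` lie_algebra"
proof
  show "(\<lambda>X. g ** X) ` lie_algebra \<subseteq> tangent_vectors G g"
    using tangent_mult[OF g lie_algebra_tangent] by auto
next
  show "tangent_vectors G g \<subseteq> (\<lambda>X. g ** X) ` lie_algebra"
  proof
    fix v assume "v \<in> tangent_vectors G g"
    then obtain c e where c: "c 0 = g" "e > 0" "c ` {-e<..<e} \<subseteq> G" "(c has_vector_derivative v) (at 0)"
      by (auto simp: tangent_vectors_def smooth_curves_def)
    have tr: "bounded_linear (transpose :: 'n mat1 \<Rightarrow> _)"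
      unfolding linear_conv_bounded_linear[symmetric]
      by (auto intro!: linearI simp: transpose_def vec_eq_iff)
    have 1: "((\<lambda>t. c t ** J_mat) has_vector_derivative v ** J_mat) (at 0)"
      using bounded_linear.has_vector_derivative[OF bounded_bilinear.bounded_linear_left[OF bounded_bilinear_matrix_mult] c(4)] .
    have 2: "((\<lambda>t. transpose (c t)) has_vector_derivative transpose v) (at 0)"
      using bounded_linear.has_vector_derivative[OF tr c(4)] .
    have "((\<lambda>t. c t ** J_mat ** transpose (c t)) has_vector_derivative
        c 0 ** J_mat ** transpose v + v ** J_mat ** transpose (c 0)) (at 0)"
      using bounded_bilinear.has_vector_derivative[OF bounded_bilinear_matrix_mult 1 2] .
    moreover have "((\<lambda>t. c t ** J_mat ** transpose (c t)) has_vector_derivative 0) (at 0)"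
    proof (rule has_vector_derivative_transform_within_open[of "\<lambda>t. J_mat" _ _ "{-e<..<e}"])
      fix t assume "t \<in> {-e<..<e}"
      then have "c t \<in> G" using c(3) by blast
      then show "J_mat = c t ** J_mat ** transpose (c t)"
        by (rule LorentzD[OF G_Lorentz, symmetric])
    qed (use c(2) in auto)
    ultimately have 0: "g ** J_mat ** transpose v + v ** J_mat ** transpose g = 0"
      using vector_derivative_unique_at c(1) by blast
    define X where "X = matrix_inv g ** v"
    have inv: "matrix_inv g ** g = mat 1" "g ** matrix_inv g = mat 1"
      using matrix_inv_cancel G_invertible g by blast+
    have v: "v = g ** X" by (simp add: X_def matrix_mul_assoc inv)
    have "g ** (X ** J_mat + J_mat ** transpose X) ** transpose g = 0"
      using 0 unfolding v
      by (simp add: matrix_transpose_mul matrix_mul_assoc add.commute matrix_mult_bilinear)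
    then have "matrix_inv g ** (g ** (X ** J_mat + J_mat ** transpose X) ** transpose g) ** transpose (matrix_inv g) = 0"
      by (simp add: matrix_mult_bilinear)
    moreover have "matrix_inv g ** (g ** Z ** transpose g) ** transpose (matrix_inv g)
        = (matrix_inv g ** g) ** Z ** transpose (matrix_inv g ** g)" for Z
      by (simp only: matrix_transpose_mul matrix_mul_assoc)
    ultimately have "X \<in> lie_algebra" by (simp add: lie_algebra_def inv)
    then show "v \<in> (\<lambda>X. g ** X) ` lie_algebra" using v by auto
  qed
qed

section \<open>The quotient metric in coordinates\<close>

text \<open>
  The derivation of the algebra of smooth functions on the quotient that differentiates at \<open>y\<close> in the
  direction \<open>w\<close>. Like all elements of \<open>Q_tangent\<close>, it is \<open>0\<close> on other functions.
\<close>

definition directional :: "real^'n \<Rightarrow> real^'n \<Rightarrow> ('n::finite mat1 set \<Rightarrow> real) \<Rightarrow> real" where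
  "directional y w = (\<lambda>\<phi>. if \<phi> \<in> Q_functions then frechet_derivative (\<lambda>z. \<phi> (from_coords z)) (at y) w else 0)"

lemma Q_functions_local:
  assumes "\<phi> \<in> Q_functions" "g \<in> G"
  obtains U h where "open U" "g \<in> U" "smooth_on U h" "\<And>x. x \<in> G \<Longrightarrow> x \<in> U \<Longrightarrow> \<phi> (coset x) = h x"
  using assms unfolding Q_functions_def smooth_functions_def by blast

text \<open>
  Pull back along the boosts, a differentiable section of the projection.
\<close>

lemma Q_function_differentiable:
  fixes y :: "real^'n::finite"
  assumes "\<phi> \<in> Q_functions"
  shows "(\<lambda>z. \<phi> (from_coords z)) differentiable (at y)"
proof -
  obtain U h where U: "open U" "boost y \<in> U" "smooth_on U h"
    "\<And>x. x \<in> G \<Longrightarrow> x \<in> U \<Longrightarrow> \<phi> (coset x) = h x"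
    using Q_functions_local[OF assms boost_G] by metis
  have "(\<lambda>z. h (boost z)) differentiable (at y)"
    using differentiable_chain_at[OF differentiable_boost smooth_on_differentiable[OF U(3,2)]]
    by (simp add: o_def)
  then obtain D where D: "((\<lambda>z. h (boost z)) has_derivative D) (at y)"
    by (auto simp: differentiable_def)
  have "open (boost -` U)"
    using U(1) continuous_on_boost[of "UNIV :: (real^'n) set"] by (simp add: continuous_on_open_vimage)
  from has_derivative_transform_within_open[OF D this, of "\<lambda>z. \<phi> (from_coords z)"]
  show ?thesis
    using U(2,4) boost_G unfolding differentiable_def from_coords_def by force
qed

lemma Q_function_has_derivative:
  "\<phi> \<in> Q_functions \<Longrightarrow> ((\<lambda>z. \<phi> (from_coords z)) has_derivative (\<lambda>w. directional y w \<phi>)) (at y)"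
  using Q_function_differentiable[of \<phi> y] frechet_derivative_works[of "\<lambda>z. \<phi> (from_coords z)" "at y"]
  by (simp add: directional_def eta_contract_eq)

lemma directional_eqI:
  assumes "\<phi> \<in> Q_functions" "((\<lambda>z. \<phi> (from_coords z)) has_derivative D) (at y)"
  shows "directional y w \<phi> = D w"
  using frechet_derivative_at[OF assms(2)] assms(1) by (simp add: directional_def)

lemma coords_Q_functions: "(\<lambda>q. coords q $ i) \<in> Q_functions"
proof -
  have "(\<lambda>g. last_row g $ i) \<in> smooth_functions G"
    by (intro linear_smooth_functions bounded_linear_compose[OF bounded_linear_vec_nth bounded_linear_last_row])
  then show ?thesis by (simp add: Q_functions_def coords_coset)
qed

lemma directional_coords: "directional y w (\<lambda>q. coords q $ i) = w $ i"
proof (rule directional_eqI[OF coords_Q_functions])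
  have "((\<lambda>z :: real^'a. z $ i) has_derivative (\<lambda>w. w $ i)) (at y)"
    by (rule bounded_linear_imp_has_derivative) (rule bounded_linear_vec_nth)
  then show "((\<lambda>z. coords (from_coords z) $ i) has_derivative (\<lambda>w. w $ i)) (at y)"
    by (simp only: coords_from_coords)
qed

text \<open>
  The coordinates are smooth functions on the quotient, and a derivation in direction \<open>w\<close> takes them to
  the components of \<open>w\<close>.
\<close>

lemma directional_inject: "directional y w = directional z v \<Longrightarrow> w = v"
proof -
  assume e: "directional y w = directional z v"
  have "w $ i = v $ i" for i
    using fun_cong[OF e, of "\<lambda>q. coords q $ i"] by (simp only: directional_coords)
  then show "w = v" by (simp add: vec_eq_iff)
qed

lemma Q_functions_linear_combination:
  "\<phi> \<in> Q_functions \<Longrightarrow> \<psi> \<in> Q_functions \<Longrightarrow> (\<lambda>q. a * \<phi> q + b * \<psi> q) \<in> Q_functions"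
  unfolding Q_functions_def mem_Collect_eq by (rule smooth_functions_linear_combination)

lemma Q_functions_mult:
  "\<phi> \<in> Q_functions \<Longrightarrow> \<psi> \<in> Q_functions \<Longrightarrow> (\<lambda>q. \<phi> q * \<psi> q) \<in> Q_functions"
  unfolding Q_functions_def mem_Collect_eq by (rule smooth_functions_mult)

lemma Q_functions_cong:
  "\<phi> \<in> Q_functions \<Longrightarrow> (\<And>q. q \<in> Q \<Longrightarrow> \<phi> q = \<psi> q) \<Longrightarrow> \<psi> \<in> Q_functions"
  unfolding Q_functions_def Q_def mem_Collect_eq by (erule smooth_functions_cong) blast

lemma Q_functions_const: "(\<lambda>q. c) \<in> Q_functions"
  unfolding Q_functions_def smooth_functions_def using smooth_on_const by blast

lemma directional_Q_tangent: "directional y w \<in> Q_tangent (from_coords y)"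
  unfolding Q_tangent_def
proof (intro CollectI conjI allI ballI impI)
  fix \<phi> \<psi> :: "'a mat1 set \<Rightarrow> real" and a b
  assume f: "\<phi> \<in> Q_functions" "\<psi> \<in> Q_functions"
  note d = Q_function_has_derivative[OF f(1), of y] Q_function_has_derivative[OF f(2), of y]
  show "directional y w (\<lambda>q. a * \<phi> q + b * \<psi> q) = a * directional y w \<phi> + b * directional y w \<psi>"
    by (rule directional_eqI[OF Q_functions_linear_combination[OF f]])
       (intro has_derivative_add has_derivative_mult_right d)
  show "directional y w (\<lambda>q. \<phi> q * \<psi> q) = \<phi> (from_coords y) * directional y w \<psi> + directional y w \<phi> * \<psi> (from_coords y)"
    by (rule directional_eqI[OF Q_functions_mult[OF f]]) (intro has_derivative_mult d)
qed (simp add: directional_def)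

text \<open>
  Functions on the quotient are here functions of arbitrary sets of matrices. A derivation does not
  see their values off \<open>Q\<close>: the difference \<open>\<delta>\<close> of two functions that agree on \<open>Q\<close> satisfies
  \<open>\<delta> = \<kappa> \<delta>\<close> with \<open>\<kappa>\<close> the indicator of the complement of \<open>Q\<close>, and the product rule applied to
  \<open>\<kappa> \<delta>\<close> gives \<open>0\<close>, because both factors vanish at \<open>p\<close>.
\<close>

lemma Q_tangent_local:
  assumes X: "X \<in> Q_tangent p" "p \<in> Q" and f: "\<phi> \<in> Q_functions" "\<And>q. q \<in> Q \<Longrightarrow> \<phi> q = \<psi> q"
  shows "X \<phi> = X \<psi>"
proof -
  have g: "\<psi> \<in> Q_functions" using Q_functions_cong f by blast
  define \<kappa> :: "'a mat1 set \<Rightarrow> real" where "\<kappa> = (\<lambda>q. if q \<in> Q then 0 else 1)"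
  define \<delta> where "\<delta> = (\<lambda>q. 1 * \<phi> q + (-1) * \<psi> q)"
  have chi: "\<kappa> \<in> Q_functions"
    by (rule Q_functions_cong[OF Q_functions_const[of 0]]) (simp add: \<kappa>_def)
  have del: "\<delta> \<in> Q_functions"
    unfolding \<delta>_def by (rule Q_functions_linear_combination[OF f(1) g])
  have "\<delta> = (\<lambda>q. \<kappa> q * \<delta> q)" using f by (auto simp: \<kappa>_def \<delta>_def fun_eq_iff)
  then have "X \<delta> = X (\<lambda>q. \<kappa> q * \<delta> q)" by (rule arg_cong)
  also have "X (\<lambda>q. \<kappa> q * \<delta> q) = \<kappa> p * X \<delta> + X \<kappa> * \<delta> p"
    using X chi del unfolding Q_tangent_def by blast
  also have "\<dots> = 0" using X(2) f(2) by (simp add: \<kappa>_def \<delta>_def)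
  finally have "X \<delta> = 0" .
  moreover have "X \<delta> = 1 * X \<phi> + (-1) * X \<psi>"
    using X f(1) g unfolding Q_tangent_def \<delta>_def by blast
  ultimately show ?thesis by simp
qed

lemma coset_differential_eq:
  fixes g :: "'n::finite mat1"
  assumes g: "g \<in> G" and v: "v \<in> tangent_vectors G g"
  shows "coset_differential g v = directional (last_row g) (last_row v)"
proof
  fix \<phi> :: "'n mat1 set \<Rightarrow> real"
  show "coset_differential g v \<phi> = directional (last_row g) (last_row v) \<phi>"
  proof (cases "\<phi> \<in> Q_functions")
    case True
    let ?d = "directional (last_row g) (last_row v) \<phi>"
    have *: "((\<lambda>t. \<phi> (coset (c t))) has_real_derivative ?d) (at 0)"
      if c: "c \<in> smooth_curves G g" "(c has_vector_derivative v) (at 0)" for c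
    proof -
      obtain e where e: "e > 0" "c ` {-e<..<e} \<subseteq> G" "c 0 = g"
        using c(1) by (auto simp: smooth_curves_def)
      have l: "((\<lambda>t. last_row (c t)) has_vector_derivative last_row v) (at 0)"
        by (rule bounded_linear.has_vector_derivative[OF bounded_linear_last_row c(2)])
      have "((\<lambda>z. \<phi> (from_coords z)) has_derivative (\<lambda>w. directional (last_row g) w \<phi>)) (at (last_row (c 0)))"
        using Q_function_has_derivative[OF True] e(3) by simp
      from has_derivative_compose[OF l[unfolded has_vector_derivative_def] this]
      have d: "((\<lambda>t. \<phi> (from_coords (last_row (c t)))) has_derivative (\<lambda>t. directional (last_row g) (t *\<^sub>R last_row v) \<phi>)) (at 0)" .
      have "linear (\<lambda>w. directional (last_row g) w \<phi>)"
        using Q_function_has_derivative[OF True] has_derivative_linear by blast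
      then have "directional (last_row g) (t *\<^sub>R last_row v) \<phi> = t * ?d" for t
        using linear_scale[where f="\<lambda>w. directional (last_row g) w \<phi>"] by simp
      then have "((\<lambda>t. \<phi> (from_coords (last_row (c t)))) has_real_derivative ?d) (at 0)"
        using d by (simp add: has_field_derivative_def mult_commute_abs)
      then show ?thesis
      proof (rule has_field_derivative_transform_within_open[of _ _ _ "{-e<..<e}"])
        fix t assume "t \<in> {-e<..<e}"
        then have "c t \<in> G" using e(2) by blast
        then show "\<phi> (from_coords (last_row (c t))) = \<phi> (coset (c t))" by (simp add: coset_eq_from_coords)
      qed (use e in auto)
    qed
    obtain c where c: "c \<in> smooth_curves G g" "(c has_vector_derivative v) (at 0)"
      using v by (auto simp: tangent_vectors_def)
    have "(THE d. \<forall>c\<in>smooth_curves G g. (c has_vector_derivative v) (at 0) \<longrightarrow>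
                   ((\<lambda>t. \<phi> (coset (c t))) has_real_derivative d) (at 0)) = ?d"
      by (rule the_equality) (use * c DERIV_unique in blast)+
    then show ?thesis using True by (simp add: coset_differential_def)
  qed (simp add: coset_differential_def directional_def)
qed

text \<open>
  The image of \<open>u\<close> under the adjoint of the map \<open>X \<mapsto> last_row (g X)\<close> from the Lie algebra to \<open>\<real>\<^sup>n\<close>,
  where \<open>y\<close> is the last row of \<open>g\<close>; see \<open>horizontal_lift_inner\<close>.
\<close>

definition horizontal_lift :: "real^'n \<Rightarrow> real^'n \<Rightarrow> 'n::finite mat1" where
  "horizontal_lift y u = (\<chi> i j. case (i, j) of
      (Some a, Some b) \<Rightarrow> y $ a * u $ b - u $ a * y $ b
    | (Some a, None) \<Rightarrow> sqrt (1 + y \<bullet> y) * u $ a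
    | (None, Some b) \<Rightarrow> sqrt (1 + y \<bullet> y) * u $ b
    | (None, None) \<Rightarrow> 0)"

lemma horizontal_lift_simps [simp]:
  "horizontal_lift y u $ Some a $ Some b = y $ a * u $ b - u $ a * y $ b"
  "horizontal_lift y u $ Some a $ None = sqrt (1 + y \<bullet> y) * u $ a"
  "horizontal_lift y u $ None $ Some a = sqrt (1 + y \<bullet> y) * u $ a"
  "horizontal_lift y u $ None $ None = 0"
  by (simp_all add: horizontal_lift_def)

lemma horizontal_lift_lie_algebra: "horizontal_lift y u \<in> lie_algebra"
  by (simp add: lie_algebra_iff)

text \<open>
  The inverse of the composition of \<open>X \<mapsto> last_row (g X)\<close> with its adjoint, which is
  \<open>u \<mapsto> (1 + 2 (y \<bullet> y)) u - (y \<bullet> u) y\<close>. As \<open>sharp y v \<bullet> w\<close> turns out to be the quotient metric, it is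
  also the passage from a vector to the corresponding covector.
\<close>

definition sharp :: "real^'n \<Rightarrow> real^'n \<Rightarrow> real^'n::finite" where
  "sharp y w = (1 / (1 + 2 * (y \<bullet> y))) *\<^sub>R (w + ((y \<bullet> w) / (1 + y \<bullet> y)) *\<^sub>R y)"

lemma last_row_mult:
  assumes "g \<in> G"
  shows "last_row (g ** X) $ b = sqrt (1 + last_row g \<bullet> last_row g) * X $ None $ Some b + (\<Sum>a\<in>UNIV. last_row g $ a * X $ Some a $ Some b)"
  using G_corner[OF assms] by (simp add: last_row_def matrix_matrix_mult_def sum_option_UNIV)

text \<open>
  The adjointness. The blocks of \<open>X\<close> enter the inner product twice, once above and once below the
  diagonal, which is where the factor \<open>2\<close> comes from.
\<close>

lemma horizontal_lift_inner:
  assumes g: "g \<in> G" and X: "X \<in> lie_algebra"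
  shows "horizontal_lift (last_row g) u \<bullet> X = 2 * (u \<bullet> last_row (g ** X))"
proof -
  let ?y = "last_row g" and ?q = "sqrt (1 + last_row g \<bullet> last_row g)"
  have skew: "X $ Some a $ Some b = - X $ Some b $ Some a" for a b
    unfolding eq_neg_iff_add_eq_0 using X unfolding lie_algebra_iff by blast
  have sym: "X $ Some a $ None = X $ None $ Some a" for a
    using X unfolding lie_algebra_iff by blast
  have "(\<Sum>a\<in>UNIV. \<Sum>b\<in>UNIV. u $ a * ?y $ b * X $ Some a $ Some b)
      = (\<Sum>a\<in>UNIV. \<Sum>b\<in>UNIV. u $ b * ?y $ a * X $ Some b $ Some a)"
    by (rule sum.swap)
  also have "\<dots> = - (\<Sum>a\<in>UNIV. \<Sum>b\<in>UNIV. ?y $ a * u $ b * X $ Some a $ Some b)"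
    unfolding sum_negf[symmetric] by (intro sum.cong refl) (subst skew, simp)
  finally have 1: "(\<Sum>a\<in>UNIV. \<Sum>b\<in>UNIV. (?y $ a * u $ b - u $ a * ?y $ b) * X $ Some a $ Some b)
      = 2 * (\<Sum>a\<in>UNIV. \<Sum>b\<in>UNIV. ?y $ a * u $ b * X $ Some a $ Some b)"
    by (simp add: left_diff_distrib sum_subtractf)
  have "horizontal_lift ?y u \<bullet> X = 2 * (\<Sum>b\<in>UNIV. ?q * u $ b * X $ None $ Some b)
      + (\<Sum>a\<in>UNIV. \<Sum>b\<in>UNIV. (?y $ a * u $ b - u $ a * ?y $ b) * X $ Some a $ Some b)"
    by (simp add: inner_vec_def sum_option_UNIV sum.distrib sym)
  also have "\<dots> = 2 * (\<Sum>b\<in>UNIV. u $ b * (?q * X $ None $ Some b + (\<Sum>a\<in>UNIV. ?y $ a * X $ Some a $ Some b)))"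
    unfolding 1
    by (subst sum.swap) (simp add: distrib_left sum.distrib sum_distrib_left mult_ac)
  finally show ?thesis by (simp add: inner_vec_def last_row_mult[OF g])
qed

lemma last_row_horizontal_lift:
  assumes "g \<in> G"
  shows "last_row (g ** horizontal_lift (last_row g) (sharp (last_row g) w)) = w"
proof -
  let ?y = "last_row g"
  define s where "s = ?y \<bullet> ?y"
  have s: "1 + s \<noteq> 0" "1 + 2 * s \<noteq> 0" "1 + s \<ge> 0"
    using inner_ge_zero[of ?y] unfolding s_def by (linarith+)
  have 1: "last_row (g ** horizontal_lift ?y u) = (1 + 2 * s) *\<^sub>R u - (?y \<bullet> u) *\<^sub>R ?y" for u
  proof -
    have "last_row (g ** horizontal_lift ?y u) $ b = (1 + s) * u $ b
        + (\<Sum>a\<in>UNIV. (?y $ a * ?y $ a) * u $ b - (?y $ a * u $ a) * ?y $ b)" for b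
      using s(3) by (simp add: last_row_mult[OF assms] s_def[symmetric] algebra_simps)
    also have "\<dots> b = (1 + s) * u $ b + s * u $ b - (?y \<bullet> u) * ?y $ b" for b
      by (simp add: sum_subtractf sum_distrib_right[symmetric] s_def inner_vec_def)
    finally show ?thesis by (simp add: vec_eq_iff algebra_simps)
  qed
  have 2: "?y \<bullet> sharp ?y w = (?y \<bullet> w) / (1 + s)"
  proof -
    have "?y \<bullet> sharp ?y w = (1 / (1 + 2 * s)) * ((?y \<bullet> w) * ((1 + 2 * s) / (1 + s)))"
      using s(1) unfolding sharp_def by (simp add: inner_add_right s_def[symmetric] add_divide_eq_iff distrib_left)
    then show ?thesis using s by simp
  qed
  show ?thesis unfolding 1 2 using s by (simp add: sharp_def s_def[symmetric])
qed

lemma G_metric_eq: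
  fixes g :: "'n::{finite,linorder} mat1"
  assumes "g \<in> G" "X \<in> lie_algebra" "Y \<in> lie_algebra"
  shows "G_metric g (g ** X) (g ** Y) = (X \<bullet> Y) / 2"
  using assms by (simp add: G_metric_def matrix_mul_assoc matrix_inv_cancel[OF G_invertible] lie_inner_eq)

lemma vertical_eq:
  fixes g :: "'n::{finite,linorder} mat1"
  assumes g: "g \<in> G"
  shows "vertical g = {g ** X | X. X \<in> lie_algebra \<and> last_row (g ** X) = 0}"
proof -
  have "coset_differential g v = (\<lambda>\<phi>. 0) \<longleftrightarrow> last_row v = 0" if "v \<in> tangent_vectors G g" for v
  proof -
    have "directional (last_row g) 0 \<phi> = 0" for \<phi>
    proof (cases "\<phi> \<in> Q_functions")
      case True
      have "linear (\<lambda>w. directional (last_row g) w \<phi>)"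
        using Q_function_has_derivative[OF True] has_derivative_linear by blast
      then show ?thesis by (rule linear_0)
    qed (simp add: directional_def)
    then have "(\<lambda>\<phi>. 0) = directional (last_row g) 0" by auto
    then show ?thesis
      using directional_inject[of "last_row g" "last_row v" "last_row g" 0] by (auto simp: coset_differential_eq[OF g that])
  qed
  then show ?thesis
    unfolding vertical_def using tangent_vectors_G[OF g] by auto
qed

text \<open>
  A vector is vertical if its last row vanishes, so the horizontal vectors are those orthogonal to the
  kernel of \<open>X \<mapsto> last_row (g X)\<close>: the range of the adjoint.
\<close>

lemma horizontal_eq:
  fixes g :: "'n::{finite,linorder} mat1"
  assumes g: "g \<in> G"
  shows "horizontal g = range (\<lambda>w. g ** horizontal_lift (last_row g) (sharp (last_row g) w))"
proof
  let ?h = "\<lambda>w. horizontal_lift (last_row g) (sharp (last_row g) w)"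
  show "range (\<lambda>w. g ** ?h w) \<subseteq> horizontal g"
    unfolding horizontal_def vertical_eq[OF g]
    by (auto simp: tangent_vectors_G[OF g] horizontal_lift_lie_algebra horizontal_lift_inner[OF g]
        G_metric_eq[OF g horizontal_lift_lie_algebra])
  show "horizontal g \<subseteq> range (\<lambda>w. g ** ?h w)"
  proof
    fix v assume v: "v \<in> horizontal g"
    then obtain X where X: "X \<in> lie_algebra" "v = g ** X"
      using tangent_vectors_G[OF g] by (auto simp: horizontal_def)
    define w where "w = last_row v"
    define Z where "Z = X - ?h w"
    have Z: "Z \<in> lie_algebra"
      unfolding Z_def by (intro subspace_diff lie_algebra_subspace X horizontal_lift_lie_algebra)
    have gZ: "g ** Z = v - g ** ?h w"
      by (simp add: Z_def X matrix_mult_bilinear)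
    have "last_row (g ** Z) = 0"
      unfolding gZ linear_diff[OF bounded_linear.linear[OF bounded_linear_last_row]] last_row_horizontal_lift[OF g] w_def by simp
    then have "g ** Z \<in> vertical g" using Z by (auto simp: vertical_eq[OF g])
    then have "X \<bullet> Z = 0"
      using v G_metric_eq[OF g X(1) Z] by (auto simp: horizontal_def X(2))
    moreover have "?h w \<bullet> Z = 0"
      using horizontal_lift_inner[OF g Z] \<open>last_row (g ** Z) = 0\<close> by simp
    ultimately have "Z \<bullet> Z = 0" by (simp add: Z_def inner_diff_left)
    then have "X = ?h w" by (simp add: Z_def)
    then show "v \<in> range (\<lambda>w. g ** ?h w)" using X by auto
  qed
qed

lemma G_metric_horizontal:
  fixes g :: "'n::{finite,linorder} mat1"
  assumes g: "g \<in> G" and "v \<in> horizontal g" "w \<in> horizontal g"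
  shows "G_metric g v w = sharp (last_row g) (last_row v) \<bullet> last_row w"
proof -
  obtain a b where *: "v = g ** horizontal_lift (last_row g) (sharp (last_row g) a)"
    "w = g ** horizontal_lift (last_row g) (sharp (last_row g) b)"
    using assms horizontal_eq[OF g] by auto
  show ?thesis
    unfolding * G_metric_eq[OF g horizontal_lift_lie_algebra horizontal_lift_lie_algebra]
    by (simp add: horizontal_lift_inner[OF g horizontal_lift_lie_algebra] last_row_horizontal_lift[OF g])
qed

lemma coset_differential_horizontal:
  assumes "g \<in> G" "v \<in> horizontal g"
  shows "coset_differential g v = directional (last_row g) (last_row v)"
  using assms by (intro coset_differential_eq) (auto simp: horizontal_def)

text \<open>
  The definition ranges over all representatives \<open>g\<close> of the coset and all horizontal vectors with the
  prescribed projections. The value of the metric of \<open>G\<close> depends only on the coordinates \<open>y\<close> and on the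
  last rows of these vectors, so the condition can be stated within \<open>\<real>\<^sup>n\<close>. The description is kept
  for arbitrary \<open>X\<close> and \<open>Y\<close>, since isometries are tested on arbitrary derivations.
\<close>

lemma Q_metric_eq:
  fixes y :: "real^'n::{finite,linorder}"
  shows "Q_metric (from_coords y) X Y =
    (THE r. \<forall>v w. X = directional y v \<and> Y = directional y w \<longrightarrow> r = sharp y v \<bullet> w)"
proof -
  have "(\<forall>g\<in>G. \<forall>v\<in>horizontal g. \<forall>w\<in>horizontal g.
     coset g = from_coords y \<and> coset_differential g v = X \<and> coset_differential g w = Y \<longrightarrow> r = G_metric g v w)
   \<longleftrightarrow> (\<forall>v w. X = directional y v \<and> Y = directional y w \<longrightarrow> r = sharp y v \<bullet> w)" (is "?l \<longleftrightarrow> ?r") for r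
  proof
    assume l: ?l
    show ?r
    proof (intro allI impI)
      fix v w assume *: "X = directional y v \<and> Y = directional y w"
      let ?h = "\<lambda>w. boost y ** horizontal_lift y (sharp y w)"
      have h: "?h w \<in> horizontal (boost y)" "last_row (?h w) = w" for w
        using horizontal_eq[OF boost_G, of y] last_row_horizontal_lift[OF boost_G, of y] by auto
      have "r = G_metric (boost y) (?h v) (?h w)"
        using l[rule_format, OF boost_G h(1) h(1)] *
        by (simp add: coset_differential_horizontal[OF boost_G h(1)] h(2) from_coords_def)
      then show "r = sharp y v \<bullet> w"
        by (simp add: G_metric_horizontal[OF boost_G h(1) h(1)] h(2))
    qed
  next
    assume r: ?r
    show ?l
    proof (intro ballI impI)
      fix g v w assume g: "g \<in> G" "v \<in> horizontal g" "w \<in> horizontal g"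
        and *: "coset g = from_coords y \<and> coset_differential g v = X \<and> coset_differential g w = Y"
      have "last_row g = y" using * coords_coset[of g] by simp
      then show "r = G_metric g v w"
        using r * g by (auto simp: coset_differential_horizontal G_metric_horizontal)
    qed
  qed
  then show ?thesis unfolding Q_metric_def by simp
qed

lemma Q_metric_directional:
  fixes y :: "real^'n::{finite,linorder}"
  shows "Q_metric (from_coords y) (directional y v) (directional y w) = sharp y v \<bullet> w"
  unfolding Q_metric_eq by (rule the_equality) (blast dest: directional_inject)+

section \<open>Isometries of the rotation invariant metric on Euclidean space\<close>

text \<open>
  The squared length of the velocity \<open>w\<close> at \<open>y\<close> in the quotient metric, see \<open>sharp_inner\<close>.
\<close>

definition quot_form :: "'a::euclidean_space \<Rightarrow> 'a \<Rightarrow> real" where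
  "quot_form y w = (w \<bullet> w + (y \<bullet> w)\<^sup>2 / (1 + y \<bullet> y)) / (1 + 2 * (y \<bullet> y))"

text \<open>
  The distance of \<open>y\<close> from the origin in the metric \<open>quot_form\<close>.
\<close>

definition radius :: "'a::euclidean_space \<Rightarrow> real" where
  "radius y = arsinh (norm y)"

text \<open>
  A path from \<open>x\<close> to \<open>y\<close> whose speed never exceeds \<open>\<bar>L\<bar>\<close>, hence of length at most \<open>\<bar>L\<bar>\<close>. Bounding the speed
  on a unit time interval takes the place of integrating it.
\<close>

definition joined_within :: "'a::euclidean_space \<Rightarrow> 'a \<Rightarrow> real \<Rightarrow> bool" where
  "joined_within x y L \<longleftrightarrow> (\<exists>\<gamma> \<gamma>'. \<gamma> 0 = x \<and> \<gamma> 1 = y \<and>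
     (\<forall>t\<in>{0..1::real}. (\<gamma> has_vector_derivative \<gamma>' t) (at t) \<and> quot_form (\<gamma> t) (\<gamma>' t) \<le> L\<^sup>2))"

definition quot_isometry :: "('a::euclidean_space \<Rightarrow> 'a) \<Rightarrow> bool" where
  "quot_isometry f \<longleftrightarrow> (\<forall>y. \<exists>D. (f has_derivative D) (at y) \<and> (\<forall>w. quot_form (f y) (D w) = quot_form y w))"

lemma radius_nonneg: "radius y \<ge> 0"
  unfolding radius_def using arsinh_real_neg_iff[of "norm y"] norm_ge_zero[of y] by linarith

lemma radius_sinh: "norm u = 1 \<Longrightarrow> a \<ge> 0 \<Longrightarrow> radius (sinh a *\<^sub>R u) = a"
  by (simp add: radius_def arsinh_sinh_real)

lemma radius_zero [simp]: "radius 0 = 0" by (simp add: radius_def)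

lemma radius_eq_0_iff: "radius y = 0 \<longleftrightarrow> y = 0"
  by (simp add: radius_def)

lemma sinh_radius: "sinh (radius y) = norm y"
  by (simp add: radius_def)

lemma direction:
  obtains u :: "'a::euclidean_space" where "norm u = 1" "y = sinh (radius y) *\<^sub>R u"
proof (cases "y = 0")
  case True
  obtain b :: 'a where "b \<in> Basis" using nonempty_Basis by blast
  then show thesis using that[of b] True by simp
next
  case False
  then show thesis using that[of "(1 / norm y) *\<^sub>R y"] by (simp add: sinh_radius)
qed

lemma joined_within_image:
  assumes "quot_isometry f" "joined_within x y L" shows "joined_within (f x) (f y) L"
proof -
  obtain \<gamma> \<gamma>' where g: "\<gamma> 0 = x" "\<gamma> 1 = y" "\<And>t. t \<in> {0..1::real} \<Longrightarrow> (\<gamma> has_vector_derivative \<gamma>' t) (at t)"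
     "\<And>t. t \<in> {0..1::real} \<Longrightarrow> quot_form (\<gamma> t) (\<gamma>' t) \<le> L\<^sup>2"
    using assms(2) unfolding joined_within_def by blast
  obtain D where D: "\<And>y. (f has_derivative D y) (at y)" "\<And>y w. quot_form (f y) (D y w) = quot_form y w"
    using assms(1) unfolding quot_isometry_def by metis
  have "((\<lambda>t. f (\<gamma> t)) has_vector_derivative D (\<gamma> t) (\<gamma>' t)) (at t)" if "t \<in> {0..1}" for t
    using vector_derivative_diff_chain_within[OF g(3)[OF that], of f "D (\<gamma> t)"] D(1)[of "\<gamma> t"]
    by (simp add: o_def has_derivative_at_withinI)
  then show ?thesis
    unfolding joined_within_def using g D(2)
    by (intro exI[of _ "\<lambda>t. f (\<gamma> t)"] exI[of _ "\<lambda>t. D (\<gamma> t) (\<gamma>' t)"]) auto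
qed

lemma joined_within_mono: "joined_within x y L \<Longrightarrow> L\<^sup>2 \<le> M\<^sup>2 \<Longrightarrow> joined_within x y M"
  unfolding joined_within_def by (blast intro: order_trans)

text \<open>
  By the Cauchy-Schwarz inequality, the radial component of a velocity is no longer than the velocity.
\<close>

lemma quot_form_radial_bound:
  fixes y w :: "'a::euclidean_space"
  shows "(y \<bullet> w)\<^sup>2 \<le> (y \<bullet> y) * (1 + y \<bullet> y) * quot_form y w"
proof -
  define q p where "q = y \<bullet> y" "p = (y \<bullet> w)\<^sup>2"
  have q: "q \<ge> 0" "1 + q > 0" "1 + 2 * q > 0" using inner_ge_zero[of y] unfolding q_p_def by linarith+
  have cs: "p \<le> q * (w \<bullet> w)" unfolding q_p_def by (rule Cauchy_Schwarz_ineq)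
  have "q * (1 + q) * quot_form y w = (q * (w \<bullet> w) * (1 + q) + q * p) / (1 + 2 * q)"
  proof -
    have "(1 + q) * (w \<bullet> w + p / (1 + q)) = (1 + q) * (w \<bullet> w) + p"
      using q(2) by (simp add: distrib_left)
    then have "q * ((1 + q) * (w \<bullet> w + p / (1 + q))) = q * (w \<bullet> w) * (1 + q) + q * p"
      by (simp add: algebra_simps)
    then show ?thesis unfolding quot_form_def q_p_def[symmetric] by (simp add: mult.assoc)
  qed
  moreover have "p * (1 + q) + q * p \<le> q * (w \<bullet> w) * (1 + q) + q * p"
    using cs q by (intro add_right_mono mult_right_mono) auto
  then have "p * (1 + 2 * q) \<le> q * (w \<bullet> w) * (1 + q) + q * p" by (simp add: algebra_simps)
  ultimately show ?thesis using q unfolding q_p_def[symmetric] by (simp add: pos_le_divide_eq)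
qed

text \<open>
  The radius grows at most with the speed of a path. As it is not differentiable at the origin,
  \<open>norm y\<close> is first replaced by \<open>sqrt (e + y \<bullet> y)\<close>, and then \<open>e\<close> tends to \<open>0\<close>.
\<close>

lemma joined_within_radius:
  assumes "joined_within x y L" "L \<ge> 0" shows "\<bar>radius x - radius y\<bar> \<le> L"
proof -
  obtain \<gamma> \<gamma>' where g: "\<gamma> 0 = x" "\<gamma> 1 = y" "\<And>t. t \<in> {0..1::real} \<Longrightarrow> (\<gamma> has_vector_derivative \<gamma>' t) (at t)"
     "\<And>t. t \<in> {0..1::real} \<Longrightarrow> quot_form (\<gamma> t) (\<gamma>' t) \<le> L\<^sup>2"
    using assms(1) unfolding joined_within_def by blast
  define \<psi> where "\<psi> e y = arsinh (sqrt (e + y \<bullet> y))" for e and y :: 'a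
  have bound: "\<bar>\<psi> e x - \<psi> e y\<bar> \<le> L" if e: "e > 0" for e
  proof -
    define d where "d t = (\<gamma> t \<bullet> \<gamma>' t) / (sqrt (e + \<gamma> t \<bullet> \<gamma> t) * sqrt (1 + (e + \<gamma> t \<bullet> \<gamma> t)))" for t
    have pos: "e + z \<bullet> z > 0" for z :: 'a using e inner_ge_zero[of z] by linarith
    have der: "((\<lambda>t. \<psi> e (\<gamma> t)) has_real_derivative d t) (at t)" if t: "t \<in> {0..1}" for t
    proof -
      let ?q = "\<gamma> t \<bullet> \<gamma> t"
      have "((\<lambda>t. \<gamma> t \<bullet> \<gamma> t) has_real_derivative 2 * (\<gamma> t \<bullet> \<gamma>' t)) (at t)"
        using bounded_bilinear.has_vector_derivative[OF bounded_bilinear_inner g(3)[OF t] g(3)[OF t]]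
        by (simp add: has_real_derivative_iff_has_vector_derivative inner_commute)
      then have 1: "((\<lambda>t. e + \<gamma> t \<bullet> \<gamma> t) has_real_derivative 2 * (\<gamma> t \<bullet> \<gamma>' t)) (at t)"
        by (auto intro!: derivative_eq_intros)
      have 2: "((\<lambda>t. sqrt (e + \<gamma> t \<bullet> \<gamma> t)) has_real_derivative (inverse (sqrt (e + ?q)) / 2) * (2 * (\<gamma> t \<bullet> \<gamma>' t))) (at t)"
        by (rule DERIV_chain2[OF DERIV_real_sqrt[OF pos] 1])
      have "((\<lambda>t. arsinh (sqrt (e + \<gamma> t \<bullet> \<gamma> t))) has_real_derivative
        (1 / sqrt ((sqrt (e + ?q))\<^sup>2 + 1)) * ((inverse (sqrt (e + ?q)) / 2) * (2 * (\<gamma> t \<bullet> \<gamma>' t)))) (at t)"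
        by (rule DERIV_chain2[OF _ 2]) (auto intro!: derivative_eq_intros)
      also have "(1 / sqrt ((sqrt (e + ?q))\<^sup>2 + 1)) * ((inverse (sqrt (e + ?q)) / 2) * (2 * (\<gamma> t \<bullet> \<gamma>' t))) = d t"
        using pos[of "\<gamma> t"] by (simp add: d_def field_simps)
      finally show ?thesis unfolding \<psi>_def .
    qed
    have dL: "\<bar>d t\<bar> \<le> L" if t: "t \<in> {0..1}" for t
    proof -
      define q where "q = \<gamma> t \<bullet> \<gamma> t"
      have q: "q \<ge> 0" by (simp add: q_def)
      have "(d t)\<^sup>2 = (\<gamma> t \<bullet> \<gamma>' t)\<^sup>2 / ((e + q) * (1 + (e + q)))"
        using e q unfolding d_def q_def[symmetric] by (simp add: power_divide power_mult_distrib)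
      also have "\<dots> \<le> L\<^sup>2"
      proof -
        have "(\<gamma> t \<bullet> \<gamma>' t)\<^sup>2 \<le> q * (1 + q) * quot_form (\<gamma> t) (\<gamma>' t)"
          unfolding q_def by (rule quot_form_radial_bound)
        also have "\<dots> \<le> q * (1 + q) * L\<^sup>2" using g(4)[OF t] q by (intro mult_left_mono) auto
        also have "\<dots> \<le> (e + q) * (1 + (e + q)) * L\<^sup>2"
          using e q by (intro mult_right_mono mult_mono) auto
        finally show ?thesis using e q by (simp add: pos_divide_le_eq mult.commute add_pos_nonneg)
      qed
      finally show ?thesis using assms(2) by (simp add: abs_le_square_iff[symmetric])
    qed
    have "norm (\<psi> e (\<gamma> 1) - \<psi> e (\<gamma> 0)) \<le> L * norm (1 - 0 :: real)"
    proof (rule field_differentiable_bound)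
      show "((\<lambda>t. \<psi> e (\<gamma> t)) has_field_derivative d t) (at t within {0..1})" if "t \<in> {0..1}" for t
        using der[OF that] by (rule has_field_derivative_at_within)
    qed (use dL in auto)
    then show ?thesis using g by (simp add: abs_minus_commute)
  qed
  have lim: "(\<lambda>n. \<psi> (inverse (real (Suc n))) z) \<longlonglongrightarrow> radius z" for z :: 'a
  proof -
    have "isCont (\<lambda>e. \<psi> e z) 0" unfolding \<psi>_def by (auto intro!: continuous_intros)
    then have "(\<lambda>n. \<psi> (inverse (real (Suc n))) z) \<longlonglongrightarrow> \<psi> 0 z"
      by (rule isCont_tendsto_compose) (rule LIMSEQ_inverse_real_of_nat)
    then show ?thesis by (simp add: \<psi>_def radius_def norm_eq_sqrt_inner)
  qed
  have "(\<lambda>n. \<bar>\<psi> (inverse (real (Suc n))) x - \<psi> (inverse (real (Suc n))) y\<bar>) \<longlonglongrightarrow> \<bar>radius x - radius y\<bar>"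
    by (intro tendsto_intros lim)
  then show ?thesis
    by (rule LIMSEQ_le_const2) (auto intro!: exI[of _ 0] bound)
qed

text \<open>
  The metric in polar coordinates \<open>sinh r \<cdot> u\<close>, for a velocity with radial speed \<open>b\<close> and angular
  velocity \<open>v\<close>.
\<close>

lemma quot_form_polar:
  fixes u v :: "'a::euclidean_space"
  assumes "norm u = 1" "u \<bullet> v = 0"
  shows "quot_form (sinh a *\<^sub>R u) ((cosh a * b) *\<^sub>R u + sinh a *\<^sub>R v)
    = b\<^sup>2 + (v \<bullet> v) * ((sinh a)\<^sup>2 / (1 + 2 * (sinh a)\<^sup>2))"
proof -
  define s where "s = (sinh a)\<^sup>2"
  have c: "(cosh a)\<^sup>2 = 1 + s" by (simp add: cosh_square_eq s_def)
  have s: "1 + s \<noteq> 0" "1 + 2 * s \<noteq> 0" using zero_le_power2[of "sinh a"] unfolding s_def by linarith+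
  have uu: "u \<bullet> u = 1" using assms(1) by (simp add: dot_square_norm)
  have 1: "(sinh a *\<^sub>R u) \<bullet> (sinh a *\<^sub>R u) = s" by (simp add: uu s_def power2_eq_square)
  have 2: "((cosh a * b) *\<^sub>R u + sinh a *\<^sub>R v) \<bullet> ((cosh a * b) *\<^sub>R u + sinh a *\<^sub>R v) = (1 + s) * b\<^sup>2 + s * (v \<bullet> v)"
  proof -
    have "((cosh a * b) *\<^sub>R u + sinh a *\<^sub>R v) \<bullet> ((cosh a * b) *\<^sub>R u + sinh a *\<^sub>R v)
        = (cosh a * b)\<^sup>2 + (sinh a)\<^sup>2 * (v \<bullet> v)"
      by (simp add: inner_add_left inner_add_right uu assms(2) inner_commute[of v u] power2_eq_square)
    then show ?thesis by (simp only: power_mult_distrib c s_def)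
  qed
  have 3: "((sinh a *\<^sub>R u) \<bullet> ((cosh a * b) *\<^sub>R u + sinh a *\<^sub>R v))\<^sup>2 = s * (1 + s) * b\<^sup>2"
  proof -
    have "(sinh a *\<^sub>R u) \<bullet> ((cosh a * b) *\<^sub>R u + sinh a *\<^sub>R v) = sinh a * cosh a * b"
      by (simp add: inner_add_right uu assms(2))
    then show ?thesis by (simp only: power_mult_distrib c) (simp only: s_def)
  qed
  have "quot_form (sinh a *\<^sub>R u) ((cosh a * b) *\<^sub>R u + sinh a *\<^sub>R v)
      = ((1 + s) * b\<^sup>2 + s * (v \<bullet> v) + s * b\<^sup>2) / (1 + 2 * s)"
    unfolding quot_form_def 1 2 3 using s by simp
  also have "\<dots> = ((1 + 2 * s) * b\<^sup>2 + (v \<bullet> v) * s) / (1 + 2 * s)"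
    by (simp add: algebra_simps)
  also have "\<dots> = b\<^sup>2 + (v \<bullet> v) * (s / (1 + 2 * s))" using s(2) by (simp add: add_divide_distrib)
  finally show ?thesis unfolding s_def .
qed

text \<open>
  The path whose radius and angle both change at constant speed. The angular part adds at most
  \<open>\<theta>\<^sup>2 / 2\<close> to the squared speed since the coefficient \<open>sinh\<^sup>2 r / (1 + 2 sinh\<^sup>2 r)\<close> stays below \<open>1 / 2\<close>.
\<close>

lemma joined_within_polar:
  fixes u w :: "'a::euclidean_space"
  assumes "norm u = 1" "norm w = 1" "u \<bullet> w = 0"
  shows "joined_within (sinh a *\<^sub>R u) (sinh b *\<^sub>R (cos \<theta> *\<^sub>R u + sin \<theta> *\<^sub>R w)) (sqrt ((b - a)\<^sup>2 + \<theta>\<^sup>2 / 2))"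
proof -
  define r where "r t = a + t * (b - a)" for t
  define e where "e t = cos (t * \<theta>) *\<^sub>R u + sin (t * \<theta>) *\<^sub>R w" for t
  define e' where "e' t = \<theta> *\<^sub>R (cos (t * \<theta>) *\<^sub>R w - sin (t * \<theta>) *\<^sub>R u)" for t
  have uw: "u \<bullet> u = 1" "w \<bullet> w = 1" "w \<bullet> u = 0" "u \<bullet> w = 0"
    using assms by (simp_all add: dot_square_norm inner_commute)
  have de: "(e has_vector_derivative e' t) (at t)" for t
    unfolding e_def e'_def by (auto intro!: derivative_eq_intros simp: algebra_simps)
  have ee: "e t \<bullet> e t = 1" for t
    using sin_cos_squared_add[of "t * \<theta>"]
    by (simp add: e_def inner_add_left inner_add_right uw power2_eq_square add.commute)
  have ee': "e t \<bullet> e' t = 0" for t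
    by (simp add: e_def e'_def inner_add_left inner_diff_right uw)
  have e'e': "e' t \<bullet> e' t = \<theta>\<^sup>2" for t
  proof -
    have "(\<theta> *\<^sub>R (c *\<^sub>R w - s *\<^sub>R u)) \<bullet> (\<theta> *\<^sub>R (c *\<^sub>R w - s *\<^sub>R u)) = \<theta>\<^sup>2 * (s\<^sup>2 + c\<^sup>2)" for c s
      by (simp add: inner_diff_left inner_diff_right uw power2_eq_square algebra_simps)
    then show ?thesis unfolding e'_def by simp
  qed
  have "((\<lambda>t. sinh (r t)) has_real_derivative cosh (r t) * (b - a)) (at t)" for t
    unfolding r_def by (auto intro!: derivative_eq_intros)
  then have "((\<lambda>t. sinh (r t) *\<^sub>R e t) has_vector_derivative sinh (r t) *\<^sub>R e' t + (cosh (r t) * (b - a)) *\<^sub>R e t) (at t)" for t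
    by (rule has_vector_derivative_scaleR[OF _ de])
  moreover have "quot_form (sinh (r t) *\<^sub>R e t) (sinh (r t) *\<^sub>R e' t + (cosh (r t) * (b - a)) *\<^sub>R e t)
      \<le> (sqrt ((b - a)\<^sup>2 + \<theta>\<^sup>2 / 2))\<^sup>2" for t
  proof -
    have "(sinh (r t))\<^sup>2 / (1 + 2 * (sinh (r t))\<^sup>2) \<le> 1 / 2"
      using zero_le_power2[of "sinh (r t)"] by (simp add: field_simps add_pos_nonneg)
    from mult_left_mono[OF this, of "\<theta>\<^sup>2"] show ?thesis
      using quot_form_polar[of "e t" "e' t" "r t" "b - a"] ee ee' e'e' by (simp add: add.commute norm_eq_1)
  qed
  moreover have "sinh (r 0) *\<^sub>R e 0 = sinh a *\<^sub>R u" "sinh (r 1) *\<^sub>R e 1 = sinh b *\<^sub>R (cos \<theta> *\<^sub>R u + sin \<theta> *\<^sub>R w)"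
    by (simp_all add: r_def e_def)
  ultimately show ?thesis
    unfolding joined_within_def
    by (intro exI[of _ "\<lambda>t. sinh (r t) *\<^sub>R e t"]
        exI[of _ "\<lambda>t. sinh (r t) *\<^sub>R e' t + (cosh (r t) * (b - a)) *\<^sub>R e t"]) blast
qed

lemma exists_orthogonal_unit:
  fixes u :: "'a::euclidean_space"
  assumes "DIM('a) \<ge> 2"
  obtains w :: 'a where "norm w = 1" "u \<bullet> w = 0"
proof -
  obtain x where "x \<noteq> 0" "orthogonal x u"
    using orthogonal_to_vector_exists[OF assms] orthogonal_commute by metis
  then show thesis
    using that[of "(1 / norm x) *\<^sub>R x"] by (simp add: orthogonal_def inner_commute)
qed

lemma joined_within_radial:
  fixes u :: "'a::euclidean_space"
  assumes "DIM('a) \<ge> 2" "norm u = 1"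
  shows "joined_within (sinh a *\<^sub>R u) (sinh b *\<^sub>R u) \<bar>b - a\<bar>"
proof -
  obtain w where "norm w = 1" "u \<bullet> w = 0" using exists_orthogonal_unit[OF assms(1)] .
  from joined_within_polar[OF assms(2) this, of a b 0] show ?thesis by simp
qed

lemma joined_within_turning:
  fixes x y :: "'a::euclidean_space"
  assumes "DIM('a) \<ge> 2"
  shows "joined_within x y (sqrt ((radius y - radius x)\<^sup>2 + pi\<^sup>2 / 2))"
proof -
  obtain u v where u: "norm u = 1" "x = sinh (radius x) *\<^sub>R u" and v: "norm v = 1" "y = sinh (radius y) *\<^sub>R v"
    using direction by metis
  obtain w0 where w0: "norm w0 = 1" "u \<bullet> w0 = 0" using exists_orthogonal_unit[OF assms(1)] .
  obtain \<theta> w where w: "0 \<le> \<theta>" "\<theta> \<le> pi" "norm w = 1" "u \<bullet> w = 0" "v = cos \<theta> *\<^sub>R u + sin \<theta> *\<^sub>R w"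
    using unit_vector_in_plane[OF u(1) v(1) w0] by metis
  have "joined_within x y (sqrt ((radius y - radius x)\<^sup>2 + \<theta>\<^sup>2 / 2))"
    using joined_within_polar[OF u(1) w(3,4), of "radius x" "radius y" \<theta>] u(2) v(2) w(5) by simp
  moreover have "(sqrt ((radius y - radius x)\<^sup>2 + \<theta>\<^sup>2 / 2))\<^sup>2 \<le> (sqrt ((radius y - radius x)\<^sup>2 + pi\<^sup>2 / 2))\<^sup>2"
    using w by (simp add: power_mono)
  ultimately show ?thesis by (rule joined_within_mono)
qed

text \<open>
  A ray from the origin realises distances forever. No other point has a ray through the origin with
  this property: by \<open>joined_within_turning\<close>, spiralling is shorter than going through the origin and on
  to a far point.
\<close>

lemma quot_isometry_fixes_0:
  fixes f f' :: "'a::euclidean_space \<Rightarrow> 'a"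
  assumes dim: "DIM('a) \<ge> 2" and f: "quot_isometry f" "quot_isometry f'"
    and inv: "\<And>y. f (f' y) = y" "\<And>y. f' (f y) = y"
  shows "f 0 = 0"
proof (rule ccontr)
  assume "f 0 \<noteq> 0"
  define p z \<rho> where "p = f 0" "z = f' 0" "\<rho> = radius p"
  note defs = p_z_\<rho>_def
  have pos: "\<rho> > 0" using \<open>f 0 \<noteq> 0\<close> radius_nonneg[of p] radius_eq_0_iff[of p] by (simp add: defs)
  have fz: "f z = 0" "f' p = 0" by (simp_all add: defs inv)
  have from0: "joined_within 0 x (radius x)" for x :: 'a
  proof -
    obtain u where "norm u = 1" "x = sinh (radius x) *\<^sub>R u" using direction .
    then show ?thesis using joined_within_radial[OF dim, of u 0 "radius x"] radius_nonneg[of x] by simp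
  qed
  have "\<rho> \<le> radius z"
    using joined_within_radius[OF joined_within_image[OF f(1) from0[of z]] radius_nonneg]
    by (simp add: fz) (simp add: defs)
  moreover have "radius z \<le> \<rho>"
    using joined_within_radius[OF joined_within_image[OF f(2) from0[of p]] radius_nonneg]
    by (simp add: fz) (simp add: defs)
  ultimately have \<rho>: "radius z = \<rho>" by simp
  obtain u where u: "norm u = 1" "z = sinh \<rho> *\<^sub>R u" using direction[of z] \<rho> by metis
  \<comment> \<open>Large enough to make \<open>4 \<rho> (R - \<rho>)\<close> exceed \<open>\<pi>\<^sup>2 / 2\<close>, which contradicts the inequality reached at the end.\<close>
  define R where "R = 3 * \<rho> + pi\<^sup>2 / \<rho>"
  have R: "R \<ge> 3 * \<rho>" using pos by (simp add: R_def)
  define y where "y = sinh R *\<^sub>R u"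
  have ry: "radius y = R" using R pos u by (simp add: y_def radius_sinh)
  have "joined_within z y \<bar>R - \<rho>\<bar>"
    unfolding y_def u(2) by (rule joined_within_radial[OF dim u(1)])
  from joined_within_radius[OF joined_within_image[OF f(1) this]]
  have b: "radius (f y) \<le> R - \<rho>" using R pos radius_nonneg[of "f y"] by (simp add: fz)
  let ?L = "sqrt ((radius (f y) - radius p)\<^sup>2 + pi\<^sup>2 / 2)"
  have "joined_within (f' p) (f' (f y)) ?L"
    by (rule joined_within_image[OF f(2) joined_within_turning[OF dim]])
  then have "\<bar>radius (f' p) - radius (f' (f y))\<bar> \<le> ?L"
    by (rule joined_within_radius) simp
  then have "R \<le> ?L" using R pos by (simp add: fz inv ry)
  then have "R\<^sup>2 \<le> ?L\<^sup>2" using R pos by (intro power_mono) auto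
  then have 1: "R\<^sup>2 \<le> (radius (f y) - \<rho>)\<^sup>2 + pi\<^sup>2 / 2" by (simp add: defs)
  have "\<bar>radius (f y) - \<rho>\<bar> \<le> R - 2 * \<rho>" using b R pos radius_nonneg[of "f y"] by linarith
  then have "(radius (f y) - \<rho>)\<^sup>2 \<le> (R - 2 * \<rho>)\<^sup>2"
    using R pos by (simp add: abs_le_square_iff[symmetric])
  with 1 have "4 * \<rho> * (R - \<rho>) \<le> pi\<^sup>2 / 2" by (simp add: power2_eq_square algebra_simps)
  moreover have "4 * \<rho> * (R - \<rho>) = 8 * \<rho>\<^sup>2 + 4 * pi\<^sup>2"
    using pos by (simp add: R_def power2_eq_square algebra_simps)
  moreover have "pi\<^sup>2 > 0" "\<rho>\<^sup>2 > 0" using pos by simp_all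
  ultimately show False by linarith
qed

lemma quot_isometry_norm_le:
  fixes f :: "'a::euclidean_space \<Rightarrow> 'a"
  assumes dim: "DIM('a) \<ge> 2" and f: "quot_isometry f" "f 0 = 0"
  shows "norm (f y) \<le> norm y"
proof -
  obtain u where "norm u = 1" "y = sinh (radius y) *\<^sub>R u" using direction .
  then have "joined_within 0 y (radius y)"
    using joined_within_radial[OF dim, of u 0 "radius y"] radius_nonneg[of y] by simp
  from joined_within_radius[OF joined_within_image[OF f(1) this] radius_nonneg]
  have "radius (f y) \<le> radius y" using radius_nonneg[of "f y"] by (simp add: f(2))
  then have "sinh (radius (f y)) \<le> sinh (radius y)" by simp
  then show ?thesis by (simp add: sinh_radius)
qed

text \<open>
  The image of a ray has the same norm as the ray at each time, hence the same radial speed. Since the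
  length of the velocity is preserved too, nothing is left for the angular velocity \<open>e'\<close>, and the
  direction \<open>e\<close> of the image is constant.
\<close>

lemma quot_isometry_linear_on_rays:
  fixes f :: "'a::euclidean_space \<Rightarrow> 'a"
  assumes f: "quot_isometry f" and norm: "\<And>y. norm (f y) = norm y" and u: "norm u = 1"
  obtains e where "\<And>s. s > 0 \<Longrightarrow> f (s *\<^sub>R u) = s *\<^sub>R e"
proof -
  obtain D where D: "\<And>y. (f has_derivative D y) (at y)" "\<And>y w. quot_form (f y) (D y w) = quot_form y w"
    using f unfolding quot_isometry_def by metis
  define e where "e s = (1 / s) *\<^sub>R f (s *\<^sub>R u)" for s
  have ee: "e s \<bullet> e s = 1" if "s > 0" for s
    using norm[of "s *\<^sub>R u"] u that by (simp add: e_def dot_square_norm norm_eq_1[symmetric])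
  have e_const: "(e has_vector_derivative 0) (at s)" if s: "s > 0" for s
  proof -
    have "((\<lambda>s. s *\<^sub>R u) has_vector_derivative u) (at s)"
      by (auto intro!: derivative_eq_intros)
    then have df: "((\<lambda>s. f (s *\<^sub>R u)) has_vector_derivative D (s *\<^sub>R u) u) (at s)"
      using vector_derivative_diff_chain_within[of "\<lambda>s. s *\<^sub>R u" u s UNIV f "D (s *\<^sub>R u)"] D(1)
      by (simp add: o_def has_derivative_at_withinI)
    define e' where "e' = (1 / s) *\<^sub>R D (s *\<^sub>R u) u + (- (1 / s\<^sup>2)) *\<^sub>R f (s *\<^sub>R u)"
    have "((\<lambda>s. 1 / s) has_real_derivative - (1 / s\<^sup>2)) (at s)"
      using s by (auto intro!: derivative_eq_intros simp: power2_eq_square)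
    then have de: "(e has_vector_derivative e') (at s)"
      unfolding e_def e'_def by (rule has_vector_derivative_scaleR[OF _ df])
    have "((\<lambda>t. e t \<bullet> e t) has_vector_derivative (e s \<bullet> e' + e' \<bullet> e s)) (at s)"
      by (rule bounded_bilinear.has_vector_derivative[OF bounded_bilinear_inner de de])
    moreover have "((\<lambda>t. e t \<bullet> e t) has_vector_derivative 0) (at s)"
      by (rule has_vector_derivative_transform_within_open[of "\<lambda>t. 1" _ _ "{0<..}"]) (use s ee in auto)
    ultimately have "e s \<bullet> e' + e' \<bullet> e s = 0" by (rule vector_derivative_unique_at)
    then have orth: "e s \<bullet> e' = 0" by (simp add: inner_commute)
    have fe: "f (s *\<^sub>R u) = s *\<^sub>R e s" using s by (simp add: e_def)
    have De: "D (s *\<^sub>R u) u = e s + s *\<^sub>R e'"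
      using s by (simp add: e'_def e_def scaleR_right_diff_distrib power2_eq_square)
    have uu: "u \<bullet> u = 1" using u by (simp add: dot_square_norm)
    have 1: "quot_form (s *\<^sub>R e s) (e s + s *\<^sub>R e') = quot_form (s *\<^sub>R u) u"
      using D(2)[of "s *\<^sub>R u" u] by (simp only: fe De)
    have 2: "(s *\<^sub>R e s) \<bullet> (s *\<^sub>R e s) = s * s" "(s *\<^sub>R u) \<bullet> (s *\<^sub>R u) = s * s"
        "(s *\<^sub>R e s) \<bullet> (e s + s *\<^sub>R e') = s" "(s *\<^sub>R u) \<bullet> u = s"
      using ee[OF s] orth uu by (simp_all add: inner_add_right)
    have 3: "(e s + s *\<^sub>R e') \<bullet> (e s + s *\<^sub>R e') = 1 + s * s * (e' \<bullet> e')"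
      using ee[OF s] orth by (simp add: inner_add_left inner_add_right inner_commute[of e' "e s"])
    have "1 + 2 * (s * s) \<noteq> 0" using zero_le_square[of s] by linarith
    moreover have "1 + 2 * (s * s) = 0 \<or> 1 + s * s * (e' \<bullet> e') + s\<^sup>2 / (1 + s * s) = 1 + s\<^sup>2 / (1 + s * s)"
      using 1[unfolded quot_form_def 2 3 uu] by (rule divide_cancel_right[THEN iffD1])
    ultimately have "s * s * (e' \<bullet> e') = 0" by linarith
    then have "e' = 0" using s by simp
    then show ?thesis using de by simp
  qed
  have "(e has_vector_derivative 0) (at s within {0<..})" if "s \<in> {0<..}" for s
    by (rule has_vector_derivative_at_within, rule e_const) (use that in simp)
  then obtain c where c: "\<And>s. s \<in> {0<..} \<Longrightarrow> e s = c"
    using has_vector_derivative_zero_constant[OF convex_real_interval(3), of 0 e] by blast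
  have "f (s *\<^sub>R u) = s *\<^sub>R c" if "s > 0" for s
    using c[of s] that by (auto simp: e_def)
  then show thesis by (rule that)
qed

text \<open>
  On each ray from the origin the map is linear, so it agrees there with its one-sided directional
  derivative, and hence with its differential at the origin.
\<close>

lemma quot_isometry_orthogonal:
  fixes f f' :: "'a::euclidean_space \<Rightarrow> 'a"
  assumes dim: "DIM('a) \<ge> 2" and f: "quot_isometry f" "quot_isometry f'"
    and inv: "\<And>y. f (f' y) = y" "\<And>y. f' (f y) = y"
  shows "orthogonal_transformation f"
proof -
  have 0: "f 0 = 0" "f' 0 = 0"
    using quot_isometry_fixes_0[OF dim f inv] quot_isometry_fixes_0[OF dim f(2,1) inv(2,1)] by auto
  have norm: "norm (f y) = norm y" for y
    using quot_isometry_norm_le[OF dim f(1) 0(1), of y] quot_isometry_norm_le[OF dim f(2) 0(2), of "f y"]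
    by (simp add: inv)
  obtain D where D: "(f has_derivative D) (at 0)"
    using f unfolding quot_isometry_def by metis
  have "f y = D y" for y
  proof (cases "y = 0")
    case True
    then show ?thesis using D has_derivative_linear linear_0 0 by metis
  next
    case False
    define u where "u = (1 / norm y) *\<^sub>R y"
    have u: "norm u = 1" "y = norm y *\<^sub>R u" using False by (simp_all add: u_def)
    obtain e where e: "\<And>s. s > 0 \<Longrightarrow> f (s *\<^sub>R u) = s *\<^sub>R e"
      using quot_isometry_linear_on_rays[OF f(1) norm u(1)] by metis
    have "((\<lambda>s. s *\<^sub>R u) has_vector_derivative u) (at 0)"
      by (auto intro!: derivative_eq_intros)
    then have "((\<lambda>s. f (s *\<^sub>R u)) has_vector_derivative D u) (at 0)"
      using vector_derivative_diff_chain_within[of "\<lambda>s. s *\<^sub>R u" u 0 UNIV f D] D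
      by (simp add: o_def has_derivative_at_withinI)
    then have "((\<lambda>s. f (s *\<^sub>R u)) has_vector_derivative D u) (at 0 within {0..})"
      by (rule has_vector_derivative_at_within)
    moreover have "((\<lambda>s. f (s *\<^sub>R u)) has_vector_derivative e) (at 0 within {0..})"
    proof (rule has_vector_derivative_transform[of 0 "{0..}" _ "\<lambda>s. s *\<^sub>R e"])
      show "f (s *\<^sub>R u) = s *\<^sub>R e" if "s \<in> {0..}" for s
        using that e[of s] 0 by (cases "s = 0") auto
    qed (auto intro!: derivative_eq_intros)
    moreover have "at 0 within {0..} \<noteq> (bot :: real filter)"
      unfolding at_within_Ici_at_right by (rule trivial_limit_at_right_real)
    ultimately have "D u = e" using vector_derivative_unique_within by blast
    moreover have "f y = norm y *\<^sub>R e" using e[of "norm y"] False u(2) by simp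
    moreover have "D y = norm y *\<^sub>R D u"
      using u(2) linear_scale[OF has_derivative_linear[OF D]] by metis
    ultimately show ?thesis by simp
  qed
  then have "f = D" by auto
  then show ?thesis
    unfolding orthogonal_transformation using norm has_derivative_linear[OF D] by auto
qed

section \<open>Isometries of the quotient\<close>

lemma vector_mult_inner:
  fixes k :: "real^'n^'n::finite"
  assumes "orthogonal_matrix k" shows "(y v* k) \<bullet> (z v* k) = y \<bullet> z"
proof -
  have "orthogonal_transformation (\<lambda>x. transpose k *v x)"
    using assms by (simp add: orthogonal_transformation_matrix orthogonal_matrix_transpose del: transpose_matrix_vector)
  then show ?thesis by (simp add: orthogonal_transformation_def)
qed

lemma vector_mult_SO_inverse:
  assumes "k \<in> SO" shows "(w v* k) v* transpose k = w" "(w v* transpose k) v* k = w"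
  using SO_inverse[OF assms] by (simp_all add: vector_matrix_mul_assoc del: vector_transpose_matrix)

lemma bounded_bibounded_linear_vector_mult: "bounded_bilinear ((v*) :: real^'n \<Rightarrow> real^'m^'n \<Rightarrow> real^'m::finite)"
  unfolding bilinear_conv_bounded_bilinear[symmetric] bilinear_def
  by (auto intro!: linearI simp: vector_matrix_mult_def vec_eq_iff algebra_simps sum.distrib sum_distrib_left)

lemma bounded_linear_vector_mult: "bounded_linear (\<lambda>y. y v* (k :: real^'m^'n::finite))"
  by (rule bounded_bilinear.bounded_linear_left[OF bounded_bibounded_linear_vector_mult])

lemma sharp_inner: "sharp y w \<bullet> w = quot_form y w"
  by (simp add: sharp_def quot_form_def inner_add_left power2_eq_square)

lemma sharp_orthogonal:
  assumes "orthogonal_matrix k" shows "sharp (y v* k) (v v* k) \<bullet> (w v* k) = sharp y v \<bullet> w"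
  by (simp add: sharp_def inner_add_left vector_mult_inner[OF assms])

definition in_coords :: "('n::finite mat1 set \<Rightarrow> 'n mat1 set) \<Rightarrow> real^'n \<Rightarrow> real^'n" where
  "in_coords F y = coords (F (from_coords y))"

lemma from_coords_in_coords: "F ` Q \<subseteq> Q \<Longrightarrow> F (from_coords y) = from_coords (in_coords F y)"
  unfolding in_coords_def by (rule from_coords_coords[symmetric]) (use from_coords_Q in blast)

lemma Q_smooth_mapD:
  assumes "Q_smooth_map F"
  shows "F (from_coords y) = from_coords (in_coords F y)" "\<phi> \<in> Q_functions \<Longrightarrow> \<phi> \<circ> F \<in> Q_functions"
  using assms from_coords_in_coords unfolding Q_smooth_map_def by blast+

text \<open>
  A smooth map of the quotient is defined by what it does to smooth functions; the coordinates are
  among them.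
\<close>

lemma in_coords_differentiable:
  fixes F :: "'n::finite mat1 set \<Rightarrow> 'n mat1 set"
  assumes "Q_smooth_map F" shows "in_coords F differentiable (at y)"
proof -
  have "(\<lambda>z. in_coords F z $ i) differentiable (at y)" for i
    using Q_function_differentiable[OF Q_smooth_mapD(2)[OF assms coords_Q_functions], of i y]
    by (simp add: in_coords_def)
  then show ?thesis
    by (subst differentiable_componentwise_within) (auto simp: Basis_vec_def inner_axis)
qed

lemma Q_differential_directional:
  assumes F: "Q_smooth_map F" and D: "(in_coords F has_derivative D) (at y)"
  shows "Q_differential F (directional y w) = directional (in_coords F y) (D w)"
proof
  fix \<phi>
  show "Q_differential F (directional y w) \<phi> = directional (in_coords F y) (D w) \<phi>"
  proof (cases "\<phi> \<in> Q_functions")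
    case True
    have "((\<lambda>z. \<phi> (from_coords (in_coords F z))) has_derivative (\<lambda>v. directional (in_coords F y) (D v) \<phi>)) (at y)"
      by (rule has_derivative_compose[OF D Q_function_has_derivative[OF True]])
    then have "((\<lambda>z. (\<phi> \<circ> F) (from_coords z)) has_derivative (\<lambda>v. directional (in_coords F y) (D v) \<phi>)) (at y)"
      by (simp add: Q_smooth_mapD(1)[OF F])
    from directional_eqI[OF Q_smooth_mapD(2)[OF F True] this]
    show ?thesis by (simp only: Q_differential_def True if_True)
  qed (simp add: Q_differential_def directional_def)
qed

lemma quot_isometry_inverse:
  assumes f: "quot_isometry f" and g: "\<And>y. g differentiable (at y)" and fg: "\<And>y. f (g y) = y"
  shows "quot_isometry g"
  unfolding quot_isometry_def
proof
  fix y
  obtain D' where D': "(g has_derivative D') (at y)" using g by (auto simp: differentiable_def)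
  obtain D where D: "(f has_derivative D) (at (g y))" "\<And>w. quot_form (f (g y)) (D w) = quot_form (g y) w"
    using f unfolding quot_isometry_def by metis
  have "((\<lambda>z. f (g z)) has_derivative (\<lambda>w. D (D' w))) (at y)"
    by (rule has_derivative_compose[OF D' D(1)])
  then have "((\<lambda>z. z) has_derivative (\<lambda>w. D (D' w))) (at y)" by (simp only: fg)
  then have "D (D' w) = w" for w
    using has_derivative_unique[OF has_derivative_ident] by (metis)
  then show "\<exists>D. (g has_derivative D) (at y) \<and> (\<forall>w. quot_form (g y) (D w) = quot_form y w)"
    using D' D(2) fg by metis
qed

text \<open>
  On directional derivatives, invariance of the quotient metric is invariance of \<open>quot_form\<close>, and an
  isometry of \<open>quot_form\<close> is orthogonal.
\<close>

lemma Isom_in_coords: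
  fixes F :: "'n::{finite,linorder} mat1 set \<Rightarrow> 'n mat1 set"
  assumes card: "CARD('n) \<ge> 2" and F: "F \<in> Isom"
  shows "orthogonal_transformation (in_coords F)"
proof -
  have bij: "bij_betw F Q Q" and sm: "Q_smooth_map F" "Q_smooth_map (inv_into Q F)"
    and iso: "\<And>p X Y. p \<in> Q \<Longrightarrow> X \<in> Q_tangent p \<Longrightarrow> Y \<in> Q_tangent p \<Longrightarrow>
        Q_metric (F p) (Q_differential F X) (Q_differential F Y) = Q_metric p X Y"
    using F unfolding Isom_def by blast+
  let ?f = "in_coords F" and ?g = "in_coords (inv_into Q F)"
  have inv: "?f (?g y) = y" "?g (?f y) = y" for y
  proof -
    have "from_coords (?f (?g y)) = F (inv_into Q F (from_coords y))"
      by (simp only: Q_smooth_mapD(1)[OF sm(1)] Q_smooth_mapD(1)[OF sm(2)])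
    also have "\<dots> = from_coords y" using bij by (intro bij_betw_inv_into_right) auto
    finally show "?f (?g y) = y" by (metis coords_from_coords)
    have "from_coords (?g (?f y)) = inv_into Q F (F (from_coords y))"
      by (simp only: Q_smooth_mapD(1)[OF sm(1)] Q_smooth_mapD(1)[OF sm(2)])
    also have "\<dots> = from_coords y" using bij by (intro bij_betw_inv_into_left) auto
    finally show "?g (?f y) = y" by (metis coords_from_coords)
  qed
  have f: "quot_isometry ?f"
    unfolding quot_isometry_def
  proof
    fix y
    obtain D where D: "(?f has_derivative D) (at y)"
      using in_coords_differentiable[OF sm(1)] by (auto simp: differentiable_def)
    have "quot_form (?f y) (D w) = quot_form y w" for w
      using iso[OF from_coords_Q directional_Q_tangent directional_Q_tangent, of y w w]
      unfolding Q_differential_directional[OF sm(1) D] Q_smooth_mapD(1)[OF sm(1)] Q_metric_directional sharp_inner .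
    with D show "\<exists>D. (?f has_derivative D) (at y) \<and> (\<forall>w. quot_form (?f y) (D w) = quot_form y w)" by blast
  qed
  moreover have "quot_isometry ?g"
    by (rule quot_isometry_inverse[OF f in_coords_differentiable[OF sm(2)] inv(1)])
  ultimately show ?thesis
    using quot_isometry_orthogonal[of ?f ?g] inv card by (simp add: DIM_cart)
qed

lemma in_coords_right_action: "k \<in> SO \<Longrightarrow> in_coords (right_action k) = (\<lambda>y. y v* k)"
  by (simp add: in_coords_def right_action_from_coords fun_eq_iff)

lemma right_action_smooth:
  assumes k: "k \<in> SO" shows "Q_smooth_map (right_action k)"
  unfolding Q_smooth_map_def
proof (intro conjI ballI)
  show "right_action k ` Q \<subseteq> Q" by (auto simp: Q_eq right_action_from_coords[OF k])
  fix \<phi> :: "'a mat1 set \<Rightarrow> real" assume \<phi>: "\<phi> \<in> Q_functions"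
  let ?b = "block_diag k"
  have lin: "bounded_linear (\<lambda>x. x ** ?b)"
    by (rule bounded_bilinear.bounded_linear_left[OF bounded_bilinear_matrix_mult])
  have "\<exists>U h. open U \<and> g \<in> U \<and> smooth_on U h \<and> (\<forall>x\<in>G \<inter> U. (\<phi> \<circ> right_action k) (coset x) = h x)"
    if g: "g \<in> G" for g
  proof -
    obtain U h where U: "open U" "g ** ?b \<in> U" "smooth_on U h" "\<And>x. x \<in> G \<Longrightarrow> x \<in> U \<Longrightarrow> \<phi> (coset x) = h x"
      using Q_functions_local[OF \<phi> G_mult[OF g block_diag_G[OF k]]] by metis
    have "open ((\<lambda>x. x ** ?b) -` U)"
      using U(1) lin by (intro open_vimage) (auto intro: linear_continuous_on)
    moreover have "smooth_on ((\<lambda>x. x ** ?b) -` U) (\<lambda>x. h (x ** ?b))"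
      by (rule smooth_on_compose_linear[OF lin U(1,3)])
    moreover have "(\<phi> \<circ> right_action k) (coset x) = h (x ** ?b)" if "x \<in> G" "x ** ?b \<in> U" for x
      using U(4)[OF G_mult[OF that(1) block_diag_G[OF k]] that(2)] that by (simp add: right_action_coset)
    ultimately show ?thesis using U(2)
      by (intro exI[of _ "(\<lambda>x. x ** ?b) -` U"] exI[of _ "\<lambda>x. h (x ** ?b)"]) auto
  qed
  then show "\<phi> \<circ> right_action k \<in> Q_functions"
    unfolding Q_functions_def smooth_functions_def by blast
qed

lemma right_action_inverse:
  assumes "k \<in> SO" "p \<in> Q" shows "right_action (transpose k) (right_action k p) = p"
proof -
  obtain y where "p = from_coords y" using assms(2) by (auto simp: Q_eq)
  then show ?thesis
    using assms(1) by (simp add: right_action_from_coords SO_transpose vector_matrix_mul_assoc SO_inverse del: vector_transpose_matrix)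
qed

lemma Q_smooth_map_cong:
  assumes "Q_smooth_map F" "\<And>p. p \<in> Q \<Longrightarrow> F p = F' p" shows "Q_smooth_map F'"
  unfolding Q_smooth_map_def
proof (intro conjI ballI)
  show "F' ` Q \<subseteq> Q" using assms unfolding Q_smooth_map_def by force
  show "\<phi> \<circ> F' \<in> Q_functions" if "\<phi> \<in> Q_functions" for \<phi>
    by (rule Q_functions_cong[OF Q_smooth_mapD(2)[OF assms(1) that]]) (simp add: assms(2))
qed

lemma right_action_bij:
  assumes "k \<in> SO" shows "bij_betw (right_action k) Q Q"
proof (rule bij_betw_byWitness[where f'="right_action (transpose k)"])
  show "\<forall>p\<in>Q. right_action k (right_action (transpose k) p) = p"
    using right_action_inverse[OF SO_transpose[OF assms]] by simp
  show "right_action k ` Q \<subseteq> Q" "right_action (transpose k) ` Q \<subseteq> Q"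
    using right_action_smooth[OF assms] right_action_smooth[OF SO_transpose[OF assms]]
    unfolding Q_smooth_map_def by blast+
qed (use right_action_inverse[OF assms] in blast)

text \<open>
  The differential of \<open>r(k)\<close> permutes the directional derivatives and maps no other derivation to one of
  them, because the differential of \<open>r(k\<^sup>-\<^sup>1)\<close> undoes it.
\<close>

lemma right_action_differential_iff:
  assumes k: "k \<in> SO" and X: "X \<in> Q_tangent (from_coords y)"
  shows "Q_differential (right_action k) X = directional (y v* k) v \<longleftrightarrow> X = directional y (v v* transpose k)"
proof -
  have dF: "Q_differential (right_action l) (directional z w) = directional (z v* l) (w v* l)" if "l \<in> SO" for l :: "real^'a^'a" and z w
  proof -
    have "((\<lambda>y. y v* l) has_derivative (\<lambda>y. y v* l)) (at z)"
      by (rule bounded_linear_imp_has_derivative[OF bounded_linear_vector_mult])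
    then show ?thesis
      using Q_differential_directional[OF right_action_smooth[OF that], of "\<lambda>y. y v* l" z w] in_coords_right_action[OF that] by simp
  qed
  note kk = vector_mult_SO_inverse[OF k]
  show ?thesis
  proof
    assume "X = directional y (v v* transpose k)"
    then show "Q_differential (right_action k) X = directional (y v* k) v"
      by (simp add: dF[OF k] kk del: vector_transpose_matrix)
  next
    assume l: "Q_differential (right_action k) X = directional (y v* k) v"
    have "X \<phi> = Q_differential (right_action (transpose k)) (Q_differential (right_action k) X) \<phi>" for \<phi>
    proof (cases "\<phi> \<in> Q_functions")
      case True
      note sm = Q_smooth_mapD(2)[OF right_action_smooth[OF SO_transpose[OF k]] True]
      have "X \<phi> = X ((\<phi> \<circ> right_action (transpose k)) \<circ> right_action k)"
        by (rule Q_tangent_local[OF X from_coords_Q True]) (simp add: right_action_inverse[OF k])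
      then show ?thesis using True sm by (simp add: Q_differential_def)
    next
      case False
      then have "X \<phi> = 0" using X unfolding Q_tangent_def by blast
      then show ?thesis using False by (simp add: Q_differential_def)
    qed
    then have "X = Q_differential (right_action (transpose k)) (directional (y v* k) v)"
      unfolding l by auto
    then show "X = directional y (v v* transpose k)"
      by (simp add: dF[OF SO_transpose[OF k]] kk del: vector_transpose_matrix)
  qed
qed

text \<open>
  For the metric, the elements \<open>X\<close> and \<open>Y\<close> of \<open>Q_tangent\<close> are arbitrary derivations. By
  \<open>right_action_differential_iff\<close>, the conditions that define the two sides of the invariance are
  satisfied by the same numbers, so that the definite descriptions agree.
\<close>

lemma right_action_Isom:
  assumes k: "k \<in> SO" shows "right_action k \<in> (Isom :: ('n::{finite,linorder} mat1 set \<Rightarrow> _) set)"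
  unfolding Isom_def
proof (intro CollectI conjI ballI)
  let ?F = "right_action k :: 'n mat1 set \<Rightarrow> _"
  show "?F \<in> extensional Q" by (simp add: right_action_def)
  show bij: "bij_betw ?F Q Q" by (rule right_action_bij[OF k])
  show "Q_smooth_map ?F" by (rule right_action_smooth[OF k])
  show "Q_smooth_map (inv_into Q ?F)"
  proof (rule Q_smooth_map_cong[OF right_action_smooth[OF SO_transpose[OF k]]])
    fix p assume p: "p \<in> (Q :: 'n mat1 set set)"
    then obtain q where q: "q \<in> Q" "?F q = p" using bij_betw_imp_surj_on[OF bij] by (metis imageE)
    then show "right_action (transpose k) p = inv_into Q ?F p"
      using right_action_inverse[OF k q(1)] bij_betw_inv_into_left[OF bij q(1)] by simp
  qed
  fix p :: "'n mat1 set" and X Y assume p: "p \<in> Q" and X: "X \<in> Q_tangent p" and Y: "Y \<in> Q_tangent p"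
  obtain y where y: "p = from_coords y" using p by (auto simp: Q_eq)
  have o: "orthogonal_matrix k" "orthogonal_matrix (transpose k)"
    using k by (auto simp: SO_def orthogonal_matrix_transpose)
  note kk = vector_mult_SO_inverse[OF k]
  have sh: "sharp y (v v* transpose k) \<bullet> (w v* transpose k) = sharp (y v* k) v \<bullet> w" for v w
    using sharp_orthogonal[OF o(1), of y "v v* transpose k" "w v* transpose k"] by (simp only: kk)
  have "(\<forall>v w. Q_differential ?F X = directional (y v* k) v \<and> Q_differential ?F Y = directional (y v* k) w
            \<longrightarrow> r = sharp (y v* k) v \<bullet> w)
      \<longleftrightarrow> (\<forall>v w. X = directional y v \<and> Y = directional y w \<longrightarrow> r = sharp y v \<bullet> w)" (is "?l \<longleftrightarrow> ?r") for r
  proof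
    assume l: ?l
    show ?r
    proof (intro allI impI)
      fix v w assume "X = directional y v \<and> Y = directional y w"
      then have "r = sharp (y v* k) (v v* k) \<bullet> (w v* k)"
        using l X Y right_action_differential_iff[OF k, of X y "v v* k"]
          right_action_differential_iff[OF k, of Y y "w v* k"] y kk by metis
      then show "r = sharp y v \<bullet> w" by (simp add: sharp_orthogonal[OF o(1)])
    qed
  next
    assume r: ?r
    show ?l
      using r right_action_differential_iff[OF k] X Y unfolding y sh[symmetric] by metis
  qed
  then show "Q_metric (?F p) (Q_differential ?F X) (Q_differential ?F Y) = Q_metric p X Y"
    unfolding y right_action_from_coords[OF k] Q_metric_eq by simp
qed

lemma topspace_Q: "topspace Q_topology = Q"
  using quotient_map_coset unfolding quotient_map_def by (metis Q_def topspace_euclidean_subtopology)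

lemma continuous_map_coords: "continuous_map Q_topology euclidean coords"
proof (rule continuous_compose_quotient_map[OF quotient_map_coset])
  have "continuous_on G last_row" by (rule linear_continuous_on[OF bounded_linear_last_row])
  then show "continuous_map (top_of_set G) euclidean (coords \<circ> coset)"
    by (simp add: o_def coords_coset)
qed

lemma open_from_coords_vimage:
  assumes "openin Q_topology U" shows "open {y. from_coords y \<in> U}"
proof -
  have "openin (top_of_set G) {g \<in> G. coset g \<in> U}" using assms by (simp add: openin_Q_topology)
  then obtain T where T: "open T" "{g \<in> G. coset g \<in> U} = G \<inter> T" by (auto simp: openin_open)
  have eq: "{y. from_coords y \<in> U} = boost -` T"
    using T(2) boost_G unfolding from_coords_def by blast
  show ?thesis unfolding eq by (rule open_vimage[OF T(1) continuous_on_boost])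
qed

lemma topspace_Isom: "topspace Isom_topology = Isom"
proof -
  have "Isom \<in> {{F \<in> Isom. F ` C \<subseteq> U} | C U. compactin Q_topology C \<and> openin Q_topology U}"
    by (intro CollectI exI[of _ "{}"]) auto
  then show ?thesis unfolding Isom_topology_def topology_generated_by_topspace by blast
qed

lemma Isom_topology_subbasis:
  "compactin Q_topology C \<Longrightarrow> openin Q_topology U \<Longrightarrow> openin Isom_topology {F \<in> Isom. F ` C \<subseteq> U}"
  unfolding Isom_topology_def by (rule topology_generated_by_Basis) blast

lemma continuous_map_in_coords: "continuous_map Isom_topology euclidean (\<lambda>F. in_coords F y)"
proof -
  have "continuous_map Isom_topology Q_topology (\<lambda>F. F (from_coords y))"
    unfolding continuous_map_def topspace_Isom topspace_Q
  proof (intro conjI allI impI)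
    show "(\<lambda>F. F (from_coords y)) \<in> Isom \<rightarrow> Q" unfolding Isom_def by (auto dest: bij_betwE)
    fix U :: "'a mat1 set set" assume "openin Q_topology U"
    then show "openin Isom_topology {F \<in> Isom. F (from_coords y) \<in> U}"
      using Isom_topology_subbasis[of "{from_coords y}" U] by (simp add: topspace_Q)
  qed
  from continuous_map_compose[OF this continuous_map_coords] show ?thesis
    by (simp add: o_def in_coords_def)
qed

lemma continuous_map_det_in_coords:
  "continuous_map Isom_topology euclideanreal (\<lambda>F. det (matrix (in_coords F)))"
proof -
  have "continuous_map Isom_topology euclideanreal (\<lambda>F. in_coords F y $ i)" for y :: "(real, 'a) vec" and i
  proof -
    have "continuous_map euclidean euclideanreal (\<lambda>v :: (real, 'a) vec. v $ i)"
      by (auto intro!: continuous_intros)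
    from continuous_map_compose[OF continuous_map_in_coords this] show ?thesis by (simp add: o_def)
  qed
  then show ?thesis
    unfolding det_def matrix_def
    by (auto intro!: continuous_map_sum continuous_map_prod continuous_map_real_mult_left)
qed

text \<open>
  For a compact set \<open>C\<close> and an open set \<open>U\<close>, the rotations that map \<open>C\<close> into \<open>U\<close> form an open set by the
  tube lemma, applied to the open set of all pairs of a rotation and a point that it maps into \<open>U\<close>.
\<close>

lemma continuous_map_right_action:
  "continuous_map (top_of_set SO) (Isom_topology :: ('n::{finite,linorder} mat1 set \<Rightarrow> _) topology) right_action"
  unfolding Isom_topology_def
proof (rule continuous_on_generated_topo)
  let ?S = "{{F \<in> Isom. F ` C \<subseteq> U} | C U. compactin Q_topology C \<and> openin Q_topology U} :: ('n mat1 set \<Rightarrow> 'n mat1 set) set set"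
  have "Isom \<in> ?S" by (intro CollectI exI[of _ "{}"]) auto
  then show "right_action ` topspace (top_of_set SO) \<subseteq> \<Union> ?S" using right_action_Isom by auto
  fix V assume "V \<in> ?S"
  then obtain C U where V: "V = {F \<in> Isom. F ` C \<subseteq> U}" "compactin Q_topology C" "openin Q_topology U" by blast
  have C: "compact (coords ` C)"
    using image_compactin[OF V(2) continuous_map_coords] by simp
  have CQ: "C \<subseteq> Q" using compactin_subset_topspace[OF V(2)] by (simp add: topspace_Q)
  define U' where "U' = {y. from_coords y \<in> U}"
  have U': "open U'" unfolding U'_def by (rule open_from_coords_vimage[OF V(3)])
  define W where "W = (\<lambda>(k :: ((real, 'n) vec, 'n) vec, y). y v* k) -` U'"
  have W: "open W"
  proof -
    have c: "continuous_on UNIV (\<lambda>p :: ((real, 'n) vec, 'n) vec \<times> (real, 'n) vec. snd p v* fst p)"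
      by (intro bounded_bilinear.continuous_on[OF bounded_bibounded_linear_vector_mult] continuous_intros)
    show ?thesis unfolding W_def case_prod_unfold by (rule open_vimage[OF U' c])
  qed
  define N where "N = {k. {k} \<times> coords ` C \<subseteq> W}"
  have "open N"
    unfolding open_subopen[of N]
  proof (intro ballI)
    fix k assume "k \<in> N"
    then obtain X where X: "k \<in> X" "open X" "X \<times> coords ` C \<subseteq> W"
      using Elementary_Topology.tube_lemma[OF C W, of k] unfolding N_def by blast
    then have "X \<subseteq> N" unfolding N_def by blast
    with X show "\<exists>T. open T \<and> k \<in> T \<and> T \<subseteq> N" by blast
  qed
  have "right_action -` V \<inter> SO = SO \<inter> N"
  proof -
    have "right_action k ` C \<subseteq> U \<longleftrightarrow> k \<in> N" if k: "k \<in> SO" for k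
    proof -
      have "right_action k p = from_coords (coords p v* k)" if "p \<in> C" for p
        using right_action_from_coords[OF k, of "coords p"] from_coords_coords[of p] CQ that by auto
      moreover have "k \<in> N \<longleftrightarrow> (\<forall>p\<in>C. from_coords (coords p v* k) \<in> U)"
        unfolding N_def W_def U'_def by (simp add: subset_iff) blast
      ultimately show ?thesis by auto
    qed
    then show ?thesis using right_action_Isom unfolding V(1) by blast
  qed
  then show "openin (top_of_set SO) (right_action -` V \<inter> topspace (top_of_set SO))"
    using \<open>open N\<close> by (simp add: openin_open_Int)
qed

lemma in_coords_eqD:
  assumes "F \<in> Isom" "F' \<in> Isom" "in_coords F = in_coords F'" shows "F = F'"
proof (rule extensionalityI)
  show "F \<in> extensional Q" "F' \<in> extensional Q" using assms by (auto simp: Isom_def)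
  fix p assume "p \<in> (Q :: 'a mat1 set set)"
  then obtain y where "p = from_coords y" by (auto simp: Q_eq)
  moreover have "F ` Q \<subseteq> Q" "F' ` Q \<subseteq> Q" using assms by (auto simp: Isom_def Q_smooth_map_def)
  ultimately show "F p = F' p" using assms(3) by (simp add: from_coords_in_coords)
qed

theorem theorem4p4:
  assumes "CARD('n::{finite,linorder}) \<ge> 2"
  shows "(Isom0 :: ('n mat1 set \<Rightarrow> 'n mat1 set) set) = right_action ` SO"
proof
  have id: "right_action (mat 1) = (restrict id Q :: 'n mat1 set \<Rightarrow> _)"
    by (auto simp: right_action_def block_diag_mat_1 fun_eq_iff restrict_def)
  have conn: "connectedin Isom_topology (right_action ` SO :: ('n mat1 set \<Rightarrow> _) set)"
    by (rule connectedin_continuous_map_image[OF continuous_map_right_action])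
       (simp add: connectedin_subtopology SO_connected)
  show "right_action ` SO \<subseteq> (Isom0 :: ('n mat1 set \<Rightarrow> _) set)"
    unfolding Isom0_def id[symmetric]
    by (rule connected_component_of_maximal[OF conn]) (rule imageI[OF mat_1_SO])
  show "(Isom0 :: ('n mat1 set \<Rightarrow> _) set) \<subseteq> right_action ` SO"
  proof
    fix F :: "'n mat1 set \<Rightarrow> 'n mat1 set" assume F0: "F \<in> Isom0"
    let ?det = "\<lambda>F :: 'n mat1 set \<Rightarrow> 'n mat1 set. det (matrix (in_coords F))"
    have sub: "Isom0 \<subseteq> (Isom :: ('n mat1 set \<Rightarrow> _) set)"
      unfolding Isom0_def using connected_component_of_subset_topspace topspace_Isom by metis
    have pm: "?det E = 1 \<or> ?det E = -1" if "E \<in> Isom0" for E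
      using Isom_in_coords[OF assms, of E] sub that
      by (intro det_orthogonal_matrix) (auto simp: orthogonal_transformation_matrix)
    have I: "right_action (mat 1) \<in> (Isom0 :: ('n mat1 set \<Rightarrow> _) set)"
      using \<open>right_action ` SO \<subseteq> Isom0\<close> mat_1_SO by blast
    have "in_coords (right_action (mat 1)) = (\<lambda>y :: (real, 'n) vec. y)"
      by (simp add: in_coords_right_action mat_1_SO)
    then have 1: "?det (right_action (mat 1)) = 1" by (simp add: matrix_id_mat_1[unfolded id_def])
    have "connected (?det ` Isom0)"
      using connectedin_continuous_map_image[OF continuous_map_det_in_coords, of Isom0]
        connectedin_connected_component_of[of Isom_topology "restrict id Q"]
      by (simp add: Isom0_def)
    moreover have "finite (?det ` Isom0)"
      by (rule finite_subset[of _ "{1, -1}"]) (use pm in auto)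
    ultimately obtain c where "?det ` Isom0 \<subseteq> {c}"
      using connected_finite_iff_sing by (metis subset_singleton_iff)
    then have det: "?det F = 1" using F0 I 1 by (metis image_subset_iff singletonD)
    define k where "k = transpose (matrix (in_coords F))"
    have o: "orthogonal_transformation (in_coords F)" using Isom_in_coords[OF assms] F0 sub by blast
    then have k: "k \<in> SO"
      using det by (simp add: SO_def k_def orthogonal_transformation_matrix orthogonal_matrix_transpose det_transpose)
    have "in_coords F y = in_coords (right_action k) y" for y
      using o matrix_works[of "in_coords F" y] unfolding in_coords_right_action[OF k]
      by (simp add: k_def orthogonal_transformation_def linear_matrix_vector_mul_eq)
    then have "F = right_action k"
      using in_coords_eqD[of F "right_action k"] F0 sub right_action_Isom[OF k] by blast
    then show "F \<in> right_action ` SO" using k by blast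
  qed
qed

end
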